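(* Let $F$ be a subfield of $\mathbb{C}$ such that $\mathrm{tr.deg.}_E F$ is finite. Then there exist $t_1,\dots,t_m\in\mathbb{C}$ such that: (E1) $F\subseteq\overline{E(\mathbf{t},\exp(\mathbf{t}))}$, and (E2) $\mathrm{tr.deg.}_E E(\mathbf{t},\exp(\mathbf{t}))=\mathrm{lin.dim}_{\mathbb{Q}}(\mathbf{t}|E)+\dim^{e}(\mathbf{t}|E)$.
   Context: An exponential derivation of $\mathbb{C}$ over $A\subseteq\mathbb{C}$ is a field derivation $\partial:\mathbb{C}\to\mathbb{C}$ vanishing on $A$ such that $\partial(\exp(z))=\exp(z)\partial(z)$ for all $z\in\mathbb{C}$; $\mathrm{ecl}(A)$ is the intersection of the kernels of all such derivations. $\mathrm{ecl}$ is a pregeometry on $\mathbb{C}$ and $\dim^{e}$ denotes its dimension function. $E=\mathrm{ecl}(\emptyset)$. For $A,B\subseteq\mathbb{C}$, $\mathrm{lin.dim}_{\mathbb{Q}}(A|B)$ is the dimension of the $\mathbb{Q}$-span of $A\cup B$ modulo the $\mathbb{Q}$-span of $B$. $\overline{\,\cdot\,}$ is algebraic closure in $\mathbb{C}$, and $\exp(\mathbf{t})=(\exp(t_1),\dots,\exp(t_m))$. *)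

theory Defs
  imports
    Complex_Main
    "HOL-Library.Extended_Nat"
    "HOL-Library.Poly_Mapping"
    "HOL-Computational_Algebra.Polynomial"
begin

section \<open>Subfields, algebraic closure and transcendence degree\<close>

definition is_subfield :: "'a::field set \<Rightarrow> bool" where
  "is_subfield K \<longleftrightarrow> 0 \<in> K \<and> 1 \<in> K \<and>
     (\<forall>x\<in>K. \<forall>y\<in>K. x + y \<in> K \<and> x * y \<in> K) \<and> (\<forall>x\<in>K. - x \<in> K \<and> inverse x \<in> K)"

definition generated_subfield :: "'a::field set \<Rightarrow> 'a set" where
  "generated_subfield A = \<Inter>{K. is_subfield K \<and> A \<subseteq> K}"

definition algebraic_closure_in :: "'a::field set \<Rightarrow> 'a set" where
  "algebraic_closure_in K = {x. \<exists>p. p \<noteq> 0 \<and> (\<forall>i. coeff p i \<in> K) \<and> poly p x = 0}"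

text \<open>
  A polynomial whose variables are indexed by the elements of the field is a finitely supported
  map from monomials (themselves finitely supported exponent maps) to coefficients; it is
  evaluated here by sending the variable with index \<open>x\<close> to \<open>x\<close> itself.
\<close>

definition self_eval :: "(('a::field \<Rightarrow>\<^sub>0 nat) \<Rightarrow>\<^sub>0 'a) \<Rightarrow> 'a" where
  "self_eval p = (\<Sum>m\<in>Poly_Mapping.keys p.
     Poly_Mapping.lookup p m * (\<Prod>x\<in>Poly_Mapping.keys m. x ^ Poly_Mapping.lookup m x))"

definition alg_independent :: "'a::field set \<Rightarrow> 'a set \<Rightarrow> bool" where
  "alg_independent K S \<longleftrightarrow>
     (\<forall>p. (\<forall>m. Poly_Mapping.lookup p m \<in> K) \<longrightarrow>
          (\<forall>m\<in>Poly_Mapping.keys p. Poly_Mapping.keys m \<subseteq> S) \<longrightarrow>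
          self_eval p = 0 \<longrightarrow> p = 0)"

text \<open>
  Dimensions below are suprema, in \<^typ>\<open>enat\<close>, of the cardinalities of finite independent
  sets. So infinite dimensions are all identified with \<open>\<infinity>\<close>, and a finite dimension is the common
  cardinality of all bases. In the transcendence degree, \<open>L\<close> need not contain \<open>K\<close>: the value is
  then that of the compositum of \<open>K\<close> and \<open>L\<close> over \<open>K\<close>.
\<close>

definition trdeg :: "'a::field set \<Rightarrow> 'a set \<Rightarrow> enat" where
  "trdeg K L = Sup {enat (card S) | S. finite S \<and> S \<subseteq> L \<and> alg_independent K S}"

section \<open>Linear dimension over the rationals\<close>

definition rat_span :: "complex set \<Rightarrow> complex set" where
  "rat_span = module.span (\<lambda>(q::rat) z. of_rat q * z)"

definition rat_independent_mod :: "complex set \<Rightarrow> complex set \<Rightarrow> bool" where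
  "rat_independent_mod V S \<longleftrightarrow>
     (\<forall>q :: complex \<Rightarrow> rat. (\<Sum>s\<in>S. of_rat (q s) * s) \<in> V \<longrightarrow> (\<forall>s\<in>S. q s = 0))"

text \<open>The dimension of the quotient of \<open>rat_span (A \<union> B)\<close> by \<open>rat_span B\<close>: a set that is
  independent modulo \<open>rat_span B\<close> maps injectively to a linearly independent set of cosets.\<close>

definition rat_lin_dim :: "complex set \<Rightarrow> complex set \<Rightarrow> enat" where
  "rat_lin_dim A B =
     Sup {enat (card S) | S. finite S \<and> S \<subseteq> rat_span (A \<union> B) \<and> rat_independent_mod (rat_span B) S}"

lemma vector_space_rat_complex: "vector_space (\<lambda>(q::rat) (z::complex). of_rat q * z)"
  by unfold_locales (simp_all add: algebra_simps of_rat_add of_rat_mult)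

section \<open>Exponential algebraic closure\<close>

definition exp_derivation :: "complex set \<Rightarrow> (complex \<Rightarrow> complex) \<Rightarrow> bool" where
  "exp_derivation A D \<longleftrightarrow>
     (\<forall>x y. D (x + y) = D x + D y) \<and> (\<forall>x y. D (x * y) = x * D y + y * D x) \<and>
     (\<forall>a\<in>A. D a = 0) \<and> (\<forall>z. D (exp z) = exp z * D z)"

definition ecl :: "complex set \<Rightarrow> complex set" where
  "ecl A = \<Inter>{{z. D z = 0} | D. exp_derivation A D}"

definition pregeometry_independent :: "('a set \<Rightarrow> 'a set) \<Rightarrow> 'a set \<Rightarrow> 'a set \<Rightarrow> bool" where
  "pregeometry_independent cl B S \<longleftrightarrow> (\<forall>s\<in>S. s \<notin> cl (B \<union> (S - {s})))"

definition pregeometry_dim :: "('a set \<Rightarrow> 'a set) \<Rightarrow> 'a set \<Rightarrow> 'a set \<Rightarrow> enat" where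
  "pregeometry_dim cl A B =
     Sup {enat (card S) | S. finite S \<and> S \<subseteq> A \<and> pregeometry_independent cl B S}"

abbreviation exp_dim :: "complex set \<Rightarrow> complex set \<Rightarrow> enat" where
  "exp_dim \<equiv> pregeometry_dim ecl"

end

(* Over E = ecl {}, write V for the space of Kaehler differentials and w(z) = d exp(z)/exp(z) - dz; let W be the span of all
   w(z). Exponential derivations are the linear functionals on V that vanish on W. For finite t, put U(t) = span(dt, w(t)).
   Then the transcendence degree of E(t, exp t) over E is dim U(t), the exponential dimension of t is the dimension of
   span(dt) modulo W, and by Ax's theorem lin.dim(t|E) = dim span w(t). Hence (E2) says that U(t) meets W in span w(t) only.
   This holds when t minimizes dim U(t) - dim span w(t) among the finite sets that contain a given transcendence basis of F
   over E, which also gives (E1); the argument is Kirby's: if U(t) met W in more, Ax's theorem, applied over a field of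
   constants, would yield a larger set with a smaller difference.

   For Ax's theorem, take a shortest linear relation between the w(z). Brackets with derivations show that its coefficients
   are constants, and minimality that they are linearly independent over the rationals; so one has
   sum c_i dy_i/y_i = du with constant c_i. Norms and traces move this relation to a rational function field in one variable,
   where comparing residues gives a contradiction unless the y_i are constants. *)
theory Submission
  imports Defs "HOL-Computational_Algebra.Computational_Algebra" "HOL-Library.Function_Algebras"
begin

section \<open>Polynomials over a subfield\<close>

text \<open>All fields are subsets of one type, and in characteristic zero every derivation of a
  subfield extends to the whole type. Total derivations therefore detect algebraic dependence as
  well as membership in \<open>ecl\<close>, and the three dimensions in (E2) can be compared inside
  one vector space: the exponential dimension of t is dim U(t) - dim(U(t) \<inter> W).

  The obstacle is that an element of U(t) \<inter> W may involve forms w(s) with s outside t, and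
  that these s may be rationally dependent modulo the relevant field K of constants, which can
  exceed E. Ax's theorem controls only a part S that is independent modulo K; the rest is shifted
  into K, and the shifted elements are what enlarges t. Modularity of dimension gains at least 1,
  and the size of S enters both remaining estimates and cancels, so the gain survives.

  The residue argument needs a variable z such that u and all y_i are algebraic over M(z). Taking
  for z a y_i outside the constants, and for M a maximal field over which z is transcendental,
  provides this; under norms z becomes a power z^n with n > 0, whose order at 0 is still
  nonzero.\<close>

definition poly_over :: "'a::zero set \<Rightarrow> 'a poly set" where
  "poly_over K = {p. \<forall>i. coeff p i \<in> K}"

lemma coeff_poly_over: "p \<in> poly_over K \<Longrightarrow> coeff p i \<in> K"
  by (simp add: poly_over_def)

lemma poly_over_mono: "K \<subseteq> L \<Longrightarrow> poly_over K \<subseteq> poly_over L"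
  by (auto simp: poly_over_def)

context
  fixes K :: "'a::field set"
  assumes K: "is_subfield K"
begin

lemma subfield_0: "0 \<in> K" and subfield_1: "1 \<in> K"
  and subfield_add: "x \<in> K \<Longrightarrow> y \<in> K \<Longrightarrow> x + y \<in> K"
  and subfield_mult: "x \<in> K \<Longrightarrow> y \<in> K \<Longrightarrow> x * y \<in> K"
  and subfield_uminus: "x \<in> K \<Longrightarrow> - x \<in> K"
  and subfield_inverse: "x \<in> K \<Longrightarrow> inverse x \<in> K"
  using K by (auto simp: is_subfield_def)

lemma subfield_diff: "x \<in> K \<Longrightarrow> y \<in> K \<Longrightarrow> x - y \<in> K"
  using subfield_add[of x "- y"] subfield_uminus[of y] by simp

lemma subfield_divide: "x \<in> K \<Longrightarrow> y \<in> K \<Longrightarrow> x / y \<in> K"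
  by (simp add: divide_inverse subfield_mult subfield_inverse)

lemma subfield_power: "x \<in> K \<Longrightarrow> x ^ n \<in> K"
  by (induction n) (simp_all add: subfield_1 subfield_mult)

lemma subfield_of_nat: "of_nat n \<in> K"
  by (induction n) (simp_all add: subfield_0 subfield_1 subfield_add)

lemma subfield_sum: "(\<And>i. i \<in> A \<Longrightarrow> f i \<in> K) \<Longrightarrow> sum f A \<in> K"
  by (induction A rule: infinite_finite_induct) (simp_all add: subfield_0 subfield_add)

lemma subfield_prod: "(\<And>i. i \<in> A \<Longrightarrow> f i \<in> K) \<Longrightarrow> prod f A \<in> K"
  by (induction A rule: infinite_finite_induct) (simp_all add: subfield_1 subfield_mult)

lemma poly_over_0: "0 \<in> poly_over K"
  by (simp add: poly_over_def subfield_0)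

lemma poly_over_const: "c \<in> K \<Longrightarrow> [:c:] \<in> poly_over K"
  by (auto simp: poly_over_def coeff_pCons subfield_0 split: nat.split)

lemma poly_over_1: "1 \<in> poly_over K"
  using poly_over_const[OF subfield_1] by (simp add: one_pCons)

lemma poly_over_X: "[:0, 1:] \<in> poly_over K"
  by (auto simp: poly_over_def coeff_pCons subfield_0 subfield_1 split: nat.split)

lemma poly_over_add: "p \<in> poly_over K \<Longrightarrow> q \<in> poly_over K \<Longrightarrow> p + q \<in> poly_over K"
  and poly_over_uminus: "p \<in> poly_over K \<Longrightarrow> - p \<in> poly_over K"
  and poly_over_diff: "p \<in> poly_over K \<Longrightarrow> q \<in> poly_over K \<Longrightarrow> p - q \<in> poly_over K"
  by (simp_all add: poly_over_def subfield_add subfield_uminus subfield_diff)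

lemma poly_over_mult: "p \<in> poly_over K \<Longrightarrow> q \<in> poly_over K \<Longrightarrow> p * q \<in> poly_over K"
  by (auto simp: poly_over_def coeff_mult intro!: subfield_sum subfield_mult)

lemma poly_over_power: "p \<in> poly_over K \<Longrightarrow> p ^ n \<in> poly_over K"
  by (induction n) (simp_all add: poly_over_1 poly_over_mult)

lemma poly_over_sum: "(\<And>i. i \<in> A \<Longrightarrow> f i \<in> poly_over K) \<Longrightarrow> sum f A \<in> poly_over K"
  by (induction A rule: infinite_finite_induct) (simp_all add: poly_over_0 poly_over_add)

lemma poly_over_monom: "c \<in> K \<Longrightarrow> monom c n \<in> poly_over K"
  by (auto simp: poly_over_def subfield_0)

lemma poly_over_pderiv: "p \<in> poly_over K \<Longrightarrow> pderiv p \<in> poly_over K"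
  using subfield_mult[OF subfield_of_nat] by (auto simp: poly_over_def coeff_pderiv simp flip: of_nat_Suc)

lemma poly_in_subfield: "p \<in> poly_over K \<Longrightarrow> x \<in> K \<Longrightarrow> poly p x \<in> K"
  by (auto simp: poly_altdef poly_over_def intro!: subfield_sum subfield_mult subfield_power)

text \<open>Long division: only the leading coefficient of \<open>P\<close> is inverted, so quotient
  and remainder keep their coefficients in \<open>K\<close>.\<close>

lemma poly_over_division:
  assumes "P \<in> poly_over K" "P \<noteq> 0" "q \<in> poly_over K"
  obtains h r where "h \<in> poly_over K" "r \<in> poly_over K" "q = P * h + r" "r = 0 \<or> degree r < degree P"
proof -
  have "\<exists>h\<in>poly_over K. \<exists>r\<in>poly_over K. q = P * h + r \<and> (r = 0 \<or> degree r < degree P)"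
    using assms(3)
  proof (induction "degree q" arbitrary: q rule: less_induct)
    case (less q)
    show ?case
    proof (cases "q = 0 \<or> degree q < degree P")
      case True
      then show ?thesis using less.prems poly_over_0 by force
    next
      case False
      define m where "m = monom (lead_coeff q / lead_coeff P) (degree q - degree P)"
      have m: "m \<in> poly_over K"
        unfolding m_def by (intro poly_over_monom subfield_divide coeff_poly_over less.prems assms(1))
      define q' where "q' = q - P * m"
      have q': "q' \<in> poly_over K"
        unfolding q'_def by (intro poly_over_diff poly_over_mult less.prems assms(1) m)
      have m0: "m \<noteq> 0" using False \<open>P \<noteq> 0\<close> by (auto simp: m_def)
      have "degree (P * m) = degree q"
        using False \<open>P \<noteq> 0\<close> m0 by (subst degree_mult_eq) (auto simp: m_def degree_monom_eq)
      moreover have "coeff (P * m) (degree q) = lead_coeff q"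
        using False \<open>P \<noteq> 0\<close> by (auto simp: m_def mult.commute[of P] coeff_monom_mult)
      ultimately have "q' = 0 \<or> degree q' < degree q"
        unfolding q'_def by (metis coeff_diff degree_diff_le diff_self eq_zero_or_degree_less order_refl)
      then have "\<exists>h\<in>poly_over K. \<exists>r\<in>poly_over K. q' = P * h + r \<and> (r = 0 \<or> degree r < degree P)"
      proof
        assume "q' = 0"
        then show ?thesis using poly_over_0 by (intro bexI[of _ 0]) auto
      next
        assume "degree q' < degree q"
        then show ?thesis using less.hyps q' by blast
      qed
      then obtain h r where "h \<in> poly_over K" "r \<in> poly_over K" "q' = P * h + r" "r = 0 \<or> degree r < degree P"
        by blast
      moreover from this(3) have "q = P * (h + m) + r"
        by (simp add: q'_def algebra_simps)
      ultimately show ?thesis using m poly_over_add by blast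
    qed
  qed
  then show ?thesis using that by blast
qed

text \<open>Minimality is encoded as generating the ideal of annihilators of \<open>x\<close> over
  \<open>K\<close>, the form in which it is applied; \<open>P\<close> is determined up to a nonzero
  factor in \<open>K\<close>.\<close>

definition minimal_poly :: "'a \<Rightarrow> 'a poly \<Rightarrow> bool" where
  "minimal_poly x P \<longleftrightarrow> P \<in> poly_over K \<and> P \<noteq> 0 \<and> poly P x = 0 \<and>
     (\<forall>q\<in>poly_over K. poly q x = 0 \<longrightarrow> (\<exists>h\<in>poly_over K. q = P * h))"

lemma minimal_poly_factor:
  assumes "minimal_poly x P" "q \<in> poly_over K" "poly q x = 0"
  obtains h where "h \<in> poly_over K" "q = P * h"
  using assms unfolding minimal_poly_def by auto

text \<open>A nonzero annihilator of least degree divides every other one, since a nonzero remainder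
  would be an annihilator of smaller degree.\<close>

lemma minimal_poly_exists:
  assumes "x \<in> algebraic_closure_in K"
  obtains P where "minimal_poly x P"
proof -
  let ?A = "\<lambda>P. P \<in> poly_over K \<and> P \<noteq> 0 \<and> poly P x = 0"
  have "\<exists>P. ?A P" using assms by (auto simp: algebraic_closure_in_def poly_over_def)
  then obtain P where P: "?A P" and min: "\<And>Q. ?A Q \<Longrightarrow> degree P \<le> degree Q"
    using ex_has_least_nat[of ?A _ degree] by blast
  have "\<exists>h\<in>poly_over K. q = P * h" if q: "q \<in> poly_over K" "poly q x = 0" for q
  proof -
    obtain h r where hr: "h \<in> poly_over K" "r \<in> poly_over K" "q = P * h + r" "r = 0 \<or> degree r < degree P"
      using poly_over_division P q(1) by blast
    then have "poly r x = 0" using P q(2) by simp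
    then have "r = 0" using hr(2,4) min[of r] by (cases "r = 0") auto
    then show ?thesis using hr by auto
  qed
  then show ?thesis using that P by (auto simp: minimal_poly_def)
qed

lemma minimal_poly_degree_pos: "minimal_poly x P \<Longrightarrow> degree P > 0"
  by (metis degree_eq_zeroE gr0I minimal_poly_def pCons_0_0 poly_const_conv)

text \<open>Irreducibility of \<open>P\<close> in disguise: the minimal polynomial \<open>P'\<close>
  of \<open>y\<close> divides \<open>P\<close>, and the cofactor cannot vanish at \<open>x\<close>,
  so \<open>P'\<close> vanishes at \<open>x\<close> too.\<close>

lemma minimal_poly_conjugate:
  assumes P: "minimal_poly x P" and y: "poly P y = 0" and q: "q \<in> poly_over K"
  shows "poly q y = 0 \<longleftrightarrow> poly q x = 0"
proof
  assume "poly q x = 0"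
  then obtain h where "q = P * h" using P q by (auto simp: minimal_poly_def)
  then show "poly q y = 0" using y by simp
next
  assume qy: "poly q y = 0"
  have "y \<in> algebraic_closure_in K"
    using P y by (auto simp: minimal_poly_def poly_over_def algebraic_closure_in_def)
  then obtain P' where P': "minimal_poly y P'" by (rule minimal_poly_exists)
  then obtain h where h: "h \<in> poly_over K" "P = P' * h"
    using P y by (auto simp: minimal_poly_def)
  have h0: "h \<noteq> 0" using h P by (auto simp: minimal_poly_def)
  obtain g where g: "q = P' * g" using P' q qy by (auto simp: minimal_poly_def)
  have "poly P' x * poly h x = 0" using P h by (simp add: minimal_poly_def)
  moreover have "poly h x \<noteq> 0"
  proof
    assume "poly h x = 0"
    then obtain k where k: "h = P * k" using P h by (auto simp: minimal_poly_def)
    \<comment> \<open>From \<open>h = P * k\<close> and \<open>P = P' * h\<close>; this would force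
      \<open>P'\<close> to have degree 0.\<close>
    then have "degree h = degree P' + degree h + degree k"
      using h h0 P' by (metis degree_mult_eq mult_eq_0_iff)
    then show False using minimal_poly_degree_pos[OF P'] by simp
  qed
  ultimately show "poly q x = 0" using g by simp
qed

end

text \<open>Separability in characteristic zero: at a common root, \<open>pderiv P\<close> would be
  a nonzero multiple of \<open>P\<close> of smaller degree.\<close>

lemma minimal_poly_simple:
  fixes K :: "'a::field_char_0 set"
  assumes K: "is_subfield K" and P: "minimal_poly K x P" and y: "poly P y = 0"
  shows "poly (pderiv P) y \<noteq> 0"
proof
  assume "poly (pderiv P) y = 0"
  moreover have D: "pderiv P \<in> poly_over K" using K P by (auto simp: minimal_poly_def[OF K] intro: poly_over_pderiv)
  ultimately have "poly (pderiv P) x = 0" using minimal_poly_conjugate[OF K P y] by blast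
  then obtain h where h: "pderiv P = P * h" using P D by (auto simp: minimal_poly_def[OF K])
  have "pderiv P \<noteq> 0" using minimal_poly_degree_pos[OF K P] by (simp add: pderiv_eq_0_iff)
  then have "degree (pderiv P) \<ge> degree P" using h by (metis degree_mult_right_le mult_eq_0_iff)
  then show False using minimal_poly_degree_pos[OF K P] by (simp add: degree_pderiv)
qed

section \<open>Generated subfields and simple extensions\<close>

lemma subfield_generated: "is_subfield (generated_subfield A)"
  unfolding is_subfield_def generated_subfield_def by blast

lemma generated_subfield_superset: "A \<subseteq> generated_subfield A"
  unfolding generated_subfield_def by blast

lemma generated_subfield_least: "is_subfield K \<Longrightarrow> A \<subseteq> K \<Longrightarrow> generated_subfield A \<subseteq> K"
  unfolding generated_subfield_def by blast

lemma generated_subfield_mono: "A \<subseteq> B \<Longrightarrow> generated_subfield A \<subseteq> generated_subfield B"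
  unfolding generated_subfield_def by blast

lemma algebraic_closure_in_mono: "K \<subseteq> L \<Longrightarrow> algebraic_closure_in K \<subseteq> algebraic_closure_in L"
  unfolding algebraic_closure_in_def by blast

text \<open>An explicit form of the simple extension \<open>K(x)\<close>: maps out of it can be
  defined on fractions of polynomials.\<close>

definition adjoin :: "'a::field set \<Rightarrow> 'a \<Rightarrow> 'a set" where
  "adjoin K x = {poly f x / poly g x | f g. f \<in> poly_over K \<and> g \<in> poly_over K \<and> poly g x \<noteq> 0}"

context
  fixes K :: "'a::field set"
  assumes K: "is_subfield K"
begin

lemma poly_in_adjoin: "f \<in> poly_over K \<Longrightarrow> poly f x \<in> adjoin K x"
  unfolding adjoin_def using poly_over_1[OF K] by (fastforce intro: exI[of _ "1 :: 'a poly"])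

lemma adjoin_base: "K \<subseteq> adjoin K x"
  using poly_in_adjoin[of "[:_:]" x] poly_over_const[OF K] by fastforce

lemma adjoin_generator: "x \<in> adjoin K x"
  using poly_in_adjoin[of "[:0, 1:]" x] poly_over_X[OF K] by simp

lemma subfield_adjoin: "is_subfield (adjoin K x)"
  unfolding is_subfield_def
proof (intro conjI ballI)
  show "0 \<in> adjoin K x" "1 \<in> adjoin K x"
    using adjoin_base subfield_0[OF K] subfield_1[OF K] by blast+
next
  fix a b assume "a \<in> adjoin K x" "b \<in> adjoin K x"
  then obtain f g f' g' where *: "f \<in> poly_over K" "g \<in> poly_over K" "poly g x \<noteq> 0" "a = poly f x / poly g x"
    "f' \<in> poly_over K" "g' \<in> poly_over K" "poly g' x \<noteq> 0" "b = poly f' x / poly g' x"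
    unfolding adjoin_def by blast
  have "a + b = poly (f * g' + f' * g) x / poly (g * g') x" "poly (g * g') x \<noteq> 0"
    using * by (simp_all add: add_frac_eq)
  then show "a + b \<in> adjoin K x"
    unfolding adjoin_def using * poly_over_add[OF K] poly_over_mult[OF K] by blast
  have "a * b = poly (f * f') x / poly (g * g') x" using * by simp
  then show "a * b \<in> adjoin K x"
    unfolding adjoin_def using * \<open>poly (g * g') x \<noteq> 0\<close> poly_over_mult[OF K] by blast
next
  fix a assume "a \<in> adjoin K x"
  then obtain f g where *: "f \<in> poly_over K" "g \<in> poly_over K" "poly g x \<noteq> 0" "a = poly f x / poly g x"
    unfolding adjoin_def by blast
  have "- a = poly (- f) x / poly g x" using * by simp
  then show "- a \<in> adjoin K x"
    unfolding adjoin_def using * poly_over_uminus[OF K] by blast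
  show "inverse a \<in> adjoin K x"
  proof (cases "poly f x = 0")
    case True
    then show ?thesis using * \<open>- a \<in> adjoin K x\<close> by simp
  next
    case False
    have "inverse a = poly g x / poly f x" using * by simp
    then show ?thesis unfolding adjoin_def using * False by blast
  qed
qed

lemma adjoin_least: "is_subfield L \<Longrightarrow> K \<subseteq> L \<Longrightarrow> x \<in> L \<Longrightarrow> adjoin K x \<subseteq> L"
  unfolding adjoin_def using poly_over_mono[of K L]
  by (auto intro!: subfield_divide poly_in_subfield)

text \<open>The inverse of \<open>poly g x\<close> is found by Euclidean descent on
  \<open>degree g\<close>: \<open>g\<close> is replaced by its remainder modulo \<open>P\<close> or,
  once its degree is below that of \<open>P\<close>, by the remainder of \<open>P\<close> modulo
  \<open>g\<close>.\<close>

lemma adjoin_algebraic: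
  assumes "x \<in> algebraic_closure_in K"
  shows "adjoin K x = {poly f x | f. f \<in> poly_over K}"
proof -
  obtain P where P: "minimal_poly K x P" using minimal_poly_exists[OF K assms] .
  have inv: "\<exists>b\<in>poly_over K. poly g x * poly b x = 1" if "g \<in> poly_over K" "poly g x \<noteq> 0" for g
    using that
  proof (induction "degree g" arbitrary: g rule: less_induct)
    case (less g)
    show ?case
    proof (cases "degree g = 0")
      case True
      then obtain c where c: "g = [:c:]" using degree_eq_zeroE by blast
      then have "c \<in> K" using coeff_poly_over[OF less.prems(1), of 0] by simp
      then show ?thesis using c less.prems
        by (intro bexI[of _ "[:inverse c:]"]) (auto intro!: poly_over_const[OF K] subfield_inverse[OF K])
    next
      case False
      note nonconst = this
      have P0: "P \<noteq> 0" and PK: "P \<in> poly_over K" and Px: "poly P x = 0"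
        using P by (auto simp: minimal_poly_def[OF K])
      have g0: "g \<noteq> 0" using less.prems by auto
      show ?thesis
      proof (cases "degree P \<le> degree g")
        case True
        obtain h r where hr: "h \<in> poly_over K" "r \<in> poly_over K" "g = P * h + r" "r = 0 \<or> degree r < degree P"
          using poly_over_division[OF K PK P0 less.prems(1)] .
        have eq: "poly g x = poly r x" unfolding hr(3) using Px by simp
        then have "r \<noteq> 0" using less.prems(2) by auto
        then have "degree r < degree g" using hr(4) True by linarith
        then show ?thesis using less.hyps[of r] hr(2) less.prems(2) unfolding eq by blast
      next
        case False
        note deg = this
        obtain q r where qr: "q \<in> poly_over K" "r \<in> poly_over K" "P = g * q + r" "r = 0 \<or> degree r < degree g"
          using poly_over_division[OF K less.prems(1) g0 PK] .
        \<comment> \<open>Otherwise \<open>r\<close>, of degree below \<open>P\<close>, is 0 and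
          \<open>P = g * q\<close>. Then \<open>q\<close> vanishes at \<open>x\<close> and is a
          multiple of \<open>P\<close>, so that \<open>g\<close> would be constant.\<close>
        have "poly r x \<noteq> 0"
        proof
          assume r0: "poly r x = 0"
          then obtain k where "r = P * k" using P qr by (auto simp: minimal_poly_def[OF K])
          then have "degree r \<ge> degree P \<or> r = 0" using P0 by (cases "k = 0") (simp_all add: degree_mult_eq)
          then have "r = 0" using qr(4) deg by linarith
          from r0 have "poly g x * poly q x = 0" using qr(3) Px by simp
          then have "poly q x = 0" using less.prems by simp
          then obtain h where "q = P * h" using P qr by (auto simp: minimal_poly_def[OF K])
          then have "P * (g * h) = g * q" by (simp only: mult.left_commute)
          then have "P * (g * h) = P * 1" using qr(3) \<open>r = 0\<close> by (simp only: add_0_right mult_1_right)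
          then have "g * h = 1" using P0 mult_left_cancel by blast
          then have "degree g + degree h = 0"
            using degree_mult_eq[of g h] by (cases "g = 0 \<or> h = 0") auto
          then show False using nonconst by simp
        qed
        then obtain b where b: "b \<in> poly_over K" "poly r x * poly b x = 1"
          using less.hyps[of r] qr by auto
        have "poly g x * poly q x = - poly r x"
          using qr(3) Px by (simp add: eq_neg_iff_add_eq_0)
        then have "poly g x * poly (- (q * b)) x = 1" using b
          by (simp add: mult.assoc[symmetric])
        then show ?thesis using qr b poly_over_uminus[OF K] poly_over_mult[OF K] by blast
      qed
    qed
  qed
  show ?thesis
  proof
    show "adjoin K x \<subseteq> {poly f x | f. f \<in> poly_over K}"
    proof
      fix a assume "a \<in> adjoin K x"
      then obtain f g where *: "f \<in> poly_over K" "g \<in> poly_over K" "poly g x \<noteq> 0" "a = poly f x / poly g x"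
        unfolding adjoin_def by blast
      obtain b where b: "b \<in> poly_over K" "poly g x * poly b x = 1" using inv * by blast
      have "inverse (poly g x) = poly b x" using b(2) by (rule inverse_unique)
      then have "a = poly (f * b) x" using *(4) by (simp add: divide_inverse)
      then show "a \<in> {poly f x | f. f \<in> poly_over K}" using * b poly_over_mult[OF K] by blast
    qed
  qed (use poly_in_adjoin in blast)
qed

end

section \<open>Derivations\<close>

text \<open>The quotient rule does not depend on the fraction: \<open>d\<close>, \<open>e\<close>,
  \<open>d'\<close>, \<open>e'\<close> stand for the derivatives of \<open>F\<close>,
  \<open>G\<close>, \<open>F'\<close>, \<open>G'\<close>, and the first hypothesis is the derivative
  of the second.\<close>

lemma quotient_rule_unique:
  fixes F G :: "'a::field"
  assumes "F * e' + G' * d = F' * e + G * d'" "F * G' = F' * G" "G \<noteq> 0" "G' \<noteq> 0"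
  shows "(d * G - F * e) / (G * G) = (d' * G' - F' * e') / (G' * G')"
proof -
  have "(d * G - F * e) * (G' * G') - (d' * G' - F' * e') * (G * G)
    = G * G' * ((F * e' + G' * d) - (F' * e + G * d')) + (F' * G - F * G') * (e * G' + e' * G)"
    by (simp add: algebra_simps)
  also have "\<dots> = 0" unfolding assms(1,2) by simp
  finally show ?thesis using assms(3,4) by (simp add: frac_eq_eq)
qed

text \<open>Values may lie outside \<open>L\<close>; this freedom is what extension to larger
  subfields requires.\<close>

definition derivation_on :: "'a::field set \<Rightarrow> ('a \<Rightarrow> 'a) \<Rightarrow> bool" where
  "derivation_on L D \<longleftrightarrow> (\<forall>x\<in>L. \<forall>y\<in>L. D (x + y) = D x + D y \<and> D (x * y) = x * D y + y * D x)"

context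
  fixes L :: "'a::field set" and D :: "'a \<Rightarrow> 'a"
  assumes L: "is_subfield L" and D: "derivation_on L D"
begin

lemma derivation_add: "x \<in> L \<Longrightarrow> y \<in> L \<Longrightarrow> D (x + y) = D x + D y"
  and derivation_mult: "x \<in> L \<Longrightarrow> y \<in> L \<Longrightarrow> D (x * y) = x * D y + y * D x"
  using D by (auto simp: derivation_on_def)

lemma derivation_0: "D 0 = 0"
proof -
  have "D 0 + D 0 = D 0 + 0" using derivation_add[of 0 0] subfield_0[OF L] by simp
  then show ?thesis by (rule add_left_imp_eq)
qed

lemma derivation_1: "D 1 = 0"
proof -
  have "D 1 + D 1 = D 1 + 0" using derivation_mult[of 1 1] subfield_1[OF L] by simp
  then show ?thesis by (rule add_left_imp_eq)
qed

lemma derivation_uminus: "x \<in> L \<Longrightarrow> D (- x) = - D x"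
  using derivation_add[of x "- x"] subfield_uminus[OF L, of x] derivation_0 by (simp add: minus_unique)

lemma derivation_diff: "x \<in> L \<Longrightarrow> y \<in> L \<Longrightarrow> D (x - y) = D x - D y"
  using derivation_add[of x "- y"] derivation_uminus[of y] subfield_uminus[OF L, of y] by simp

lemma derivation_sum: "(\<And>i. i \<in> A \<Longrightarrow> f i \<in> L) \<Longrightarrow> D (sum f A) = (\<Sum>i\<in>A. D (f i))"
  by (induction A rule: infinite_finite_induct) (simp_all add: derivation_0 derivation_add subfield_sum[OF L])

lemma derivation_inverse: "x \<in> L \<Longrightarrow> D (inverse x) = - D x / (x * x)"
proof (cases "x = 0")
  case False
  assume x: "x \<in> L"
  have "x * D (inverse x) + inverse x * D x = 0"
    using derivation_mult[OF x subfield_inverse[OF L x]] False derivation_1 by simp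
  then have *: "x * D (inverse x) = - (inverse x * D x)" by (simp only: eq_neg_iff_add_eq_0)
  have "D (inverse x) = inverse x * (x * D (inverse x))" using False by simp
  then show ?thesis unfolding * by (simp add: divide_inverse)
qed (simp add: derivation_0)

lemma derivation_divide:
  assumes "x \<in> L" "y \<in> L"
  shows "D (x / y) = (D x * y - x * D y) / (y * y)"
proof (cases "y = 0")
  case False
  have "D (x / y) = x * (- D y / (y * y)) + inverse y * D x"
    unfolding divide_inverse[of x y]
    by (simp only: derivation_mult[OF assms(1) subfield_inverse[OF L assms(2)]] derivation_inverse[OF assms(2)])
  also have "\<dots> = (D x * y - x * D y) / (y * y)"
    using False by (simp add: divide_simps)
  finally show ?thesis .
qed (simp add: derivation_0)

lemma poly_derivation_add:
  "p \<in> poly_over L \<Longrightarrow> q \<in> poly_over L \<Longrightarrow> map_poly D (p + q) = map_poly D p + map_poly D q"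
  by (intro poly_eqI) (simp add: coeff_map_poly derivation_0 derivation_add coeff_poly_over)

lemma poly_derivation_mult:
  "p \<in> poly_over L \<Longrightarrow> q \<in> poly_over L \<Longrightarrow> map_poly D (p * q) = p * map_poly D q + q * map_poly D p"
proof (intro poly_eqI)
  fix n assume p: "p \<in> poly_over L" and q: "q \<in> poly_over L"
  have "coeff (map_poly D (p * q)) n = (\<Sum>i\<le>n. D (coeff p i * coeff q (n - i)))"
    using p q by (simp add: coeff_map_poly derivation_0 coeff_mult derivation_sum subfield_mult[OF L] coeff_poly_over)
  also have "\<dots> = (\<Sum>i\<le>n. coeff p i * D (coeff q (n - i))) + (\<Sum>i\<le>n. D (coeff p i) * coeff q (n - i))"
    using p q by (simp add: derivation_mult coeff_poly_over sum.distrib mult.commute)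
  also have "\<dots> = coeff (p * map_poly D q + map_poly D p * q) n"
    by (simp add: coeff_mult coeff_map_poly derivation_0)
  finally show "coeff (map_poly D (p * q)) n = coeff (p * map_poly D q + q * map_poly D p) n"
    by (simp add: mult.commute)
qed

lemma poly_derivation_const: "map_poly D [:c:] = [:D c:]"
  by (simp add: map_poly_pCons derivation_0)

lemma derivation_poly:
  assumes x: "x \<in> L"
  shows "p \<in> poly_over L \<Longrightarrow> D (poly p x) = poly (map_poly D p) x + poly (pderiv p) x * D x"
proof (induction p)
  case 0
  then show ?case by (simp add: derivation_0)
next
  case (pCons a p)
  have a: "a \<in> L" using coeff_poly_over[OF pCons.prems, of 0] by simp
  have p: "p \<in> poly_over L" 
    using coeff_poly_over[OF pCons.prems, of "Suc _"] by (simp add: poly_over_def)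
  have "D (poly (pCons a p) x) = D a + (x * D (poly p x) + poly p x * D x)"
    using a x p by (simp add: derivation_add derivation_mult subfield_mult[OF L] poly_in_subfield[OF L])
  then show ?case
    using pCons.IH[OF p] pCons.hyps by (simp add: map_poly_pCons derivation_0 pderiv_pCons algebra_simps)
qed

text \<open>The condition on \<open>v\<close> says that \<open>f(X) \<mapsto> f\<^sup>D(x) + f'(x) v\<close> respects the relations satisfied by \<open>x\<close>.\<close>

lemma derivation_extend_value:
  assumes v: "\<And>f. f \<in> poly_over L \<Longrightarrow> poly f x = 0 \<Longrightarrow> poly (map_poly D f) x + poly (pderiv f) x * v = 0"
  shows "\<exists>D'. derivation_on (adjoin L x) D' \<and> (\<forall>a\<in>L. D' a = D a) \<and> D' x = v"
proof -
  define \<delta> where "\<delta> f = poly (map_poly D f) x + poly (pderiv f) x * v" for f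
  have \<delta>_add: "\<delta> (f + g) = \<delta> f + \<delta> g" if "f \<in> poly_over L" "g \<in> poly_over L" for f g
    using that by (simp add: \<delta>_def poly_derivation_add pderiv_add algebra_simps)
  have \<delta>_mult: "\<delta> (f * g) = poly f x * \<delta> g + poly g x * \<delta> f" if "f \<in> poly_over L" "g \<in> poly_over L" for f g
    using that by (simp add: \<delta>_def poly_derivation_mult pderiv_mult algebra_simps)
  have \<delta>_const: "\<delta> [:c:] = D c" for c
    by (simp add: \<delta>_def poly_derivation_const)
  have \<delta>_eq: "\<delta> f = \<delta> g" if "f \<in> poly_over L" "g \<in> poly_over L" "poly f x = poly g x" for f g
  proof -
    have fg: "f - g \<in> poly_over L" using that poly_over_diff[OF L] by blast
    then have "\<delta> (f - g) = 0" using v[of "f - g"] that by (simp add: \<delta>_def)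
    then show ?thesis using \<delta>_add[OF fg that(2)] by simp
  qed
  define q where "q f g = (\<delta> f * poly g x - poly f x * \<delta> g) / (poly g x * poly g x)" for f g
  define R where "R a f g \<longleftrightarrow> f \<in> poly_over L \<and> g \<in> poly_over L \<and> poly g x \<noteq> 0 \<and> a = poly f x / poly g x" for a f g
  have q_eq: "q f g = q f' g'" if "R a f g" "R a f' g'" for a f g f' g'
  proof -
    have in_L: "f \<in> poly_over L" "g \<in> poly_over L" "f' \<in> poly_over L" "g' \<in> poly_over L"
      and nz: "poly g x \<noteq> 0" "poly g' x \<noteq> 0" using that by (auto simp: R_def)
    have cross: "poly f x * poly g' x = poly f' x * poly g x"
      using that by (auto simp: R_def field_simps)
    have "\<delta> (f * g') = \<delta> (f' * g)"
      using in_L cross by (intro \<delta>_eq) (simp_all add: poly_over_mult[OF L])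
    then have eq: "poly f x * \<delta> g' + poly g' x * \<delta> f = poly f' x * \<delta> g + poly g x * \<delta> f'"
      using in_L by (simp add: \<delta>_mult)
    show ?thesis
      unfolding q_def by (rule quotient_rule_unique[OF eq cross nz])
  qed
  define D' where "D' a = (THE b. \<exists>f g. R a f g \<and> b = q f g)" for a
  have D': "D' a = q f g" if "R a f g" for a f g
    unfolding D'_def by (rule the_equality) (use that q_eq in blast)+
  have R_poly: "R (poly f x) f 1" if "f \<in> poly_over L" for f
    using that poly_over_1[OF L] by (simp add: R_def)
  have \<delta>_1: "\<delta> 1 = 0" using \<delta>_const[of 1] derivation_1 by (simp add: one_pCons)
  have D'_poly: "D' (poly f x) = \<delta> f" if "f \<in> poly_over L" for f
    using D'[OF R_poly[OF that]] \<delta>_1 by (simp add: q_def)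
  show ?thesis
  proof (intro exI conjI ballI)
    show "D' a = D a" if "a \<in> L" for a
      using D'_poly[of "[:a:]"] poly_over_const[OF L that] \<delta>_const by simp
    show "D' x = v"
      using D'_poly[of "[:0, 1:]"] poly_over_X[OF L] derivation_0 derivation_1
      by (simp add: \<delta>_def map_poly_pCons pderiv_pCons)
    show "derivation_on (adjoin L x) D'"
      unfolding derivation_on_def
    proof (intro ballI conjI)
      fix a b assume "a \<in> adjoin L x" "b \<in> adjoin L x"
      then obtain f g f' g' where R: "R a f g" "R b f' g'" unfolding adjoin_def R_def by blast
      have in_L: "f \<in> poly_over L" "g \<in> poly_over L" "f' \<in> poly_over L" "g' \<in> poly_over L"
        and nz: "poly g x \<noteq> 0" "poly g' x \<noteq> 0"
        and ab: "a = poly f x / poly g x" "b = poly f' x / poly g' x" using R by (auto simp: R_def)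
      have "R (a + b) (f * g' + f' * g) (g * g')" "R (a * b) (f * f') (g * g')"
        using in_L nz by (auto simp: R_def ab field_simps intro!: poly_over_add[OF L] poly_over_mult[OF L])
      then have *: "D' (a + b) = q (f * g' + f' * g) (g * g')" "D' (a * b) = q (f * f') (g * g')"
        "D' a = q f g" "D' b = q f' g'" using R D' by auto
      \<comment> \<open>Naming the eight values reduces the sum and product rules for fractions to
        the polynomial identities \<open>quot\<close>.\<close>
      define F G F' G' d e d' e' where abb: "F = poly f x" "G = poly g x" "F' = poly f' x" "G' = poly g' x"
        "d = \<delta> f" "e = \<delta> g" "d' = \<delta> f'" "e' = \<delta> g'"
      have nz': "G \<noteq> 0" "G' \<noteq> 0" using nz by (simp_all add: abb)
      have quot: "(F * e' + G' * d + (F' * e + G * d')) * (G * G') - (F * G' + F' * G) * (G * e' + G' * e)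
          = (d * G - F * e) * (G' * G') + (d' * G' - F' * e') * (G * G)"
        "((F * d' + F' * d) * (G * G') - F * F' * (G * e' + G' * e))
          = F * G * (d' * G' - F' * e') + F' * G' * (d * G - F * e)"
        by (simp_all add: algebra_simps)
      show "D' (a + b) = D' a + D' b"
        unfolding * q_def using in_L nz'
        by (simp add: \<delta>_add \<delta>_mult poly_over_mult[OF L] abb[symmetric] quot) (simp add: divide_simps)
      show "D' (a * b) = a * D' b + b * D' a"
        unfolding * q_def unfolding ab using in_L nz'
        by (simp add: \<delta>_add \<delta>_mult poly_over_mult[OF L] abb[symmetric] quot) (simp add: divide_simps)
    qed
  qed
qed

end

section \<open>Extension of derivations\<close>

definition Der :: "'a::field set \<Rightarrow> ('a \<Rightarrow> 'a) set" where
  "Der A = {D. derivation_on UNIV D \<and> (\<forall>a\<in>A. D a = 0)}"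

definition constants :: "('a::zero \<Rightarrow> 'a) set \<Rightarrow> 'a set" where
  "constants \<Delta> = {z. \<forall>D\<in>\<Delta>. D z = 0}"

lemma subfield_UNIV: "is_subfield UNIV"
  by (simp add: is_subfield_def)

text \<open>A transcendental \<open>x\<close> satisfies no relations, so its value is free. For
  algebraic \<open>x\<close> the value is forced by differentiating the minimal polynomial, whose
  derivative does not vanish at \<open>x\<close>.\<close>

lemma derivation_extend_adjoin:
  fixes L :: "'a::field_char_0 set"
  assumes L: "is_subfield L" and D: "derivation_on L D"
  shows "\<exists>D'. derivation_on (adjoin L x) D' \<and> (\<forall>a\<in>L. D' a = D a) \<and>
    (x \<notin> algebraic_closure_in L \<longrightarrow> D' x = v)"
proof (cases "x \<in> algebraic_closure_in L")
  case False
  have "poly (map_poly D f) x + poly (pderiv f) x * v = 0" if "f \<in> poly_over L" "poly f x = 0" for f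
  proof -
    have "f = 0" using that False unfolding algebraic_closure_in_def poly_over_def by blast
    then show ?thesis by simp
  qed
  then show ?thesis using derivation_extend_value[OF L D, of x v] by blast
next
  case True
  then obtain P where P: "minimal_poly L x P" using minimal_poly_exists[OF L] by blast
  define v' where "v' = - poly (map_poly D P) x / poly (pderiv P) x"
  have PL: "P \<in> poly_over L" and Px: "poly P x = 0" using P by (auto simp: minimal_poly_def[OF L])
  have v': "poly (map_poly D P) x + poly (pderiv P) x * v' = 0"
    using minimal_poly_simple[OF L P Px] by (simp add: v'_def)
  have "poly (map_poly D f) x + poly (pderiv f) x * v' = 0" if f: "f \<in> poly_over L" "poly f x = 0" for f
  proof -
    obtain h where h: "h \<in> poly_over L" "f = P * h" by (rule minimal_poly_factor[OF L P f])
    have "poly (map_poly D f) x + poly (pderiv f) x * v'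
        = (poly (map_poly D P) x + poly (pderiv P) x * v') * poly h x"
      unfolding h(2) poly_derivation_mult[OF L D PL h(1)] pderiv_mult using Px by (simp add: algebra_simps)
    then show ?thesis using v' by simp
  qed
  then show ?thesis using derivation_extend_value[OF L D, of x v'] True by blast
qed

text \<open>Graphs are used because unions of chains of them are immediate. The condition at 0, with
  closure under sums and negatives, makes the relation single-valued.\<close>

definition derivation_graph :: "('a::field \<times> 'a) set \<Rightarrow> bool" where
  "derivation_graph G \<longleftrightarrow> (1, 0) \<in> G \<and> (\<forall>b. (0, b) \<in> G \<longrightarrow> b = 0) \<and>
     (\<forall>a a' b b'. (a, a') \<in> G \<longrightarrow> (b, b') \<in> G \<longrightarrow> (a + b, a' + b') \<in> G \<and> (a * b, a * b' + b * a') \<in> G) \<and>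
     (\<forall>a a'. (a, a') \<in> G \<longrightarrow> (- a, - a') \<in> G \<and> (inverse a, - a' / (a * a)) \<in> G)"

lemma derivation_graph_of:
  assumes L: "is_subfield L" and D: "derivation_on L D"
  shows "derivation_graph ((\<lambda>a. (a, D a)) ` L)"
proof -
  have mem: "(a, b) \<in> (\<lambda>a. (a, D a)) ` L \<longleftrightarrow> a \<in> L \<and> b = D a" for a b by blast
  show ?thesis
    unfolding derivation_graph_def mem
    using derivation_0[OF L D] derivation_1[OF L D] derivation_add[OF L D] derivation_mult[OF L D]
      derivation_uminus[OF L D] derivation_inverse[OF L D] subfield_1[OF L] subfield_add[OF L]
      subfield_mult[OF L] subfield_uminus[OF L] subfield_inverse[OF L]
    by simp
qed

lemma derivation_graph_unique:
  assumes G: "derivation_graph G" and ab: "(a, b) \<in> G" "(a, c) \<in> G"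
  shows "b = c"
proof -
  have "(- a, - c) \<in> G" using G ab by (auto simp: derivation_graph_def)
  then have "(a + - a, b + - c) \<in> G" using G ab unfolding derivation_graph_def by blast
  then have "(0, b - c) \<in> G" by simp
  then have "b - c = 0" using G unfolding derivation_graph_def by blast
  then show ?thesis by simp
qed

lemma derivation_graph_function:
  assumes G: "derivation_graph G"
  obtains D where "is_subfield (fst ` G)" "derivation_on (fst ` G) D" "G = (\<lambda>a. (a, D a)) ` (fst ` G)"
proof -
  define D where "D a = (THE b. (a, b) \<in> G)" for a
  have D: "D a = b" if "(a, b) \<in> G" for a b
    unfolding D_def by (rule the_equality) (use that derivation_graph_unique[OF G] in blast)+
  have one: "(1, 0) \<in> G" using G by (simp add: derivation_graph_def)
  have add: "(a + b, a' + b') \<in> G" and mult: "(a * b, a * b' + b * a') \<in> G" if "(a, a') \<in> G" "(b, b') \<in> G" for a b a' b'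
    using G that unfolding derivation_graph_def by blast+
  have um: "(- a, - a') \<in> G" and inv: "(inverse a, - a' / (a * a)) \<in> G" if "(a, a') \<in> G" for a a'
    using G that unfolding derivation_graph_def by blast+
  have zero: "(0, 0) \<in> G" using add[OF one um[OF one]] by simp
  have dom: "a \<in> fst ` G \<longleftrightarrow> (\<exists>a'. (a, a') \<in> G)" for a by force
  show ?thesis
  proof
    show "is_subfield (fst ` G)"
      unfolding is_subfield_def Ball_def dom by (blast intro: zero one add mult um inv)
    show "derivation_on (fst ` G) D"
      unfolding derivation_on_def Ball_def dom
    proof (intro allI impI)
      fix a b assume "\<exists>a'. (a, a') \<in> G" "\<exists>b'. (b, b') \<in> G"
      then obtain a' b' where ab: "(a, a') \<in> G" "(b, b') \<in> G" by blast
      show "D (a + b) = D a + D b \<and> D (a * b) = a * D b + b * D a"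
        unfolding D[OF ab(1)] D[OF ab(2)] D[OF add[OF ab]] D[OF mult[OF ab]] by simp
    qed
    have "p \<in> (\<lambda>a. (a, D a)) ` (fst ` G)" if "p \<in> G" for p
      using that D[of "fst p" "snd p"] by (intro image_eqI[of _ _ "fst p"]) simp_all
    moreover have "(a, D a) \<in> G" if "a \<in> fst ` G" for a
    proof -
      from that have "\<exists>a'. (a, a') \<in> G" unfolding dom .
      then obtain a' where "(a, a') \<in> G" ..
      then show ?thesis using D by simp
    qed
    ultimately show "G = (\<lambda>a. (a, D a)) ` (fst ` G)" by blast
  qed
qed

text \<open>Zorn's lemma: a maximal derivation graph above that of \<open>D\<close> has full domain,
  because one more element can always be adjoined.\<close>

theorem derivation_extend_UNIV:
  fixes L :: "'a::field_char_0 set"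
  assumes L: "is_subfield L" and D: "derivation_on L D"
  shows "\<exists>D'. derivation_on UNIV D' \<and> (\<forall>a\<in>L. D' a = D a)"
proof -
  define G0 where "G0 = (\<lambda>a. (a, D a)) ` L"
  define \<A> where "\<A> = {G. G0 \<subseteq> G \<and> derivation_graph G}"
  have "\<exists>M\<in>\<A>. \<forall>X\<in>\<A>. M \<subseteq> X \<longrightarrow> X = M"
  proof (rule subset_Zorn_nonempty)
    show "\<A> \<noteq> {}" using derivation_graph_of[OF L D] by (auto simp: \<A>_def G0_def)
  next
    fix \<C> assume ne: "\<C> \<noteq> {}" and ch: "subset.chain \<A> \<C>"
    have gr: "derivation_graph G" "G0 \<subseteq> G" if "G \<in> \<C>" for G
      using ch that by (auto simp: subset_chain_def \<A>_def)
    have two: "\<exists>G\<in>\<C>. p \<in> G \<and> q \<in> G" if "p \<in> \<Union>\<C>" "q \<in> \<Union>\<C>" for p q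
      using ch that unfolding subset_chain_def by blast
    have "derivation_graph (\<Union>\<C>)"
      unfolding derivation_graph_def
    proof (intro conjI allI impI)
      show "(1, 0) \<in> \<Union>\<C>" using ne gr by (auto simp: derivation_graph_def)
      show "b = 0" if "(0, b) \<in> \<Union>\<C>" for b using that gr by (auto simp: derivation_graph_def)
    next
      fix a a' b b' assume "(a, a') \<in> \<Union>\<C>" "(b, b') \<in> \<Union>\<C>"
      from two[OF this] obtain G where G: "G \<in> \<C>" "(a, a') \<in> G" "(b, b') \<in> G" by blast
      with gr[OF G(1)] show "(a + b, a' + b') \<in> \<Union>\<C>" "(a * b, a * b' + b * a') \<in> \<Union>\<C>"
        unfolding derivation_graph_def by blast+
    next
      fix a a' assume "(a, a') \<in> \<Union>\<C>"
      then obtain G where G: "G \<in> \<C>" "(a, a') \<in> G" by blast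
      with gr[OF G(1)] show "(- a, - a') \<in> \<Union>\<C>" "(inverse a, - a' / (a * a)) \<in> \<Union>\<C>"
        unfolding derivation_graph_def by blast+
    qed
    then show "\<Union>\<C> \<in> \<A>" using ne gr by (auto simp: \<A>_def)
  qed
  then obtain M where M: "derivation_graph M" "G0 \<subseteq> M" and max: "\<And>X. G0 \<subseteq> X \<Longrightarrow> derivation_graph X \<Longrightarrow> M \<subseteq> X \<Longrightarrow> X = M"
    by (auto simp: \<A>_def)
  obtain D' where D': "is_subfield (fst ` M)" "derivation_on (fst ` M) D'" "M = (\<lambda>a. (a, D' a)) ` (fst ` M)"
    by (rule derivation_graph_function[OF M(1)])
  have "x \<in> fst ` M" for x
  proof -
    obtain E where E: "derivation_on (adjoin (fst ` M) x) E" "\<And>a. a \<in> fst ` M \<Longrightarrow> E a = D' a"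
      using derivation_extend_adjoin[OF D'(1,2), of x] by blast
    let ?X = "(\<lambda>a. (a, E a)) ` adjoin (fst ` M) x"
    have "derivation_graph ?X" using derivation_graph_of[OF subfield_adjoin[OF D'(1)] E(1)] .
    moreover have "M \<subseteq> ?X"
    proof -
      have "(\<lambda>a. (a, D' a)) ` (fst ` M) = (\<lambda>a. (a, E a)) ` (fst ` M)"
        using E(2) by (intro image_cong) simp_all
      also have "\<dots> \<subseteq> ?X" using adjoin_base[OF D'(1)] by (rule image_mono)
      finally show ?thesis using D'(3) by simp
    qed
    ultimately have "?X = M" using max M(2) by (meson subset_trans)
    moreover have "(x, E x) \<in> ?X" using adjoin_generator[OF D'(1), of x] by (rule imageI)
    ultimately show ?thesis by force
  qed
  then have U: "fst ` M = UNIV" by blast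
  have "D' a = D a" if "a \<in> L" for a
  proof -
    have "(a, D a) \<in> M" using that M(2) by (auto simp: G0_def)
    moreover have "(a, D' a) \<in> M" using D'(3) U by (metis UNIV_I imageI)
    ultimately show ?thesis using derivation_graph_unique[OF M(1)] by blast
  qed
  then show ?thesis using D'(2) U by auto
qed

section \<open>Derivations of the whole field, their constants, and algebraic dependence\<close>

lemma Der_derivation: "D \<in> Der A \<Longrightarrow> derivation_on UNIV D"
  and Der_zero: "D \<in> Der A \<Longrightarrow> a \<in> A \<Longrightarrow> D a = 0"
  by (simp_all add: Der_def)

lemma derivation_zero_poly:
  assumes D: "D \<in> Der K" and f: "f \<in> poly_over K"
  shows "D (poly f x) = poly (pderiv f) x * D x"
proof -
  have "map_poly D f = 0"
    using Der_zero[OF D] coeff_poly_over[OF f] derivation_0[OF subfield_UNIV Der_derivation[OF D]]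
    by (intro poly_eqI) (simp add: coeff_map_poly)
  then show ?thesis
    using derivation_poly[OF subfield_UNIV Der_derivation[OF D], of x f] by (simp add: poly_over_def)
qed

text \<open>Apply \<open>D\<close> to the minimal polynomial at \<open>x\<close>: this gives
  \<open>poly (pderiv P) x * D x = 0\<close>, and the first factor is nonzero.\<close>

lemma Der_algebraic:
  fixes K :: "'a::field_char_0 set"
  assumes K: "is_subfield K" and x: "x \<in> algebraic_closure_in K" and D: "D \<in> Der K"
  shows "D x = 0"
proof -
  obtain P where P: "minimal_poly K x P" using minimal_poly_exists[OF K x] .
  then have "P \<in> poly_over K" "poly P x = 0" by (auto simp: minimal_poly_def[OF K])
  then have "poly (pderiv P) x * D x = 0"
    using derivation_zero_poly[OF D, of P x] derivation_0[OF subfield_UNIV Der_derivation[OF D]] by simp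
  then show ?thesis using minimal_poly_simple[OF K P \<open>poly P x = 0\<close>] by simp
qed

text \<open>The zero derivation of \<open>K\<close> extends with the free value 1 at
  \<open>x\<close>. Together with \<open>Der_algebraic\<close>, this lets derivations detect
  transcendence.\<close>

lemma transcendental_derivation:
  fixes K :: "'a::field_char_0 set"
  assumes K: "is_subfield K" and x: "x \<notin> algebraic_closure_in K"
  obtains D where "D \<in> Der K" "D x = 1"
proof -
  have "derivation_on K (\<lambda>_. 0)" by (simp add: derivation_on_def)
  then obtain D where D: "derivation_on (adjoin K x) D" "\<And>a. a \<in> K \<Longrightarrow> D a = 0" "D x = 1"
    using derivation_extend_adjoin[OF K, of "\<lambda>_. 0" x 1] x by blast
  obtain D' where D': "derivation_on UNIV D'" "\<And>a. a \<in> adjoin K x \<Longrightarrow> D' a = D a"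
    using derivation_extend_UNIV[OF subfield_adjoin[OF K] D(1)] by blast
  have "D' a = 0" if "a \<in> K" for a
    using D'(2)[of a] D(2)[OF that] that adjoin_base[OF K, of x] by auto
  then have "D' \<in> Der K" using D'(1) by (simp add: Der_def)
  moreover have "D' x = 1" using D'(2)[OF adjoin_generator[OF K]] D(3) by simp
  ultimately show ?thesis using that by blast
qed

lemma subfield_constants:
  assumes "\<Delta> \<subseteq> Der {}"
  shows "is_subfield (constants \<Delta>)"
proof -
  have "is_subfield {z. D z = 0}" if "D \<in> \<Delta>" for D
  proof -
    have D: "derivation_on UNIV D" using that assms Der_derivation by blast
    show ?thesis
      by (simp add: is_subfield_def derivation_0[OF subfield_UNIV D] derivation_1[OF subfield_UNIV D]
        derivation_add[OF subfield_UNIV D] derivation_mult[OF subfield_UNIV D]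
        derivation_uminus[OF subfield_UNIV D] derivation_inverse[OF subfield_UNIV D])
  qed
  then show ?thesis unfolding is_subfield_def constants_def by blast
qed

lemma constants_algebraically_closed:
  fixes \<Delta> :: "('a::field_char_0 \<Rightarrow> 'a) set"
  assumes \<Delta>: "\<Delta> \<subseteq> Der {}"
  shows "algebraic_closure_in (constants \<Delta>) \<subseteq> constants \<Delta>"
proof
  fix x assume x: "x \<in> algebraic_closure_in (constants \<Delta>)"
  have "D x = 0" if "D \<in> \<Delta>" for D
  proof -
    have "D \<in> Der (constants \<Delta>)" using that \<Delta> by (auto simp: Der_def constants_def)
    then show ?thesis using Der_algebraic[OF subfield_constants[OF \<Delta>] x] by blast
  qed
  then show "x \<in> constants \<Delta>" by (simp add: constants_def)
qed

lemma Der_generated: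
  assumes "D \<in> Der A"
  shows "D \<in> Der (generated_subfield A)"
proof -
  have "D \<in> Der {}" using assms by (simp add: Der_def)
  then have "is_subfield (constants {D})" by (intro subfield_constants) simp
  moreover have "A \<subseteq> constants {D}" using assms by (auto simp: Der_def constants_def)
  ultimately have "generated_subfield A \<subseteq> constants {D}" by (rule generated_subfield_least)
  then show ?thesis using assms by (auto simp: Der_def constants_def)
qed

lemma Der_combination:
  assumes "D \<in> Der A" "D' \<in> Der A"
  shows "(\<lambda>x. D x - c * D' x) \<in> Der A"
  using assms unfolding Der_def derivation_on_def by (simp add: algebra_simps)

text \<open>Steinitz exchange through derivations: if \<open>x\<close> were transcendental over
  \<open>M(z)\<close>, a derivation over \<open>M\<close> with value 1 at \<open>z\<close> could be
  corrected to vanish at \<open>x\<close> without changing its value at \<open>z\<close>, although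
  \<open>z\<close> is algebraic over \<open>M(x)\<close>.\<close>

lemma algebraic_exchange:
  fixes M :: "'a::field_char_0 set"
  assumes M: "is_subfield M" and z: "z \<notin> algebraic_closure_in M" "z \<in> algebraic_closure_in (adjoin M x)"
  shows "x \<in> algebraic_closure_in (adjoin M z)"
proof (rule ccontr)
  assume "x \<notin> algebraic_closure_in (adjoin M z)"
  then obtain D where D: "D \<in> Der (adjoin M z)" "D x = 1"
    using transcendental_derivation[OF subfield_adjoin[OF M]] by blast
  obtain D' where D': "D' \<in> Der M" "D' z = 1" by (rule transcendental_derivation[OF M z(1)])
  have DM: "D \<in> Der M" and Dz: "D z = 0"
    using D(1) adjoin_base[OF M, of z] adjoin_generator[OF M, of z] by (auto simp: Der_def)
  define D'' where "D'' = (\<lambda>y. D' y - D' x * D y)"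
  have D'': "D'' \<in> Der M" unfolding D''_def by (rule Der_combination[OF D'(1) DM])
  have "D'' x = 0" using D by (simp add: D''_def)
  then have "M \<subseteq> constants {D''}" "x \<in> constants {D''}" using D'' by (auto simp: Der_def constants_def)
  moreover have "is_subfield (constants {D''})" using D'' by (intro subfield_constants) (simp add: Der_def)
  ultimately have "adjoin M x \<subseteq> constants {D''}" using adjoin_least[OF M] by blast
  then have "D'' \<in> Der (adjoin M x)" using D'' by (auto simp: Der_def constants_def)
  then have "D'' z = 0" using Der_algebraic[OF subfield_adjoin[OF M] z(2)] by blast
  then show False using D'(2) Dz by (simp add: D''_def)
qed

lemma subset_algebraic_closure:
  assumes L: "is_subfield L"
  shows "L \<subseteq> algebraic_closure_in L"
proof
  fix y assume y: "y \<in> L"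
  show "y \<in> algebraic_closure_in L"
    unfolding algebraic_closure_in_def
    using poly_over_diff[OF L poly_over_X[OF L] poly_over_const[OF L y]]
    by (intro CollectI exI[of _ "[:0, 1:] - [:y:]"]) (auto simp: poly_over_def)
qed

text \<open>Supplies a rational function field in one variable over which everything is algebraic.
  If \<open>x\<close> were transcendental over \<open>M(z)\<close>, then by exchange
  \<open>z\<close> would stay transcendental over \<open>M(x)\<close>, against maximality of
  \<open>M\<close>.\<close>

lemma maximal_subfield_avoiding:
  fixes K :: "'a::field_char_0 set"
  assumes K: "is_subfield K" and z: "z \<notin> algebraic_closure_in K"
  shows "\<exists>M. is_subfield M \<and> K \<subseteq> M \<and> z \<notin> algebraic_closure_in M \<and>
    algebraic_closure_in (adjoin M z) = UNIV"
proof -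
  define \<A> where "\<A> = {M. is_subfield M \<and> K \<subseteq> M \<and> z \<notin> algebraic_closure_in M}"
  have "\<exists>M\<in>\<A>. \<forall>X\<in>\<A>. M \<subseteq> X \<longrightarrow> X = M"
  proof (rule subset_Zorn_nonempty)
    show "\<A> \<noteq> {}" using K z by (auto simp: \<A>_def)
  next
    fix \<C> assume ne: "\<C> \<noteq> {}" and ch: "subset.chain \<A> \<C>"
    have C: "is_subfield M" "K \<subseteq> M" "z \<notin> algebraic_closure_in M" if "M \<in> \<C>" for M
      using ch that by (auto simp: subset_chain_def \<A>_def)
    have two: "\<exists>M\<in>\<C>. p \<in> M \<and> q \<in> M" if "p \<in> \<Union>\<C>" "q \<in> \<Union>\<C>" for p q
      using ch that unfolding subset_chain_def by blast
    have "is_subfield (\<Union>\<C>)"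
      unfolding is_subfield_def
    proof (intro conjI ballI)
      show "0 \<in> \<Union>\<C>" "1 \<in> \<Union>\<C>" using ne C subfield_0 subfield_1 by blast+
    next
      fix x y assume "x \<in> \<Union>\<C>" "y \<in> \<Union>\<C>"
      from two[OF this] show "x + y \<in> \<Union>\<C>" "x * y \<in> \<Union>\<C>" using C subfield_add subfield_mult by blast+
    next
      fix x assume "x \<in> \<Union>\<C>"
      then show "- x \<in> \<Union>\<C>" "inverse x \<in> \<Union>\<C>" using C subfield_uminus subfield_inverse by blast+
    qed
    moreover have "z \<notin> algebraic_closure_in (\<Union>\<C>)"
    proof
      assume "z \<in> algebraic_closure_in (\<Union>\<C>)"
      then obtain p where p: "p \<noteq> 0" "\<And>i. coeff p i \<in> \<Union>\<C>" "poly p z = 0"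
        by (auto simp: algebraic_closure_in_def)
      \<comment> \<open>The finitely many coefficients of an algebraic relation already lie in one
        member of the chain.\<close>
      have "\<exists>M\<in>\<C>. \<forall>i<n. coeff p i \<in> M" for n
      proof (induction n)
        case 0 then show ?case using ne by auto
      next
        case (Suc n)
        then obtain M where M: "M \<in> \<C>" "\<forall>i<n. coeff p i \<in> M" by blast
        obtain M' where M': "M' \<in> \<C>" "coeff p n \<in> M'" using p(2) by blast
        have "M \<subseteq> M' \<or> M' \<subseteq> M" using ch M(1) M'(1) by (auto simp: subset_chain_def)
        then show ?case using M M' by (metis less_antisym subsetD)
      qed
      then obtain M where M: "M \<in> \<C>" "\<forall>i<Suc (degree p). coeff p i \<in> M" by blast
      then have "coeff p i \<in> M" for i
        using C(1)[OF M(1)] subfield_0 by (cases "i \<le> degree p") (auto simp: coeff_eq_0)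
      then show False using C(3)[OF M(1)] p by (auto simp: algebraic_closure_in_def)
    qed
    moreover have "K \<subseteq> \<Union>\<C>" using ne C(2) by blast
    ultimately show "\<Union>\<C> \<in> \<A>" by (simp add: \<A>_def)
  qed
  then obtain M where M: "is_subfield M" "K \<subseteq> M" "z \<notin> algebraic_closure_in M"
    and max: "\<And>X. is_subfield X \<Longrightarrow> K \<subseteq> X \<Longrightarrow> z \<notin> algebraic_closure_in X \<Longrightarrow> M \<subseteq> X \<Longrightarrow> X = M"
    by (auto simp: \<A>_def)
  have "x \<in> algebraic_closure_in (adjoin M z)" for x
  proof (rule ccontr)
    assume nx: "x \<notin> algebraic_closure_in (adjoin M z)"
    then have "z \<notin> algebraic_closure_in (adjoin M x)" using algebraic_exchange[OF M(1,3)] by blast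
    then have "adjoin M x = M"
      using max[OF subfield_adjoin[OF M(1)]] adjoin_base[OF M(1), of x] M(2) by blast
    then have "x \<in> adjoin M z" using adjoin_generator[OF M(1), of x] adjoin_base[OF M(1), of z] by blast
    then show False using nx subset_algebraic_closure[OF subfield_adjoin[OF M(1)]] by blast
  qed
  then show ?thesis using M by blast
qed

section \<open>Field homomorphisms\<close>

definition field_hom_on :: "'a::field set \<Rightarrow> ('a \<Rightarrow> 'b::field) \<Rightarrow> bool" where
  "field_hom_on L \<phi> \<longleftrightarrow> \<phi> 1 = 1 \<and> (\<forall>x\<in>L. \<forall>y\<in>L. \<phi> (x + y) = \<phi> x + \<phi> y \<and> \<phi> (x * y) = \<phi> x * \<phi> y)"

context
  fixes L :: "'a::field set" and \<phi> :: "'a \<Rightarrow> 'b::field"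
  assumes L: "is_subfield L" and \<phi>: "field_hom_on L \<phi>"
begin

lemma hom_1: "\<phi> 1 = 1"
  and hom_add: "x \<in> L \<Longrightarrow> y \<in> L \<Longrightarrow> \<phi> (x + y) = \<phi> x + \<phi> y"
  and hom_mult: "x \<in> L \<Longrightarrow> y \<in> L \<Longrightarrow> \<phi> (x * y) = \<phi> x * \<phi> y"
  using \<phi> by (auto simp: field_hom_on_def)

lemma hom_0: "\<phi> 0 = 0"
proof -
  have "\<phi> 0 + \<phi> 0 = \<phi> 0 + 0" using hom_add[of 0 0] subfield_0[OF L] by simp
  then show ?thesis by (rule add_left_imp_eq)
qed

lemma hom_uminus: "x \<in> L \<Longrightarrow> \<phi> (- x) = - \<phi> x"
  using hom_add[of x "- x"] subfield_uminus[OF L, of x] hom_0 by (simp add: minus_unique)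

lemma hom_inverse: "x \<in> L \<Longrightarrow> \<phi> (inverse x) = inverse (\<phi> x)"
proof (cases "x = 0")
  case False
  assume x: "x \<in> L"
  have "\<phi> x * \<phi> (inverse x) = 1"
    using hom_mult[OF x subfield_inverse[OF L x]] False hom_1 by simp
  then show ?thesis by (simp add: inverse_unique)
qed (simp add: hom_0)

lemma hom_nonzero: "x \<in> L \<Longrightarrow> x \<noteq> 0 \<Longrightarrow> \<phi> x \<noteq> 0"
proof
  assume x: "x \<in> L" "x \<noteq> 0" and "\<phi> x = 0"
  then have "\<phi> (x * inverse x) = 0" using hom_mult[OF x(1) subfield_inverse[OF L x(1)]] by simp
  then show False using x hom_1 by simp
qed

lemma hom_divide: "x \<in> L \<Longrightarrow> y \<in> L \<Longrightarrow> \<phi> (x / y) = \<phi> x / \<phi> y"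
  using hom_mult[of x "inverse y"] hom_inverse[of y] subfield_inverse[OF L, of y] by (simp add: divide_inverse)

lemma hom_sum: "(\<And>i. i \<in> A \<Longrightarrow> f i \<in> L) \<Longrightarrow> \<phi> (sum f A) = (\<Sum>i\<in>A. \<phi> (f i))"
  by (induction A rule: infinite_finite_induct) (simp_all add: hom_0 hom_add subfield_sum[OF L])

lemma hom_power: "x \<in> L \<Longrightarrow> \<phi> (x ^ n) = \<phi> x ^ n"
  by (induction n) (simp_all add: hom_1 hom_mult subfield_power[OF L])

end

text \<open>\<open>ev\<close> plays the role of evaluation at the intended image of
  \<open>x\<close>. It has the same kernel as evaluation at \<open>x\<close>, hence factors through
  \<open>k[x]\<close> and passes to fractions. It serves for conjugates and for Laurent
  expansions.\<close>

lemma adjoin_hom: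
  fixes k :: "'a::field set" and ev :: "'a poly \<Rightarrow> 'b::field"
  assumes k: "is_subfield k"
    and add: "\<And>f g. f \<in> poly_over k \<Longrightarrow> g \<in> poly_over k \<Longrightarrow> ev (f + g) = ev f + ev g"
    and mult: "\<And>f g. f \<in> poly_over k \<Longrightarrow> g \<in> poly_over k \<Longrightarrow> ev (f * g) = ev f * ev g"
    and one: "ev 1 = 1"
    and zero: "\<And>f. f \<in> poly_over k \<Longrightarrow> ev f = 0 \<longleftrightarrow> poly f x = 0"
  shows "\<exists>\<phi>. field_hom_on (adjoin k x) \<phi> \<and> (\<forall>f\<in>poly_over k. \<phi> (poly f x) = ev f)"
proof -
  define R where "R a f g \<longleftrightarrow> f \<in> poly_over k \<and> g \<in> poly_over k \<and> poly g x \<noteq> 0 \<and> a = poly f x / poly g x" for a f g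
  have eq: "ev f = ev g" if "f \<in> poly_over k" "g \<in> poly_over k" "poly f x = poly g x" for f g
  proof -
    have fg: "f - g \<in> poly_over k" using that poly_over_diff[OF k] by blast
    then have "ev (f - g) = 0" using zero that by simp
    then show ?thesis using add[OF fg that(2)] by simp
  qed
  have R_eq: "ev f / ev g = ev f' / ev g'" if "R a f g" "R a f' g'" for a f g f' g'
  proof -
    have p: "f \<in> poly_over k" "g \<in> poly_over k" "f' \<in> poly_over k" "g' \<in> poly_over k"
      and nz: "poly g x \<noteq> 0" "poly g' x \<noteq> 0"
      and "poly f x / poly g x = poly f' x / poly g' x" using that by (auto simp: R_def)
    then have "poly (f * g') x = poly (f' * g) x" by (simp add: frac_eq_eq)
    then have "ev (f * g') = ev (f' * g)" using p by (intro eq poly_over_mult[OF k])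
    then have "ev f * ev g' = ev f' * ev g" using p by (simp add: mult)
    moreover have "ev g \<noteq> 0" "ev g' \<noteq> 0" using zero p nz by blast+
    ultimately show ?thesis by (simp add: frac_eq_eq)
  qed
  define \<phi> where "\<phi> a = (THE b. \<exists>f g. R a f g \<and> b = ev f / ev g)" for a
  have \<phi>: "\<phi> a = ev f / ev g" if "R a f g" for a f g
    unfolding \<phi>_def by (rule the_equality) (use that R_eq in blast)+
  have \<phi>_poly: "\<phi> (poly f x) = ev f" if "f \<in> poly_over k" for f
    using \<phi>[of "poly f x" f 1] that poly_over_1[OF k] one by (simp add: R_def)
  have "field_hom_on (adjoin k x) \<phi>"
    unfolding field_hom_on_def
  proof (intro conjI ballI)
    show "\<phi> 1 = 1" using \<phi>_poly[OF poly_over_1[OF k]] one by simp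
  next
    fix a b assume "a \<in> adjoin k x" "b \<in> adjoin k x"
    then obtain f g f' g' where R: "R a f g" "R b f' g'" unfolding adjoin_def R_def by blast
    have p: "f \<in> poly_over k" "g \<in> poly_over k" "f' \<in> poly_over k" "g' \<in> poly_over k"
      and nz: "poly g x \<noteq> 0" "poly g' x \<noteq> 0"
      and ab: "a = poly f x / poly g x" "b = poly f' x / poly g' x" using R by (auto simp: R_def)
    have nz': "ev g \<noteq> 0" "ev g' \<noteq> 0" using zero p nz by blast+
    have "R (a + b) (f * g' + f' * g) (g * g')" "R (a * b) (f * f') (g * g')"
      using p nz by (auto simp: R_def ab add_frac_eq intro!: poly_over_add[OF k] poly_over_mult[OF k])
    then have "\<phi> (a + b) = ev (f * g' + f' * g) / ev (g * g')" "\<phi> (a * b) = ev (f * f') / ev (g * g')"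
      using \<phi> by blast+
    then show "\<phi> (a + b) = \<phi> a + \<phi> b" "\<phi> (a * b) = \<phi> a * \<phi> b"
      unfolding \<phi>[OF R(1)] \<phi>[OF R(2)] using p nz'
      by (simp_all add: add mult poly_over_mult[OF k] add_frac_eq)
  qed
  then show ?thesis using \<phi>_poly by blast
qed

text \<open>The elements of \<open>k(x)\<close> whose derivative stays in \<open>k(x)\<close> form a
  subfield.\<close>

lemma adjoin_derivation_closed:
  fixes k :: "'a::field_char_0 set"
  assumes k: "is_subfield k" and D: "derivation_on UNIV D" and Dk: "D ` k \<subseteq> k"
    and x: "D x \<in> adjoin k x"
  shows "D ` adjoin k x \<subseteq> adjoin k x"
proof -
  note L = subfield_adjoin[OF k, of x] and U = subfield_UNIV
  let ?S = "{a \<in> adjoin k x. D a \<in> adjoin k x}"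
  have "is_subfield ?S"
    unfolding is_subfield_def
    by (auto simp: derivation_0[OF U D] derivation_1[OF U D] derivation_add[OF U D] derivation_mult[OF U D]
      derivation_uminus[OF U D] derivation_inverse[OF U D]
      intro!: subfield_0[OF L] subfield_1[OF L] subfield_add[OF L] subfield_mult[OF L] subfield_uminus[OF L]
        subfield_inverse[OF L] subfield_divide[OF L] subfield_diff[OF L])
  moreover have "k \<subseteq> ?S" using adjoin_base[OF k, of x] Dk by blast
  moreover have "x \<in> ?S" using adjoin_generator[OF k] x by blast
  ultimately have "adjoin k x \<subseteq> ?S" by (rule adjoin_least[OF k])
  then show ?thesis by blast
qed

text \<open>Differentiate \<open>poly P y = 0\<close>. The same rational expression serves for every
  root of \<open>P\<close>, which is why embeddings sending \<open>x\<close> to another root commute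
  with \<open>D\<close>.\<close>

lemma algebraic_derivation_in_adjoin:
  fixes k :: "'a::field_char_0 set"
  assumes k: "is_subfield k" and D: "derivation_on UNIV D" and Dk: "D ` k \<subseteq> k"
    and P: "minimal_poly k x P" and y: "poly P y = 0"
  shows "D y = - poly (map_poly D P) y / poly (pderiv P) y" "map_poly D P \<in> poly_over k"
proof -
  have "0 = poly (map_poly D P) y + poly (pderiv P) y * D y"
    using derivation_poly[OF subfield_UNIV D, of y P] y derivation_0[OF subfield_UNIV D] by (simp add: poly_over_def)
  then have "poly (pderiv P) y * D y = - poly (map_poly D P) y" by (simp add: eq_neg_iff_add_eq_0 add.commute)
  then show "D y = - poly (map_poly D P) y / poly (pderiv P) y"
    using minimal_poly_simple[OF k P y] by (metis nonzero_mult_div_cancel_left)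
  show "map_poly D P \<in> poly_over k"
    using P image_subset_iff[THEN iffD1, OF Dk] by (auto simp: minimal_poly_def[OF k] poly_over_def coeff_map_poly derivation_0[OF subfield_UNIV D])
qed

text \<open>The elements at which the two sides agree form a subfield, so agreement on
  \<open>k\<close> and at \<open>x\<close> is enough.\<close>

lemma hom_derivation_commute:
  fixes k :: "'a::field set" and \<phi> :: "'a \<Rightarrow> 'b::field"
  assumes k: "is_subfield k" and \<phi>: "field_hom_on (adjoin k x) \<phi>"
    and D: "derivation_on UNIV D" and Dcl: "D ` adjoin k x \<subseteq> adjoin k x"
    and \<delta>: "derivation_on UNIV \<delta>" and base: "\<And>c. c \<in> k \<Longrightarrow> \<delta> (\<phi> c) = \<phi> (D c)" and gen: "\<delta> (\<phi> x) = \<phi> (D x)"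
    and a: "a \<in> adjoin k x"
  shows "\<delta> (\<phi> a) = \<phi> (D a)"
proof -
  note L = subfield_adjoin[OF k, of x] and U = subfield_UNIV
  have cl: "D a \<in> adjoin k x" if "a \<in> adjoin k x" for a using Dcl that by blast
  let ?S = "{a \<in> adjoin k x. \<delta> (\<phi> a) = \<phi> (D a)}"
  note L_facts = subfield_0[OF L] subfield_1[OF L] subfield_add[OF L] subfield_mult[OF L] subfield_uminus[OF L]
        subfield_inverse[OF L] subfield_divide[OF L] subfield_diff[OF L]
  have "is_subfield ?S"
    unfolding is_subfield_def
    by (simp add: derivation_0[OF U D] derivation_1[OF U D] derivation_add[OF U D] derivation_mult[OF U D]
      derivation_uminus[OF U D] derivation_inverse[OF U D] derivation_0[OF U \<delta>] derivation_1[OF U \<delta>]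
      derivation_add[OF U \<delta>] derivation_mult[OF U \<delta>] derivation_uminus[OF U \<delta>] derivation_inverse[OF U \<delta>]
      L_facts cl hom_0[OF L \<phi>] hom_1[OF L \<phi>] hom_add[OF L \<phi>] hom_mult[OF L \<phi>] hom_uminus[OF L \<phi>]
      hom_inverse[OF L \<phi>] hom_divide[OF L \<phi>])
  moreover have "k \<subseteq> ?S" using adjoin_base[OF k, of x] base by blast
  moreover have "x \<in> ?S" using adjoin_generator[OF k] gen by blast
  ultimately have "adjoin k x \<subseteq> ?S" by (rule adjoin_least[OF k])
  then show ?thesis using a by blast
qed

section \<open>Norms and traces via power sums\<close>

text \<open>Newton's identities: \<open>S\<close> is the generating function of the power sums, and the logarithmic
  derivative of \<open>\<Prod>(1 - a\<^sub>i X)\<close> is \<open>- S\<close>.\<close>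

lemma fps_deriv_prod_linear:
  fixes a :: "'i \<Rightarrow> 'a::field_char_0"
  assumes "finite I"
  shows "fps_deriv (\<Prod>i\<in>I. 1 - fps_const (a i) * fps_X)
    = - (Abs_fps (\<lambda>m. \<Sum>i\<in>I. a i ^ Suc m) * (\<Prod>i\<in>I. 1 - fps_const (a i) * fps_X))"
  using assms
proof (induction I rule: finite_induct)
  case empty
  have "Abs_fps (\<lambda>m. \<Sum>i\<in>{}. a i ^ Suc m) = 0" by (rule fps_ext) simp
  then show ?case by simp
next
  case (insert i I)
  let ?g = "1 - fps_const (a i) * fps_X" and ?F = "\<Prod>i\<in>I. 1 - fps_const (a i) * fps_X"
  let ?T = "Abs_fps (\<lambda>m. a i ^ Suc m)" and ?S = "Abs_fps (\<lambda>m. \<Sum>i\<in>I. a i ^ Suc m)"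
  \<comment> \<open>\<open>?T\<close> is the geometric series of
    \<open>a i / (1 - a i * X)\<close>.\<close>
  have "?T * ?g = ?T - fps_const (a i) * (?T * fps_X)" by (simp add: algebra_simps)
  also have "\<dots> = fps_const (a i)"
    by (rule fps_ext) (auto simp: fps_X_mult_right_nth gr0_conv_Suc)
  finally have T: "fps_const (a i) = ?T * ?g" ..
  have S: "Abs_fps (\<lambda>m. \<Sum>i\<in>insert i I. a i ^ Suc m) = ?T + ?S"
    using insert.hyps by (intro fps_ext) simp
  have "fps_deriv ?g = - fps_const (a i)" by simp
  then have d: "fps_deriv ?g = - (?T * ?g)" using T by (simp only:)
  have ring: "g * - (s * f) + - (t * g) * f = - ((t + s) * (g * f))" for g f s t :: "'a fps"
    by (simp add: algebra_simps)
  have "fps_deriv (?g * ?F) = - ((?T + ?S) * (?g * ?F))"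
    unfolding fps_deriv_mult d insert.IH by (rule ring)
  then show ?case unfolding S prod.insert[OF insert.hyps] .
qed

text \<open>Here \<open>e n\<close> is the \<open>n\<close>-th elementary symmetric function with
  sign \<open>(-1)^n\<close>; compare coefficients in the preceding lemma.\<close>

lemma power_sum_recursion:
  fixes a :: "'i \<Rightarrow> 'a::field_char_0"
  assumes "finite I"
  defines "e \<equiv> fps_nth (\<Prod>i\<in>I. 1 - fps_const (a i) * fps_X)"
  shows "of_nat (Suc n) * e (Suc n) = - (\<Sum>j\<le>n. (\<Sum>i\<in>I. a i ^ Suc j) * e (n - j))" "e 0 = 1"
proof -
  show "of_nat (Suc n) * e (Suc n) = - (\<Sum>j\<le>n. (\<Sum>i\<in>I. a i ^ Suc j) * e (n - j))"
    using arg_cong[OF fps_deriv_prod_linear[OF assms(1), of a], of "\<lambda>f. fps_nth f n"]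
    unfolding e_def by (simp add: fps_mult_nth atLeast0AtMost del: power_Suc of_nat_Suc)
  show "e 0 = 1"
    unfolding e_def using assms(1) by (induction I rule: finite_induct) simp_all
qed

lemma power_sums_in_subfield:
  fixes a :: "'i \<Rightarrow> 'a::field_char_0"
  assumes K: "is_subfield K" and I: "finite I"
    and e: "\<And>n. fps_nth (\<Prod>i\<in>I. 1 - fps_const (a i) * fps_X) n \<in> K"
  shows "(\<Sum>i\<in>I. a i ^ n) \<in> K"
proof -
  have "(\<Sum>i\<in>I. a i ^ Suc n) \<in> K" for n
  proof (induction n rule: less_induct)
    case (less n)
    let ?e = "fps_nth (\<Prod>i\<in>I. 1 - fps_const (a i) * fps_X)"
    let ?r = "\<Sum>j<n. (\<Sum>i\<in>I. a i ^ Suc j) * ?e (n - j)"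
    have "of_nat (Suc n) * ?e (Suc n) = - (\<Sum>j\<le>n. (\<Sum>i\<in>I. a i ^ Suc j) * ?e (n - j))"
      by (rule power_sum_recursion(1)[OF I])
    \<comment> \<open>The last term is the unknown power sum, whose coefficient \<open>?e 0\<close>
      is 1.\<close>
    also have "(\<Sum>j\<le>n. (\<Sum>i\<in>I. a i ^ Suc j) * ?e (n - j)) = ?r + (\<Sum>i\<in>I. a i ^ Suc n)"
      unfolding lessThan_Suc_atMost[symmetric] by (simp only: sum.lessThan_Suc power_sum_recursion(2)[OF I] diff_self_eq_0 mult_1_right)
    finally have rec: "of_nat (Suc n) * ?e (Suc n) = - (?r + (\<Sum>i\<in>I. a i ^ Suc n))" .
    have "p = - x - r" if "x = - (r + p)" for x r p :: 'a using that by simp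
    from this[OF rec] have "(\<Sum>i\<in>I. a i ^ Suc n) = - (of_nat (Suc n) * ?e (Suc n)) - ?r" .
    moreover have "?r \<in> K"
      by (intro subfield_sum[OF K] subfield_mult[OF K] less.IH e) simp
    ultimately show ?case
      using subfield_diff[OF K subfield_uminus[OF K subfield_mult[OF K subfield_of_nat[OF K] e]]] by (simp only:)
  qed
  \<comment> \<open>The recursion covers positive exponents only; the zeroth power sum is
    \<open>card I\<close>.\<close>
  then show ?thesis using subfield_of_nat[OF K, of "card I"] by (cases n) (simp, blast)
qed

text \<open>Newton's recursion solved in the other direction; the division by a positive integer
  uses characteristic zero.\<close>

lemma prod_linear_in_subfield:
  fixes a :: "'i \<Rightarrow> 'a::field_char_0"
  assumes K: "is_subfield K" and I: "finite I" and s: "\<And>n. (\<Sum>i\<in>I. a i ^ n) \<in> K"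
  shows "fps_nth (\<Prod>i\<in>I. 1 - fps_const (a i) * fps_X) n \<in> K"
proof (induction n rule: less_induct)
  case (less n)
  let ?e = "fps_nth (\<Prod>i\<in>I. 1 - fps_const (a i) * fps_X)"
  show ?case
  proof (cases n)
    case 0
    then show ?thesis using power_sum_recursion(2)[OF I, of a] subfield_1[OF K] by simp
  next
    case (Suc m)
    have "of_nat (Suc m) * ?e (Suc m) = - (\<Sum>j\<le>m. (\<Sum>i\<in>I. a i ^ Suc j) * ?e (m - j))"
      by (rule power_sum_recursion(1)[OF I])
    also have "- (\<Sum>j\<le>m. (\<Sum>i\<in>I. a i ^ Suc j) * ?e (m - j)) \<in> K"
      using Suc by (intro subfield_uminus[OF K] subfield_sum[OF K] subfield_mult[OF K] s less.IH) simp
    finally have "of_nat (Suc m) * ?e (Suc m) / of_nat (Suc m) \<in> K"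
      by (rule subfield_divide[OF K _ subfield_of_nat[OF K]])
    moreover have "of_nat (Suc m) * ?e (Suc m) / of_nat (Suc m) = ?e (Suc m)"
      using of_nat_neq_0[of m, where 'a = 'a] by (simp del: of_nat_Suc)
    ultimately show ?thesis using Suc by (simp only:)
  qed
qed

text \<open>The vanishing of the higher coefficients is carried along for the induction, since the
  new top coefficient involves the next coefficient of the old product.\<close>

lemma prod_linear_top_coeff:
  fixes a :: "'i \<Rightarrow> 'a::field"
  assumes "finite I"
  shows "fps_nth (\<Prod>i\<in>I. 1 - fps_const (a i) * fps_X) (card I) = (\<Prod>i\<in>I. - a i)
    \<and> (\<forall>n>card I. fps_nth (\<Prod>i\<in>I. 1 - fps_const (a i) * fps_X) n = 0)"
  using assms
proof (induction I rule: finite_induct)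
  case (insert i I)
  let ?F = "\<Prod>i\<in>I. 1 - fps_const (a i) * fps_X"
  have "fps_nth ((1 - fps_const (a i) * fps_X) * ?F) (Suc n) = fps_nth ?F (Suc n) - a i * fps_nth ?F n" for n
  proof -
    have "(1 - fps_const (a i) * fps_X) * ?F = ?F - fps_const (a i) * (?F * fps_X)"
      by (simp add: algebra_simps)
    then show ?thesis by (simp only: fps_sub_nth fps_mult_left_const_nth fps_X_mult_right_nth) simp
  qed
  then show ?case using insert by (auto simp: Suc_less_eq2)
qed simp

text \<open>Reduces membership of norms to that of traces of powers.\<close>

lemma prod_in_subfield:
  fixes a :: "'i \<Rightarrow> 'a::field_char_0"
  assumes K: "is_subfield K" and I: "finite I" and s: "\<And>n. (\<Sum>i\<in>I. a i ^ n) \<in> K"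
  shows "(\<Prod>i\<in>I. a i) \<in> K"
proof -
  have "(\<Prod>i\<in>I. - a i) \<in> K"
    using prod_linear_in_subfield[OF assms, of "card I"] prod_linear_top_coeff[OF I, of a] by simp
  moreover have "(\<Prod>i\<in>I. - a i) = (- 1) ^ card I * (\<Prod>i\<in>I. a i)"
    by (rule prod_uminus)
  moreover have "(- 1) ^ card I * ((- 1) ^ card I * (\<Prod>i\<in>I. a i)) = (\<Prod>i\<in>I. a i)"
    by (simp add: mult.assoc[symmetric] power_mult_distrib[symmetric])
  ultimately show ?thesis
    using subfield_mult[OF K subfield_power[OF K subfield_uminus[OF K subfield_1[OF K]]]] by metis
qed

text \<open>\<open>r\<close> lists the roots of \<open>P\<close>, so the sums and products in the
  conclusion are the trace and norm of \<open>poly f x\<close> over \<open>k\<close>.\<close>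

lemma minimal_poly_roots:
  fixes k :: "'a::{alg_closed_field, field_char_0} set"
  assumes k: "is_subfield k" and P: "minimal_poly k x P"
  shows "\<exists>n>0. \<exists>r :: nat \<Rightarrow> 'a. (\<forall>i<n. poly P (r i) = 0) \<and>
    (\<forall>f\<in>poly_over k. (\<Sum>i<n. poly f (r i)) \<in> k \<and> (\<Prod>i<n. poly f (r i)) \<in> k)"
proof -
  have P0: "P \<noteq> 0" and PK: "P \<in> poly_over k" using P by (auto simp: minimal_poly_def[OF k])
  obtain A where A: "size A = degree P" "P = smult (lead_coeff P) (\<Prod>x\<in>#A. [:-x, 1:])"
    using alg_closed_imp_factorization[OF P0] by blast
  obtain xs where xs: "mset xs = A" using ex_mset by blast
  define n where "n = length xs"
  define r where "r i = xs ! i" for i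
  define Q where "Q = (\<Prod>i<n. [:- r i, 1:])"
  have "(\<Prod>x\<in>#A. [:-x, 1:]) = prod_list (map (\<lambda>x. [:-x, 1:]) xs)"
    unfolding xs[symmetric] by (simp flip: mset_map add: prod_mset_prod_list)
  also have "\<dots> = Q"
    unfolding Q_def n_def r_def prod.list_conv_set_nth by (simp add: atLeast0LessThan)
  finally have PQ: "P = smult (lead_coeff P) Q" using A(2) by simp
  have n: "n > 0" using minimal_poly_degree_pos[OF k P] A(1) unfolding n_def xs[symmetric] by simp
  have root: "poly P (r i) = 0" if "i < n" for i
  proof -
    have "poly Q (r i) = 0" unfolding Q_def poly_prod using that by (intro prod_zero bexI[of _ i]) simp_all
    then show ?thesis by (subst PQ) simp
  qed
  have "Q = smult (inverse c) P" if "P = smult c Q" "c \<noteq> 0" for c using that by simp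
  from this[OF PQ] P0 have "Q = smult (inverse (lead_coeff P)) P" by simp
  then have Qk: "coeff Q i \<in> k" for i
    using PK by (simp add: coeff_poly_over subfield_mult[OF k] subfield_inverse[OF k])
  have refl: "reflect_poly [:- c, 1:] = [:1, - c:]" for c :: 'a
    by (cases "c = 0") (simp_all add: reflect_poly_pCons reflect_poly_pCons' monom_0 monom_Suc)
  \<comment> \<open>This product is the reversal of \<open>Q\<close>, the monic multiple of
    \<open>P\<close>; its coefficients therefore lie in \<open>k\<close>.\<close>
  have "(\<Prod>i<n. 1 - fps_const (r i) * fps_X) = fps_of_poly (\<Prod>i<n. [:1, - r i:])"
    by (simp add: fps_of_poly_prod fps_of_poly_linear' flip: fps_const_neg)
  also have "(\<Prod>i<n. [:1, - r i:]) = reflect_poly Q"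
    by (simp add: Q_def reflect_poly_prod refl)
  finally have e: "fps_nth (\<Prod>i<n. 1 - fps_const (r i) * fps_X) m \<in> k" for m
    by (simp add: coeff_reflect_poly Qk subfield_0[OF k])
  have ps: "(\<Sum>i<n. r i ^ m) \<in> k" for m
    by (rule power_sums_in_subfield[OF k _ e]) simp
  have tr: "(\<Sum>i<n. poly f (r i)) \<in> k" if "f \<in> poly_over k" for f
  proof -
    have "(\<Sum>i<n. poly f (r i)) = (\<Sum>m\<le>degree f. coeff f m * (\<Sum>i<n. r i ^ m))"
      by (simp add: poly_altdef sum_distrib_left) (rule sum.swap)
    then show ?thesis using that by (auto intro!: subfield_sum[OF k] subfield_mult[OF k] ps coeff_poly_over)
  qed
  \<comment> \<open>The power sums of the values of \<open>f\<close> are the traces of the powers of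
    \<open>f\<close>.\<close>
  have "(\<Prod>i<n. poly f (r i)) \<in> k" if "f \<in> poly_over k" for f
    by (rule prod_in_subfield[OF k])
      (use tr[OF poly_over_power[OF k that]] in \<open>simp_all add: poly_power\<close>)
  then show ?thesis using n root tr by (intro exI[of _ n] conjI exI[of _ r]) auto
qed

text \<open>\<open>\<sigma> i\<close> sends \<open>x\<close> to the \<open>i\<close>-th root of its
  minimal polynomial. It commutes with \<open>D\<close> because \<open>D\<close> is given at all
  roots by one rational expression.\<close>

lemma conjugate_embeddings:
  fixes k :: "'a::{alg_closed_field, field_char_0} set"
  assumes k: "is_subfield k" and x: "x \<in> algebraic_closure_in k"
    and D: "derivation_on UNIV D" and Dk: "D ` k \<subseteq> k"
  shows "\<exists>n>0. \<exists>\<sigma> :: nat \<Rightarrow> 'a \<Rightarrow> 'a.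
    (\<forall>i<n. field_hom_on (adjoin k x) (\<sigma> i) \<and> (\<forall>c\<in>k. \<sigma> i c = c) \<and>
      (\<forall>a\<in>adjoin k x. D (\<sigma> i a) = \<sigma> i (D a))) \<and>
    D ` adjoin k x \<subseteq> adjoin k x \<and>
    (\<forall>a\<in>adjoin k x. (\<Sum>i<n. \<sigma> i a) \<in> k \<and> (\<Prod>i<n. \<sigma> i a) \<in> k)"
proof -
  note L = subfield_adjoin[OF k, of x]
  obtain P where P: "minimal_poly k x P" using minimal_poly_exists[OF k x] .
  have PK: "P \<in> poly_over k" and Px: "poly P x = 0" using P by (auto simp: minimal_poly_def[OF k])
  obtain n and r :: "nat \<Rightarrow> 'a" where n: "n > 0" and root: "\<And>i. i < n \<Longrightarrow> poly P (r i) = 0"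
    and tr: "\<And>f. f \<in> poly_over k \<Longrightarrow> (\<Sum>i<n. poly f (r i)) \<in> k"
    and nm: "\<And>f. f \<in> poly_over k \<Longrightarrow> (\<Prod>i<n. poly f (r i)) \<in> k"
    using minimal_poly_roots[OF k P] by blast
  have "\<exists>\<phi>. field_hom_on (adjoin k x) \<phi> \<and> (\<forall>f\<in>poly_over k. \<phi> (poly f x) = poly f (r i))" if "i < n" for i
    by (rule adjoin_hom[OF k]) (simp_all add: minimal_poly_conjugate[OF k P root[OF that]])
  then obtain \<sigma> where \<sigma>: "\<forall>i<n. field_hom_on (adjoin k x) (\<sigma> i) \<and> (\<forall>f\<in>poly_over k. \<sigma> i (poly f x) = poly f (r i))"
    by metis
  then have hom: "field_hom_on (adjoin k x) (\<sigma> i)" and ev: "\<And>f. f \<in> poly_over k \<Longrightarrow> \<sigma> i (poly f x) = poly f (r i)"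
    if "i < n" for i using that by blast+
  have fixed: "\<sigma> i c = c" if "i < n" "c \<in> k" for i c
    using ev[OF that(1) poly_over_const[OF k that(2)]] by simp
  note Dalg = algebraic_derivation_in_adjoin[OF k D Dk P]
  have Pd: "pderiv P \<in> poly_over k" using poly_over_pderiv[OF k PK] .
  have DP: "map_poly D P \<in> poly_over k" using Dalg(2)[OF Px] .
  have Dx: "D x \<in> adjoin k x"
    unfolding Dalg(1)[OF Px]
    by (intro subfield_divide[OF L] subfield_uminus[OF L] poly_in_adjoin[OF k] Pd DP)
  have Dcl: "D ` adjoin k x \<subseteq> adjoin k x" by (rule adjoin_derivation_closed[OF k D Dk Dx])
  have comm: "D (\<sigma> i a) = \<sigma> i (D a)" if i: "i < n" and a: "a \<in> adjoin k x" for i a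
  proof (rule hom_derivation_commute[OF k hom[OF i] D Dcl D _ _ a])
    show "D (\<sigma> i c) = \<sigma> i (D c)" if "c \<in> k" for c
      using fixed[OF i that] fixed[OF i, of "D c"] Dk that by auto
    have "\<sigma> i x = r i" using ev[OF i poly_over_X[OF k]] by simp
    moreover have "\<sigma> i (D x) = - poly (map_poly D P) (r i) / poly (pderiv P) (r i)"
      unfolding Dalg(1)[OF Px]
      by (simp add: hom_divide[OF L hom[OF i]] hom_uminus[OF L hom[OF i]] poly_in_adjoin[OF k] subfield_divide[OF L]
        Pd DP ev[OF i])
    ultimately show "D (\<sigma> i x) = \<sigma> i (D x)" using Dalg(1)[OF root[OF i]] by simp
  qed
  have "(\<Sum>i<n. \<sigma> i a) \<in> k \<and> (\<Prod>i<n. \<sigma> i a) \<in> k" if a: "a \<in> adjoin k x" for a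
  proof -
    obtain f where f: "f \<in> poly_over k" "a = poly f x" using a adjoin_algebraic[OF k x] by blast
    then show ?thesis using tr[OF f(1)] nm[OF f(1)] ev by simp
  qed
  then show ?thesis using n hom fixed comm Dcl by (intro exI[of _ n] conjI exI[of _ \<sigma>]) auto
qed

section \<open>Logarithmic differential relations\<close>

text \<open>The relation of differentials \<open>sum \<gamma> dy/y = du\<close> contracted with a
  single derivation, with the \<open>y j\<close> and \<open>u\<close> confined to
  \<open>k\<close>.\<close>

definition log_relation :: "('a::field \<Rightarrow> 'a) \<Rightarrow> 'i set \<Rightarrow> ('i \<Rightarrow> 'a) \<Rightarrow> 'a set \<Rightarrow> ('i \<Rightarrow> 'a) \<Rightarrow> 'a \<Rightarrow> bool" where
  "log_relation D J \<gamma> k y u \<longleftrightarrow> (\<forall>j\<in>J. y j \<in> k \<and> y j \<noteq> 0) \<and> u \<in> k \<and> (\<Sum>j\<in>J. \<gamma> j * (D (y j) / y j)) = D u"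

lemma derivation_prod:
  assumes D: "derivation_on UNIV D" and "finite A" "\<And>i. i \<in> A \<Longrightarrow> f i \<noteq> 0"
  shows "D (\<Prod>i\<in>A. f i) / (\<Prod>i\<in>A. f i) = (\<Sum>i\<in>A. D (f i) / f i)"
  using assms(2,3)
proof (induction A rule: finite_induct)
  case empty
  then show ?case using derivation_1[OF subfield_UNIV D] by simp
next
  case (insert i A)
  then have "(\<Prod>i\<in>A. f i) \<noteq> 0" "f i \<noteq> 0" by simp_all
  moreover have "D (f i * (\<Prod>i\<in>A. f i)) = f i * D (\<Prod>i\<in>A. f i) + (\<Prod>i\<in>A. f i) * D (f i)"
    by (rule derivation_mult[OF subfield_UNIV D]) simp_all
  ultimately have "D (f i * (\<Prod>i\<in>A. f i)) / (f i * (\<Prod>i\<in>A. f i)) = D (f i) / f i + D (\<Prod>i\<in>A. f i) / (\<Prod>i\<in>A. f i)"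
    by (simp add: add_divide_distrib)
  then show ?case using insert by simp
qed

text \<open>Apply all embeddings to the relation and add. They fix the \<open>\<gamma> j\<close>,
  and logarithmic derivatives turn products into sums, so \<open>y'\<close> consists of norms and
  \<open>u'\<close> is a trace. An entry already in \<open>k\<close> is merely raised to the power
  \<open>n\<close>.\<close>

lemma log_relation_descent_step:
  fixes k :: "'a::{alg_closed_field, field_char_0} set"
  assumes k: "is_subfield k" and x: "x \<in> algebraic_closure_in k"
    and D: "derivation_on UNIV D" and Dk: "D ` k \<subseteq> k"
    and \<gamma>: "\<And>j. j \<in> J \<Longrightarrow> \<gamma> j \<in> k" and rel: "log_relation D J \<gamma> (adjoin k x) y u"
  shows "\<exists>n>0. \<exists>y' u'. log_relation D J \<gamma> k y' u' \<and> (\<forall>j. y j \<in> k \<longrightarrow> y' j = y j ^ n)"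
proof -
  note L = subfield_adjoin[OF k, of x]
  from conjugate_embeddings[OF k x D Dk]
  obtain n and \<sigma> :: "nat \<Rightarrow> 'a \<Rightarrow> 'a" where n: "n > 0"
    and \<sigma>: "\<forall>i<n. field_hom_on (adjoin k x) (\<sigma> i) \<and> (\<forall>c\<in>k. \<sigma> i c = c) \<and>
      (\<forall>a\<in>adjoin k x. D (\<sigma> i a) = \<sigma> i (D a))"
    and Dcl: "D ` adjoin k x \<subseteq> adjoin k x"
    and ntr: "\<forall>a\<in>adjoin k x. (\<Sum>i<n. \<sigma> i a) \<in> k \<and> (\<Prod>i<n. \<sigma> i a) \<in> k"
    by (elim exE conjE) (rule that)
  have hom: "field_hom_on (adjoin k x) (\<sigma> i)" and fixed: "\<And>c. c \<in> k \<Longrightarrow> \<sigma> i c = c"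
    and comm: "\<And>a. a \<in> adjoin k x \<Longrightarrow> D (\<sigma> i a) = \<sigma> i (D a)" if "i < n" for i
    using \<sigma> that by blast+
  have tr: "(\<Sum>i<n. \<sigma> i a) \<in> k" and nm: "(\<Prod>i<n. \<sigma> i a) \<in> k" if "a \<in> adjoin k x" for a
    using ntr that by blast+
  have cl: "D a \<in> adjoin k x" if "a \<in> adjoin k x" for a using Dcl that by blast
  have y: "y j \<in> adjoin k x" "y j \<noteq> 0" if "j \<in> J" for j using rel that by (auto simp: log_relation_def)
  have u: "u \<in> adjoin k x" and eq: "(\<Sum>j\<in>J. \<gamma> j * (D (y j) / y j)) = D u" using rel by (auto simp: log_relation_def)
  define y' where "y' j = (\<Prod>i<n. \<sigma> i (y j))" for j
  define u' where "u' = (\<Sum>i<n. \<sigma> i u)"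
  have nz: "\<sigma> i (y j) \<noteq> 0" if "i < n" "j \<in> J" for i j
    using hom_nonzero[OF L hom[OF that(1)]] y[OF that(2)] by blast
  have dlog: "D (y' j) / y' j = (\<Sum>i<n. \<sigma> i (D (y j) / y j))" if j: "j \<in> J" for j
  proof -
    have "D (y' j) / y' j = (\<Sum>i<n. D (\<sigma> i (y j)) / \<sigma> i (y j))"
      unfolding y'_def by (rule derivation_prod[OF D]) (use nz j in auto)
    also have "\<dots> = (\<Sum>i<n. \<sigma> i (D (y j) / y j))"
      using y[OF j] by (intro sum.cong refl) (simp add: comm hom_divide[OF L hom] cl)
    finally show ?thesis .
  qed
  have "(\<Sum>j\<in>J. \<gamma> j * (D (y' j) / y' j)) = (\<Sum>j\<in>J. \<Sum>i<n. \<gamma> j * \<sigma> i (D (y j) / y j))"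
    by (simp add: dlog sum_distrib_left)
  also have "\<dots> = (\<Sum>i<n. \<Sum>j\<in>J. \<gamma> j * \<sigma> i (D (y j) / y j))" by (rule sum.swap)
  also have "\<dots> = (\<Sum>i<n. \<sigma> i (D u))"
  proof (intro sum.cong refl)
    fix i assume "i \<in> {..<n}"
    then have i: "i < n" by simp
    have \<gamma>L: "\<gamma> j \<in> adjoin k x" if "j \<in> J" for j using \<gamma>[OF that] adjoin_base[OF k, of x] by blast
    have "\<sigma> i (D u) = (\<Sum>j\<in>J. \<sigma> i (\<gamma> j * (D (y j) / y j)))"
      unfolding eq[symmetric] by (rule hom_sum[OF L hom[OF i]])
        (intro subfield_mult[OF L] subfield_divide[OF L] \<gamma>L cl y)
    also have "\<dots> = (\<Sum>j\<in>J. \<gamma> j * \<sigma> i (D (y j) / y j))"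
      using y by (intro sum.cong refl)
        (simp add: hom_mult[OF L hom[OF i]] \<gamma>L cl subfield_divide[OF L] fixed[OF i \<gamma>] del: times_divide_eq_right)
    finally show "(\<Sum>j\<in>J. \<gamma> j * \<sigma> i (D (y j) / y j)) = \<sigma> i (D u)" ..
  qed
  also have "\<dots> = (\<Sum>i<n. D (\<sigma> i u))" using u comm by simp
  also have "\<dots> = D u'" unfolding u'_def by (rule derivation_sum[OF subfield_UNIV D, symmetric]) simp
  finally have "(\<Sum>j\<in>J. \<gamma> j * (D (y' j) / y' j)) = D u'" .
  moreover have "y' j \<in> k \<and> y' j \<noteq> 0" if "j \<in> J" for j
    using nm[OF y(1)[OF that]] nz that by (simp add: y'_def)
  moreover have "u' \<in> k" using tr[OF u] by (simp add: u'_def)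
  moreover have "y' j = y j ^ n" if "y j \<in> k" for j
    using fixed[OF _ that] by (simp add: y'_def)
  ultimately have "log_relation D J \<gamma> k y' u'" "\<forall>j. y j \<in> k \<longrightarrow> y' j = y j ^ n"
    by (auto simp: log_relation_def)
  then show ?thesis using n by blast
qed

text \<open>Descends through a tower of simple algebraic extensions; the exponents of the steps
  multiply and stay positive.\<close>

lemma log_relation_descent:
  fixes k :: "'a::{alg_closed_field, field_char_0} set"
  assumes "is_subfield k" "derivation_on UNIV D" "D ` k \<subseteq> k" "\<And>j. j \<in> J \<Longrightarrow> \<gamma> j \<in> k"
    "set xs \<subseteq> algebraic_closure_in k" "log_relation D J \<gamma> (foldl adjoin k xs) y u"
  shows "\<exists>n>0. \<exists>y' u'. log_relation D J \<gamma> k y' u' \<and> (\<forall>j. y j \<in> k \<longrightarrow> y' j = y j ^ n)"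
  using assms
proof (induction xs arbitrary: k)
  case Nil
  then show ?case by (intro exI[of _ 1]) auto
next
  case (Cons x xs)
  note k = Cons.prems(1) and D = Cons.prems(2) and Dk = Cons.prems(3)
  have x: "x \<in> algebraic_closure_in k" using Cons.prems(5) by simp
  have sub: "k \<subseteq> adjoin k x" by (rule adjoin_base[OF k])
  have cl: "D ` adjoin k x \<subseteq> adjoin k x"
    using conjugate_embeddings[OF k x D Dk] by blast
  have "\<exists>n>0. \<exists>y' u'. log_relation D J \<gamma> (adjoin k x) y' u' \<and> (\<forall>j. y j \<in> adjoin k x \<longrightarrow> y' j = y j ^ n)"
  proof (rule Cons.IH[OF subfield_adjoin[OF k] D cl])
    show "\<gamma> j \<in> adjoin k x" if "j \<in> J" for j using Cons.prems(4)[OF that] sub by blast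
    show "set xs \<subseteq> algebraic_closure_in (adjoin k x)"
      using Cons.prems(5) algebraic_closure_in_mono[OF sub] by auto
    show "log_relation D J \<gamma> (foldl adjoin (adjoin k x) xs) y u" using Cons.prems(6) by simp
  qed
  then obtain n y' u' where n: "n > 0" "log_relation D J \<gamma> (adjoin k x) y' u'"
    "\<And>j. y j \<in> adjoin k x \<Longrightarrow> y' j = y j ^ n" by blast
  obtain m y'' u'' where m: "m > 0" "log_relation D J \<gamma> k y'' u''" "\<And>j. y' j \<in> k \<Longrightarrow> y'' j = y' j ^ m"
    using log_relation_descent_step[OF k x D Dk Cons.prems(4) n(2)] by blast
  have "y'' j = y j ^ (n * m)" if "y j \<in> k" for j
    using that n(3)[of j] m(3)[of j] sub subfield_power[OF k that, of n] by (auto simp: power_mult)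
  moreover have "n * m > 0" using n m by simp
  ultimately show ?case using m(2) by blast
qed

lemma foldl_adjoin:
  assumes "is_subfield k"
  shows "is_subfield (foldl adjoin k xs)" "k \<subseteq> foldl adjoin k xs" "set xs \<subseteq> foldl adjoin k xs"
proof -
  have "is_subfield (foldl adjoin k xs) \<and> k \<subseteq> foldl adjoin k xs \<and> set xs \<subseteq> foldl adjoin k xs"
    using assms
  proof (induction xs arbitrary: k)
    case (Cons x xs)
    then show ?case
      using Cons.IH[OF subfield_adjoin[OF Cons.prems, of x]] adjoin_base[OF Cons.prems, of x]
        adjoin_generator[OF Cons.prems, of x] by auto
  qed simp
  then show "is_subfield (foldl adjoin k xs)" "k \<subseteq> foldl adjoin k xs" "set xs \<subseteq> foldl adjoin k xs"
    by blast+
qed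

text \<open>Over a rational function field the residue at \<open>z = 0\<close> turns the relation into one between orders of vanishing.\<close>

lemma log_relation_residue:
  fixes M :: "'a::field_char_0 set"
  assumes M: "is_subfield M" and z: "z \<notin> algebraic_closure_in M"
    and D: "D \<in> Der M" and Dz: "D z = 1"
    and \<gamma>: "\<And>j. j \<in> J \<Longrightarrow> \<gamma> j \<in> M" and rel: "log_relation D J \<gamma> (adjoin M z) y u"
  shows "\<exists>q :: 'i \<Rightarrow> int. (\<Sum>j\<in>J. of_int (q j) * \<gamma> j) = 0 \<and>
    (\<forall>j\<in>J. \<forall>n. y j = z ^ n \<longrightarrow> q j = int n)"
proof -
  note L = subfield_adjoin[OF M, of z]
  \<comment> \<open>The Laurent expansion at \<open>z = 0\<close>, with \<open>z\<close> sent to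
    \<open>fls_X\<close>. Since \<open>z\<close> is transcendental over \<open>M\<close>, only the
    zero polynomial expands to 0.\<close>
  define ev :: "'a poly \<Rightarrow> 'a fls" where "ev f = fps_to_fls (fps_of_poly f)" for f
  have "\<exists>\<phi>. field_hom_on (adjoin M z) \<phi> \<and> (\<forall>f\<in>poly_over M. \<phi> (poly f z) = ev f)"
  proof (rule adjoin_hom[OF M])
    show "ev f = 0 \<longleftrightarrow> poly f z = 0" if "f \<in> poly_over M" for f
    proof -
      have "f = 0" if "poly f z = 0"
        using that z \<open>f \<in> poly_over M\<close> unfolding algebraic_closure_in_def poly_over_def by blast
      moreover have "ev f = 0 \<longleftrightarrow> f = 0"
        unfolding ev_def fps_to_fls_eq_0_iff using fps_of_poly_eq_iff[of f 0] by simp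
      ultimately show ?thesis by auto
    qed
  qed (simp_all add: ev_def fps_of_poly_add fps_of_poly_mult fls_times_fps_to_fls)
  then obtain \<phi> where hom: "field_hom_on (adjoin M z) \<phi>" and ev: "\<And>f. f \<in> poly_over M \<Longrightarrow> \<phi> (poly f z) = ev f"
    by blast
  have \<phi>c: "\<phi> c = fls_const c" if "c \<in> M" for c
    using ev[OF poly_over_const[OF M that]] by (simp add: ev_def fps_of_poly_const)
  have \<phi>z: "\<phi> z = fls_X" using ev[OF poly_over_X[OF M]] by (simp add: ev_def)
  have Dd: "derivation_on UNIV D" using D by (rule Der_derivation)
  have \<delta>: "derivation_on UNIV (fls_deriv :: 'a fls \<Rightarrow> 'a fls)"
    by (simp add: derivation_on_def mult.commute)
  have DM: "D ` M \<subseteq> M" using Der_zero[OF D] subfield_0[OF M] by auto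
  have Dcl: "D ` adjoin M z \<subseteq> adjoin M z"
    by (rule adjoin_derivation_closed[OF M Dd DM]) (simp add: Dz subfield_1[OF L])
  then have cl: "D a \<in> adjoin M z" if "a \<in> adjoin M z" for a using that by blast
  have comm: "fls_deriv (\<phi> a) = \<phi> (D a)" if "a \<in> adjoin M z" for a
    by (rule hom_derivation_commute[OF M hom Dd Dcl \<delta> _ _ that])
      (simp_all add: \<phi>c \<phi>z Der_zero[OF D] Dz hom_0[OF L hom] hom_1[OF L hom])
  have y: "y j \<in> adjoin M z" "y j \<noteq> 0" if "j \<in> J" for j using rel that by (auto simp: log_relation_def)
  have u: "u \<in> adjoin M z" and eq: "(\<Sum>j\<in>J. \<gamma> j * (D (y j) / y j)) = D u" using rel by (auto simp: log_relation_def)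
  have \<gamma>L: "\<gamma> j \<in> adjoin M z" if "j \<in> J" for j using \<gamma>[OF that] adjoin_base[OF M, of z] by blast
  \<comment> \<open>The order of \<open>y j\<close> at \<open>z = 0\<close>.\<close>
  define q where "q j = fls_subdegree (\<phi> (y j))" for j
  have "fls_deriv (\<phi> u) = \<phi> (\<Sum>j\<in>J. \<gamma> j * (D (y j) / y j))" unfolding eq by (rule comm[OF u])
  also have "\<dots> = (\<Sum>j\<in>J. \<phi> (\<gamma> j * (D (y j) / y j)))"
    by (rule hom_sum[OF L hom]) (intro subfield_mult[OF L] subfield_divide[OF L] \<gamma>L cl y)
  also have "\<dots> = (\<Sum>j\<in>J. fls_const (\<gamma> j) * (fls_deriv (\<phi> (y j)) * inverse (\<phi> (y j))))"
  proof (intro sum.cong refl)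
    fix j assume j: "j \<in> J"
    note yj = y(1)[OF j]
    show "\<phi> (\<gamma> j * (D (y j) / y j)) = fls_const (\<gamma> j) * (fls_deriv (\<phi> (y j)) * inverse (\<phi> (y j)))"
      by (simp only: hom_mult[OF L hom \<gamma>L[OF j] subfield_divide[OF L cl[OF yj] yj]]
        hom_divide[OF L hom cl[OF yj] yj] comm[OF yj] \<phi>c[OF \<gamma>[OF j]] divide_inverse[of "\<phi> (D (y j))" "\<phi> (y j)"])
  qed
  finally have "fls_residue (fls_deriv (\<phi> u))
      = fls_residue (\<Sum>j\<in>J. fls_const (\<gamma> j) * (fls_deriv (\<phi> (y j)) * inverse (\<phi> (y j))))" by (rule arg_cong)
  \<comment> \<open>A derivative has residue 0, while the residue of a logarithmic derivative is the
    order.\<close>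
  then have "0 = (\<Sum>j\<in>J. fls_residue (fls_const (\<gamma> j) * (fls_deriv (\<phi> (y j)) * inverse (\<phi> (y j)))))"
    unfolding fls_residue_deriv by (simp only: fls_residue_def fls_nth_sum)
  also have "\<dots> = (\<Sum>j\<in>J. of_int (q j) * \<gamma> j)"
    unfolding fls_residue_fls_const_times fls_residue_deriv_times_inverse_eq_subdegree q_def
    by (intro sum.cong refl mult.commute)
  finally have "(\<Sum>j\<in>J. of_int (q j) * \<gamma> j) = 0" ..
  moreover have "q j = int n" if "j \<in> J" "y j = z ^ n" for j n
    unfolding q_def that(2) hom_power[OF L hom adjoin_generator[OF M]] \<phi>z by simp
  ultimately show ?thesis by blast
qed

text \<open>If \<open>y i\<close> is outside \<open>K\<close>, it is transcendental over
  \<open>K\<close> and can serve as the variable of a field \<open>M(y i)\<close> over which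
  everything is algebraic. After descent, residues give an integer relation among the
  \<open>\<gamma> j\<close> whose coefficient at \<open>i\<close> is the order \<open>n > 0\<close>
  of \<open>y i ^ n\<close>, against \<open>indep\<close>.\<close>

theorem log_relation_trivial:
  fixes K :: "'a::{alg_closed_field, field_char_0} set"
  assumes K: "is_subfield K" and acl: "algebraic_closure_in K \<subseteq> K" and J: "finite J"
    and \<gamma>: "\<And>j. j \<in> J \<Longrightarrow> \<gamma> j \<in> K"
    and indep: "\<And>q :: 'i \<Rightarrow> int. (\<Sum>j\<in>J. of_int (q j) * \<gamma> j) = 0 \<Longrightarrow> \<forall>j\<in>J. q j = 0"
    and y: "\<And>j. j \<in> J \<Longrightarrow> y j \<noteq> 0"
    and rel: "\<And>D. D \<in> Der K \<Longrightarrow> (\<Sum>j\<in>J. \<gamma> j * (D (y j) / y j)) = D u"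
    and i: "i \<in> J"
  shows "y i \<in> K"
proof (rule ccontr)
  assume "y i \<notin> K"
  then have "y i \<notin> algebraic_closure_in K" using acl by blast
  then obtain M where M: "is_subfield M" "K \<subseteq> M" "y i \<notin> algebraic_closure_in M"
    and alg: "\<And>x. x \<in> algebraic_closure_in (adjoin M (y i))"
    using maximal_subfield_avoiding[OF K] by blast
  obtain D where D: "D \<in> Der M" "D (y i) = 1" by (rule transcendental_derivation[OF M(1,3)])
  define k where "k = adjoin M (y i)"
  have k: "is_subfield k" unfolding k_def by (rule subfield_adjoin[OF M(1)])
  have Dd: "derivation_on UNIV D" using D(1) by (rule Der_derivation)
  have "D ` M \<subseteq> M" using Der_zero[OF D(1)] subfield_0[OF M(1)] by auto
  then have Dk: "D ` k \<subseteq> k"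
    unfolding k_def by (rule adjoin_derivation_closed[OF M(1) Dd]) (simp add: D(2) subfield_1[OF subfield_adjoin[OF M(1)]])
  obtain xs where xs: "set xs = insert u (y ` J)" using finite_list[of "insert u (y ` J)"] J by auto
  have "D \<in> Der K" using D(1) M(2) by (auto simp: Der_def)
  then have "log_relation D J \<gamma> (foldl adjoin k xs) y u"
    unfolding log_relation_def using foldl_adjoin(3)[OF k, of xs] xs y rel by blast
  moreover have \<gamma>M: "\<gamma> j \<in> M" if "j \<in> J" for j using \<gamma>[OF that] M(2) by blast
  then have "\<gamma> j \<in> k" if "j \<in> J" for j using that adjoin_base[OF M(1), of "y i"] unfolding k_def by blast
  moreover have "set xs \<subseteq> algebraic_closure_in k" using alg unfolding k_def by blast
  ultimately obtain n y' u' where n: "n > 0" "log_relation D J \<gamma> k y' u'" "\<And>j. y j \<in> k \<Longrightarrow> y' j = y j ^ n"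
    using log_relation_descent[OF k Dd Dk, of J \<gamma> xs y u] by blast
  have y'i: "y' i = y i ^ n" using n(3) adjoin_generator[OF M(1), of "y i"] unfolding k_def by blast
  obtain q :: "'i \<Rightarrow> int" where q: "(\<Sum>j\<in>J. of_int (q j) * \<gamma> j) = 0" "\<And>j n. j \<in> J \<Longrightarrow> y' j = y i ^ n \<Longrightarrow> q j = int n"
    using log_relation_residue[OF M(1,3) D \<gamma>M n(2)[unfolded k_def]] by blast
  have "q i = 0" using indep[OF q(1)] i by blast
  then show False using q(2)[OF i y'i] n(1) by simp
qed

section \<open>Algebraic independence\<close>

text \<open>Induction on \<open>S\<close>: read as a polynomial in \<open>s\<close> over the field
  generated by \<open>K\<close> and the remaining variables, the sum has only zero coefficients, and
  each of these is a sum of the same kind. \<open>M\<close> is an abstract index set, so fixing the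
  exponent of \<open>s\<close> only shrinks it.\<close>

lemma monomials_independent:
  fixes K :: "'a::field set"
  assumes "is_subfield K" "finite S" "\<And>s. s \<in> S \<Longrightarrow> s \<notin> algebraic_closure_in (generated_subfield (K \<union> (S - {s})))"
    and "finite M" "\<And>m. m \<in> M \<Longrightarrow> a m \<in> K"
    and "\<And>m m'. m \<in> M \<Longrightarrow> m' \<in> M \<Longrightarrow> (\<forall>x\<in>S. e m x = e m' x) \<Longrightarrow> m = m'"
    and "(\<Sum>m\<in>M. a m * (\<Prod>x\<in>S. x ^ e m x)) = 0" "m \<in> M"
  shows "a m = 0"
  using assms(2-)
proof (induction S arbitrary: M m rule: finite_induct)
  case empty
  then have "M = {m}" by blast
  then show ?case using empty.prems by simp
next
  case (insert s S)
  let ?L = "generated_subfield (K \<union> S)"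
  have L: "is_subfield ?L" by (rule subfield_generated)
  have KL: "K \<subseteq> ?L" "S \<subseteq> ?L" using generated_subfield_superset[of "K \<union> S"] by auto
  define b where "b m = a m * (\<Prod>x\<in>S. x ^ e m x)" for m
  have b: "b m \<in> ?L" if "m \<in> M" for m
    unfolding b_def using insert.prems(3)[OF that] KL
    by (intro subfield_mult[OF L] subfield_prod[OF L] subfield_power[OF L]) blast+
  define p where "p = (\<Sum>m\<in>M. monom (b m) (e m s))"
  have "p \<in> poly_over ?L"
    unfolding p_def by (intro poly_over_sum[OF L] poly_over_monom[OF L] b)
  moreover have "poly p s = 0"
    using insert.prems(5) insert.hyps
    by (simp add: p_def poly_sum poly_monom b_def mult.assoc mult.commute[of "s ^ _"])
  moreover have "s \<notin> algebraic_closure_in ?L"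
    using insert.prems(1)[of s] insert.hyps by (simp add: insert_Diff_if)
  ultimately have "p = 0" unfolding algebraic_closure_in_def poly_over_def by blast
  let ?M = "{m' \<in> M. e m' s = e m s}"
  have "0 = coeff p (e m s)" using \<open>p = 0\<close> by simp
  also have "\<dots> = (\<Sum>m'\<in>?M. a m' * (\<Prod>x\<in>S. x ^ e m' x))"
    unfolding p_def coeff_sum coeff_monom b_def by (rule sum.inter_filter[symmetric]) (rule insert.prems(2))
  finally have eq: "(\<Sum>m'\<in>?M. a m' * (\<Prod>x\<in>S. x ^ e m' x)) = 0" ..
  show ?case
  proof (rule insert.IH[of ?M])
    show "s' \<notin> algebraic_closure_in (generated_subfield (K \<union> (S - {s'})))" if "s' \<in> S" for s'
    proof -
      have "generated_subfield (K \<union> (S - {s'})) \<subseteq> generated_subfield (K \<union> (insert s S - {s'}))"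
        by (rule generated_subfield_mono) blast
      then show ?thesis using insert.prems(1)[of s'] that algebraic_closure_in_mono by blast
    qed
  qed (use insert.prems eq in auto)
qed

section \<open>Evaluation of multivariate polynomials and the exchange form of algebraic
  independence\<close>

definition mon_eval :: "('x \<Rightarrow> 'a) \<Rightarrow> ('x \<Rightarrow>\<^sub>0 nat) \<Rightarrow> 'a::comm_semiring_1" where
  "mon_eval \<phi> m = (\<Prod>x\<in>Poly_Mapping.keys m. \<phi> x ^ Poly_Mapping.lookup m x)"

text \<open>A general assignment \<open>\<phi>\<close> is allowed, so that one variable can later be
  moved while the others stay at their own values.\<close>

definition mpoly_eval :: "('x \<Rightarrow> 'a) \<Rightarrow> (('x \<Rightarrow>\<^sub>0 nat) \<Rightarrow>\<^sub>0 'a) \<Rightarrow> 'a::comm_semiring_1" where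
  "mpoly_eval \<phi> p = (\<Sum>m\<in>Poly_Mapping.keys p. Poly_Mapping.lookup p m * mon_eval \<phi> m)"

lemma self_eval_eq: "self_eval p = mpoly_eval (\<lambda>x. x) p"
  by (simp add: self_eval_def mpoly_eval_def mon_eval_def)

lemma mon_eval_superset:
  assumes "finite A" "Poly_Mapping.keys m \<subseteq> A"
  shows "mon_eval \<phi> m = (\<Prod>x\<in>A. \<phi> x ^ Poly_Mapping.lookup m x)"
  unfolding mon_eval_def by (rule prod.mono_neutral_left) (use assms in \<open>auto simp: in_keys_iff\<close>)

lemma mpoly_eval_superset:
  assumes "finite A" "Poly_Mapping.keys p \<subseteq> A"
  shows "mpoly_eval \<phi> p = (\<Sum>m\<in>A. Poly_Mapping.lookup p m * mon_eval \<phi> m)"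
  unfolding mpoly_eval_def by (rule sum.mono_neutral_left) (use assms in \<open>auto simp: in_keys_iff\<close>)

lemma mon_eval_add: "mon_eval \<phi> (m + n) = mon_eval \<phi> m * mon_eval \<phi> n"
proof -
  let ?A = "Poly_Mapping.keys m \<union> Poly_Mapping.keys n"
  have "mon_eval \<phi> (m + n) = (\<Prod>x\<in>?A. \<phi> x ^ Poly_Mapping.lookup (m + n) x)"
    by (rule mon_eval_superset) (simp_all add: Poly_Mapping.keys_add)
  also have "\<dots> = (\<Prod>x\<in>?A. \<phi> x ^ Poly_Mapping.lookup m x) * (\<Prod>x\<in>?A. \<phi> x ^ Poly_Mapping.lookup n x)"
    by (simp add: lookup_add power_add prod.distrib)
  also have "\<dots> = mon_eval \<phi> m * mon_eval \<phi> n"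
    by (subst (1 2) mon_eval_superset[of ?A]) simp_all
  finally show ?thesis .
qed

lemma mon_eval_single: "mon_eval \<phi> (Poly_Mapping.single x n) = \<phi> x ^ n"
  by (simp add: mon_eval_def)

lemma mon_eval_0: "mon_eval \<phi> 0 = 1"
  by (simp add: mon_eval_def)

lemma mpoly_eval_0: "mpoly_eval \<phi> 0 = 0"
  by (simp add: mpoly_eval_def)

lemma mpoly_eval_single: "mpoly_eval \<phi> (Poly_Mapping.single m c) = c * mon_eval \<phi> m"
  by (simp add: mpoly_eval_def)

lemma mpoly_eval_add: "mpoly_eval \<phi> (p + q) = mpoly_eval \<phi> p + mpoly_eval \<phi> q"
proof -
  let ?A = "Poly_Mapping.keys p \<union> Poly_Mapping.keys q"
  have "mpoly_eval \<phi> (p + q) = (\<Sum>m\<in>?A. Poly_Mapping.lookup (p + q) m * mon_eval \<phi> m)"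
    by (rule mpoly_eval_superset) (simp_all add: Poly_Mapping.keys_add)
  also have "\<dots> = (\<Sum>m\<in>?A. Poly_Mapping.lookup p m * mon_eval \<phi> m) + (\<Sum>m\<in>?A. Poly_Mapping.lookup q m * mon_eval \<phi> m)"
    by (simp add: lookup_add distrib_right sum.distrib)
  also have "\<dots> = mpoly_eval \<phi> p + mpoly_eval \<phi> q"
    by (subst (1 2) mpoly_eval_superset[of ?A]) simp_all
  finally show ?thesis .
qed

lemma mpoly_eval_sum: "mpoly_eval \<phi> (sum f A) = (\<Sum>i\<in>A. mpoly_eval \<phi> (f i))"
  by (induction A rule: infinite_finite_induct) (simp_all add: mpoly_eval_0 mpoly_eval_add)

lemma poly_mapping_sum_single:
  "p = (\<Sum>m\<in>Poly_Mapping.keys p. Poly_Mapping.single m (Poly_Mapping.lookup p m))"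
  by (rule poly_mapping_eqI) (simp add: lookup_sum lookup_single when_def in_keys_iff)

lemma poly_mapping_mult_single:
  fixes p q :: "('x \<Rightarrow>\<^sub>0 nat) \<Rightarrow>\<^sub>0 'a::comm_semiring_1"
  shows "p * q = (\<Sum>m\<in>Poly_Mapping.keys p. \<Sum>n\<in>Poly_Mapping.keys q.
    Poly_Mapping.single (m + n) (Poly_Mapping.lookup p m * Poly_Mapping.lookup q n))"
  by (subst (1) poly_mapping_sum_single[of p], subst (1) poly_mapping_sum_single[of q])
    (simp add: sum_product mult_single)

lemma mpoly_eval_mult: "mpoly_eval \<phi> (p * q) = mpoly_eval \<phi> p * mpoly_eval \<phi> q"
  unfolding poly_mapping_mult_single[of p q] mpoly_eval_sum mpoly_eval_single mon_eval_add
  by (simp add: mpoly_eval_def sum_product mult_ac)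

definition mpoly_over :: "'a::comm_semiring_1 set \<Rightarrow> 'x set \<Rightarrow> (('x \<Rightarrow>\<^sub>0 nat) \<Rightarrow>\<^sub>0 'a) set" where
  "mpoly_over K T = {p. (\<forall>m. Poly_Mapping.lookup p m \<in> K) \<and> (\<forall>m\<in>Poly_Mapping.keys p. Poly_Mapping.keys m \<subseteq> T)}"

context
  fixes K :: "'a::field set"
  assumes K: "is_subfield K"
begin

lemma mpoly_over_0: "0 \<in> mpoly_over K T"
  by (simp add: mpoly_over_def subfield_0[OF K])

lemma mpoly_over_single: "c \<in> K \<Longrightarrow> Poly_Mapping.keys m \<subseteq> T \<Longrightarrow> Poly_Mapping.single m c \<in> mpoly_over K T"
  by (auto simp: mpoly_over_def lookup_single when_def subfield_0[OF K])

lemma mpoly_over_add: "p \<in> mpoly_over K T \<Longrightarrow> q \<in> mpoly_over K T \<Longrightarrow> p + q \<in> mpoly_over K T"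
  using Poly_Mapping.keys_add[of p q] unfolding mpoly_over_def by (simp add: lookup_add subfield_add[OF K]) blast

lemma mpoly_over_sum: "(\<And>i. i \<in> A \<Longrightarrow> f i \<in> mpoly_over K T) \<Longrightarrow> sum f A \<in> mpoly_over K T"
  by (induction A rule: infinite_finite_induct) (simp_all add: mpoly_over_0 mpoly_over_add)

lemma mpoly_over_mult:
  assumes "p \<in> mpoly_over K T" "q \<in> mpoly_over K T"
  shows "p * q \<in> mpoly_over K T"
  unfolding poly_mapping_mult_single[of p q]
proof (intro mpoly_over_sum mpoly_over_single)
  fix m n assume mn: "m \<in> Poly_Mapping.keys p" "n \<in> Poly_Mapping.keys q"
  show "Poly_Mapping.lookup p m * Poly_Mapping.lookup q n \<in> K"
    using assms by (simp add: mpoly_over_def subfield_mult[OF K])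
  show "Poly_Mapping.keys (m + n) \<subseteq> T"
    using Poly_Mapping.keys_add[of m n] assms mn by (fastforce simp: mpoly_over_def)
qed

lemma mpoly_over_prod:
  "finite A \<Longrightarrow> (\<And>i. i \<in> A \<Longrightarrow> \<exists>p\<in>mpoly_over K T. mpoly_eval \<phi> p = v i) \<Longrightarrow>
    \<exists>p\<in>mpoly_over K T. mpoly_eval \<phi> p = (\<Prod>i\<in>A. v i)"
proof (induction A rule: finite_induct)
  case empty
  show ?case
    using mpoly_over_single[OF subfield_1[OF K], of 0 T] mpoly_eval_single[of \<phi> 0 1]
    by (intro bexI[of _ "Poly_Mapping.single 0 1"]) (simp_all add: mon_eval_0)
next
  case (insert i A)
  obtain p where "p \<in> mpoly_over K T" "mpoly_eval \<phi> p = v i" using insert.prems by blast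
  moreover obtain q where "q \<in> mpoly_over K T" "mpoly_eval \<phi> q = (\<Prod>i\<in>A. v i)"
    using insert.IH insert.prems by blast
  ultimately show ?case using insert.hyps by (intro bexI[of _ "p * q"]) (simp_all add: mpoly_eval_mult mpoly_over_mult)
qed

text \<open>The fractions of polynomial values form a subfield containing \<open>K\<close> and
  \<open>T\<close>.\<close>

lemma generated_subfield_fraction:
  assumes "x \<in> generated_subfield (K \<union> T)"
  shows "\<exists>p\<in>mpoly_over K T. \<exists>q\<in>mpoly_over K T. mpoly_eval (\<lambda>x. x) q \<noteq> 0 \<and>
    x = mpoly_eval (\<lambda>x. x) p / mpoly_eval (\<lambda>x. x) q"
proof -
  let ?ev = "mpoly_eval (\<lambda>x. x :: 'a)" and ?R = "mpoly_over K T"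
  let ?Q = "{x. \<exists>p\<in>?R. \<exists>q\<in>?R. ?ev q \<noteq> 0 \<and> x = ?ev p / ?ev q}"
  have QI: "?ev p / ?ev q \<in> ?Q" if "p \<in> ?R" "q \<in> ?R" "?ev q \<noteq> 0" for p q using that by blast
  have const: "Poly_Mapping.single 0 c \<in> ?R" "?ev (Poly_Mapping.single 0 c) = c" if "c \<in> K" for c
    using that by (simp_all add: mpoly_over_single mpoly_eval_single mon_eval_0)
  note one = const[OF subfield_1[OF K]]
  have polyQ: "?ev p \<in> ?Q" if "p \<in> ?R" for p
    using QI[OF that one(1)] unfolding one(2) by simp
  have constQ: "c \<in> ?Q" if "c \<in> K" for c
    using polyQ[OF const(1)[OF that]] by (simp only: const(2)[OF that])
  have "is_subfield ?Q"
    unfolding is_subfield_def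
  proof (intro conjI ballI)
    show "0 \<in> ?Q" "1 \<in> ?Q" by (rule constQ[OF subfield_0[OF K]], rule constQ[OF subfield_1[OF K]])
  next
    fix x y assume "x \<in> ?Q" "y \<in> ?Q"
    then obtain p q p' q' where *: "p \<in> ?R" "q \<in> ?R" "?ev q \<noteq> 0" "x = ?ev p / ?ev q"
      "p' \<in> ?R" "q' \<in> ?R" "?ev q' \<noteq> 0" "y = ?ev p' / ?ev q'" by blast
    have eq: "x + y = ?ev (p * q' + p' * q) / ?ev (q * q')" "x * y = ?ev (p * p') / ?ev (q * q')"
      and nz: "?ev (q * q') \<noteq> 0"
      using * by (simp_all add: mpoly_eval_add mpoly_eval_mult add_frac_eq)
    show "x + y \<in> ?Q"
      unfolding eq by (intro QI nz mpoly_over_add mpoly_over_mult *(1,2,5,6))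
    show "x * y \<in> ?Q"
      unfolding eq by (intro QI nz mpoly_over_mult *(1,2,5,6))
  next
    fix x assume "x \<in> ?Q"
    then obtain p q where *: "p \<in> ?R" "q \<in> ?R" "?ev q \<noteq> 0" "x = ?ev p / ?ev q" by blast
    have m1: "- 1 \<in> K" using subfield_uminus[OF K subfield_1[OF K]] .
    have "- x = ?ev (Poly_Mapping.single 0 (- 1) * p) / ?ev q"
      unfolding mpoly_eval_mult const(2)[OF m1] using *(4) by simp
    then show "- x \<in> ?Q" using QI[OF mpoly_over_mult[OF const(1)[OF m1] *(1)] *(2,3)] by (simp only:)
    show "inverse x \<in> ?Q"
    proof (cases "?ev p = 0")
      case True
      then have "inverse x = 0" using *(4) by simp
      then show ?thesis using constQ[OF subfield_0[OF K]] by (simp only:)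
    next
      case False
      have "inverse x = ?ev q / ?ev p" using *(4) by simp
      then show ?thesis using QI[OF *(2,1) False] by (simp only:)
    qed
  qed
  moreover have "K \<union> T \<subseteq> ?Q"
  proof
    fix x assume "x \<in> K \<union> T"
    then show "x \<in> ?Q"
    proof
      assume "x \<in> K"
      then show ?thesis by (rule constQ)
    next
      assume "x \<in> T"
      then have "Poly_Mapping.single (Poly_Mapping.single x 1) 1 \<in> ?R"
        by (simp add: mpoly_over_single subfield_1[OF K])
      from polyQ[OF this] show ?thesis by (simp only: mpoly_eval_single mon_eval_single mult_1_left power_one_right)
    qed
  qed
  ultimately have "generated_subfield (K \<union> T) \<subseteq> ?Q" by (rule generated_subfield_least)
  then show ?thesis using assms by blast
qed

end

lemma mpoly_eval_cong:
  assumes "p \<in> mpoly_over K T" "\<And>x. x \<in> T \<Longrightarrow> \<phi> x = \<psi> x"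
  shows "mpoly_eval \<phi> p = mpoly_eval \<psi> p"
proof -
  have "mon_eval \<phi> m = mon_eval \<psi> m" if "m \<in> Poly_Mapping.keys p" for m
  proof -
    have "Poly_Mapping.keys m \<subseteq> T" using assms(1) that by (simp add: mpoly_over_def)
    then show ?thesis unfolding mon_eval_def using assms(2) by (intro prod.cong refl) (simp add: subset_iff)
  qed
  then show ?thesis unfolding mpoly_eval_def by simp
qed

text \<open>For one direction, an algebraic equation for \<open>s\<close> over the others becomes a
  polynomial relation after clearing denominators; the other direction is
  \<open>monomials_independent\<close>.\<close>

theorem alg_independent_iff:
  fixes K :: "'a::field_char_0 set"
  assumes K: "is_subfield K" and S: "finite S"
  shows "alg_independent K S \<longleftrightarrow> (\<forall>s\<in>S. s \<notin> algebraic_closure_in (generated_subfield (K \<union> (S - {s}))))"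
proof
  assume indep: "alg_independent K S"
  show "\<forall>s\<in>S. s \<notin> algebraic_closure_in (generated_subfield (K \<union> (S - {s})))"
  proof (intro ballI notI)
    fix s assume s: "s \<in> S" and "s \<in> algebraic_closure_in (generated_subfield (K \<union> (S - {s})))"
    then obtain f where f: "f \<noteq> 0" "\<And>i. coeff f i \<in> generated_subfield (K \<union> (S - {s}))" "poly f s = 0"
      by (auto simp: algebraic_closure_in_def)
    let ?R = "mpoly_over K (S - {s})" and ?ev = "mpoly_eval (\<lambda>x. x :: 'a)"
    have "\<forall>i. \<exists>pq. fst pq \<in> ?R \<and> snd pq \<in> ?R \<and> ?ev (snd pq) \<noteq> 0 \<and> coeff f i = ?ev (fst pq) / ?ev (snd pq)"
    proof
      fix i
      obtain u v where "u \<in> ?R" "v \<in> ?R" "?ev v \<noteq> 0" "coeff f i = ?ev u / ?ev v"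
        using generated_subfield_fraction[OF K f(2)[of i]] by blast
      then show "\<exists>pq. fst pq \<in> ?R \<and> snd pq \<in> ?R \<and> ?ev (snd pq) \<noteq> 0 \<and> coeff f i = ?ev (fst pq) / ?ev (snd pq)"
        by (intro exI[of _ "(u, v)"]) simp
    qed
    from choice[OF this] obtain pq where pq: "\<forall>i. fst (pq i) \<in> ?R \<and> snd (pq i) \<in> ?R \<and> ?ev (snd (pq i)) \<noteq> 0 \<and>
      coeff f i = ?ev (fst (pq i)) / ?ev (snd (pq i))" ..
    \<comment> \<open>A common denominator of the coefficients of \<open>f\<close>.\<close>
    define d where "d = (\<Prod>i\<le>degree f. ?ev (snd (pq i)))"
    have d: "d \<noteq> 0" using pq by (simp add: d_def)
    have "\<exists>P\<in>?R. ?ev P = d * coeff f i" if i: "i \<le> degree f" for i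
    proof -
      obtain Q where Q: "Q \<in> ?R" "?ev Q = (\<Prod>j\<in>{..degree f} - {i}. ?ev (snd (pq j)))"
        using mpoly_over_prod[OF K, of "{..degree f} - {i}" "S - {s}" "\<lambda>x. x" "\<lambda>j. ?ev (snd (pq j))"] pq by blast
      have "d = ?ev (snd (pq i)) * ?ev Q" unfolding d_def Q(2) using i by (intro prod.remove) auto
      then have "d * coeff f i = ?ev (fst (pq i) * Q)" using pq by (simp add: mpoly_eval_mult)
      moreover have "fst (pq i) * Q \<in> ?R" using mpoly_over_mult[OF K _ Q(1)] pq by blast
      ultimately show ?thesis by (intro bexI[of _ "fst (pq i) * Q"]) simp_all
    qed
    then have "\<forall>i. \<exists>P. i \<le> degree f \<longrightarrow> P \<in> ?R \<and> ?ev P = d * coeff f i" by blast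
    from choice[OF this] obtain P where P': "\<forall>i. i \<le> degree f \<longrightarrow> P i \<in> ?R \<and> ?ev (P i) = d * coeff f i" ..
    then have P: "P i \<in> ?R \<and> ?ev (P i) = d * coeff f i" if "i \<le> degree f" for i using that by blast
    define p where "p = (\<Sum>i\<le>degree f. P i * Poly_Mapping.single (Poly_Mapping.single s i) 1)"
    have "?R \<subseteq> mpoly_over K S" by (auto simp: mpoly_over_def)
    then have "p \<in> mpoly_over K S"
      unfolding p_def using P s subfield_1[OF K]
      by (intro mpoly_over_sum[OF K] mpoly_over_mult[OF K] mpoly_over_single[OF K]) auto
    \<comment> \<open>Moving only the variable \<open>s\<close> recovers \<open>f\<close> from
      \<open>p\<close>. So \<open>p = 0\<close> would make \<open>f\<close> vanish everywhere, which
      is impossible for a nonzero polynomial over an infinite field.\<close>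
    have ev_p: "mpoly_eval (\<lambda>y. if y = s then x else y) p = d * poly f x" for x
    proof -
      have "mpoly_eval (\<lambda>y. if y = s then x else y) (P i) = d * coeff f i" if "i \<le> degree f" for i
        using P[OF that] mpoly_eval_cong[of "P i" K "S - {s}" "\<lambda>y. if y = s then x else y" "\<lambda>x. x"] by simp
      then show ?thesis
        by (simp add: p_def mpoly_eval_sum mpoly_eval_mult mpoly_eval_single mon_eval_single poly_altdef
          sum_distrib_left mult.assoc)
    qed
    have "(\<lambda>y. if y = s then s else y) = (\<lambda>y. y)" by auto
    then have "self_eval p = mpoly_eval (\<lambda>y. if y = s then s else y) p" by (simp only: self_eval_eq)
    then have "self_eval p = 0" using ev_p[of s] f(3) by simp
    moreover have "(\<forall>m. Poly_Mapping.lookup p m \<in> K)" "(\<forall>m\<in>Poly_Mapping.keys p. Poly_Mapping.keys m \<subseteq> S)"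
      using \<open>p \<in> mpoly_over K S\<close> by (simp_all add: mpoly_over_def)
    ultimately have "p = 0" using indep[unfolded alg_independent_def, rule_format] by simp
    then have "poly f x = 0" for x using ev_p[of x] d by (simp add: mpoly_eval_0)
    then show False using f(1) poly_all_0_iff_0 by blast
  qed
next
  assume indep: "\<forall>s\<in>S. s \<notin> algebraic_closure_in (generated_subfield (K \<union> (S - {s})))"
  show "alg_independent K S"
    unfolding alg_independent_def
  proof (intro allI impI)
    fix p :: "('a \<Rightarrow>\<^sub>0 nat) \<Rightarrow>\<^sub>0 'a"
    assume pK: "\<forall>m. Poly_Mapping.lookup p m \<in> K" and keys: "\<forall>m\<in>Poly_Mapping.keys p. Poly_Mapping.keys m \<subseteq> S"
      and zero: "self_eval p = 0"
    have "Poly_Mapping.lookup p m = 0" if "m \<in> Poly_Mapping.keys p" for m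
    proof (rule monomials_independent[OF K S, of "Poly_Mapping.keys p" _ Poly_Mapping.lookup])
      show "s \<notin> algebraic_closure_in (generated_subfield (K \<union> (S - {s})))" if "s \<in> S" for s
        using indep that by blast
      show "m = m'" if "m \<in> Poly_Mapping.keys p" "m' \<in> Poly_Mapping.keys p"
        "\<forall>x\<in>S. Poly_Mapping.lookup m x = Poly_Mapping.lookup m' x" for m m'
      proof (rule poly_mapping_eqI)
        fix x
        show "Poly_Mapping.lookup m x = Poly_Mapping.lookup m' x"
        proof (cases "x \<in> S")
          case False
          then have "x \<notin> Poly_Mapping.keys m" "x \<notin> Poly_Mapping.keys m'" using keys that(1,2) by blast+
          then show ?thesis by (simp add: in_keys_iff)
        qed (use that(3) in blast)
      qed
      have "self_eval p = (\<Sum>m\<in>Poly_Mapping.keys p. Poly_Mapping.lookup p m * (\<Prod>x\<in>S. x ^ Poly_Mapping.lookup m x))"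
        unfolding self_eval_eq mpoly_eval_def using keys S by (intro sum.cong refl) (simp add: mon_eval_superset[OF S])
      then show "(\<Sum>m\<in>Poly_Mapping.keys p. Poly_Mapping.lookup p m * (\<Prod>x\<in>S. x ^ Poly_Mapping.lookup m x)) = 0"
        using zero by simp
    qed (use pK that in auto)
    then have "Poly_Mapping.lookup p m = 0" for m by (cases "m \<in> Poly_Mapping.keys p") (simp_all add: in_keys_iff)
    then show "p = 0" by (intro poly_mapping_eqI) simp
  qed
qed

section \<open>Ax's theorem on exponential derivations\<close>

definition exp_form :: "(complex \<Rightarrow> complex) \<Rightarrow> complex \<Rightarrow> complex" where
  "exp_form D z = D (exp z) / exp z - D z"

lemma additive_of_rat:
  fixes f :: "'a::field_char_0 \<Rightarrow> 'b::field_char_0"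
  assumes add: "\<And>x y. f (x + y) = f x + f y"
  shows "f (of_rat q * x) = of_rat q * f x"
proof -
  have "f 0 + f 0 = f 0 + 0" using add[of 0 0] by simp
  then have f0: "f 0 = 0" by (rule add_left_imp_eq)
  have neg: "f (- y) = - f y" for y
  proof -
    have "f y + f (- y) = 0" using add[of y "- y"] f0 by simp
    then show ?thesis by (rule minus_unique[symmetric])
  qed
  have nat: "f (of_nat n * y) = of_nat n * f y" for n y
  proof (induction n)
    case (Suc n)
    have "f (of_nat (Suc n) * y) = f (of_nat n * y + y)" by (simp add: algebra_simps)
    also have "\<dots> = of_nat n * f y + f y" unfolding add Suc.IH ..
    finally show ?case by (simp add: algebra_simps)
  qed (simp add: f0)
  have int: "f (of_int k * y) = of_int k * f y" for k y
  proof (cases k rule: int_cases2)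
    case (nonneg n)
    then show ?thesis using nat[of n y] by simp
  next
    case (nonpos n)
    then show ?thesis using nat[of n y] neg[of "of_nat n * y"] by simp
  qed
  obtain a b where q: "q = of_int a / of_int b" "b > 0"
    using quotient_of_denom_pos quotient_of_div by (metis surj_pair)
  have b: "of_int b \<noteq> (0 :: 'b)" "of_int b \<noteq> (0 :: 'a)" using q(2) by simp_all
  have "of_int b * f (of_rat q * x) = f (of_int b * (of_rat q * x))" by (rule int[symmetric])
  also have "of_int b * (of_rat q * x) = of_int a * x" using b by (simp add: q of_rat_divide)
  also have "f \<dots> = of_int a * f x" by (rule int)
  finally show ?thesis using b by (simp add: q of_rat_divide field_simps)
qed

context
  fixes D :: "complex \<Rightarrow> complex"
  assumes D: "derivation_on UNIV D"
begin

lemma exp_form_add: "exp_form D (x + y) = exp_form D x + exp_form D y"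
  by (simp add: exp_form_def exp_add derivation_mult[OF subfield_UNIV D] derivation_add[OF subfield_UNIV D]
    add_divide_distrib)

lemma exp_form_of_rat: "exp_form D (of_rat q * x) = of_rat q * exp_form D x"
  by (rule additive_of_rat) (rule exp_form_add)

lemma exp_form_eq_0_iff: "exp_form D z = 0 \<longleftrightarrow> D (exp z) = exp z * D z"
  by (simp add: exp_form_def field_simps)

end

lemma subfield_of_rat:
  fixes K :: "'a::field_char_0 set"
  assumes K: "is_subfield K"
  shows "of_rat q \<in> K"
proof -
  have int: "of_int k \<in> K" for k
    using subfield_of_nat[OF K] subfield_uminus[OF K subfield_of_nat[OF K]] by (cases k) (simp_all del: of_nat_Suc)
  show ?thesis by (cases q) (simp add: of_rat_rat subfield_divide[OF K] int)
qed

lemma derivation_bracket: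
  assumes D: "derivation_on UNIV D" and D': "derivation_on UNIV D'"
  shows "derivation_on UNIV (\<lambda>x. D (D' x) - D' (D x))"
  unfolding derivation_on_def
  by (auto simp: derivation_add[OF subfield_UNIV D] derivation_add[OF subfield_UNIV D']
    derivation_mult[OF subfield_UNIV D] derivation_mult[OF subfield_UNIV D'] algebra_simps)

text \<open>This expresses that the differential form \<open>d exp(z) / exp(z) - dz\<close> is closed.\<close>

lemma exp_form_bracket:
  assumes D: "derivation_on UNIV D" and D': "derivation_on UNIV D'"
  shows "exp_form (\<lambda>x. D (D' x) - D' (D x)) z = D (exp_form D' z) - D' (exp_form D z)"
proof -
  note U = subfield_UNIV
  have "D (exp_form D' z) = (D (D' (exp z)) * exp z - D' (exp z) * D (exp z)) / (exp z * exp z) - D (D' z)"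
    unfolding exp_form_def by (simp add: derivation_diff[OF U D] derivation_divide[OF U D])
  moreover have "D' (exp_form D z) = (D' (D (exp z)) * exp z - D (exp z) * D' (exp z)) / (exp z * exp z) - D' (D z)"
    unfolding exp_form_def by (simp add: derivation_diff[OF U D'] derivation_divide[OF U D'])
  moreover have "(a * e - p * q) / (e * e) - x - ((b * e - q * p) / (e * e) - y) = (a - b) / e - (x - y)"
    if "e \<noteq> 0" for a b e p q x y :: complex
    using that by (simp add: field_simps)
  ultimately show ?thesis by (simp only: exp_form_def exp_not_eq_zero not_False_eq_True)
qed

text \<open>In a shortest relation, brackets with \<open>\<Delta>\<close> show that the coefficients are constants of \<open>\<Delta>\<close>, and a
  rational dependency among the coefficients would give a shorter one; so \<open>log_relation_trivial\<close> applies.\<close>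

theorem ax_independence:
  fixes \<Delta> :: "(complex \<Rightarrow> complex) set" and w c :: "'i \<Rightarrow> complex"
  defines "K \<equiv> constants \<Delta>"
  assumes \<Delta>: "\<Delta> \<subseteq> Der {}" and "finite I"
    and "\<And>i D. i \<in> I \<Longrightarrow> D \<in> \<Delta> \<Longrightarrow> exp_form D (w i) = 0"
    and "\<And>q :: 'i \<Rightarrow> rat. (\<Sum>i\<in>I. of_rat (q i) * w i) \<in> K \<Longrightarrow> \<forall>i\<in>I. q i = 0"
    and "\<And>D. D \<in> Der K \<Longrightarrow> (\<Sum>i\<in>I. c i * exp_form D (w i)) = 0"
  shows "\<forall>i\<in>I. c i = 0"
  using assms(3-)
proof (induction "card I" arbitrary: I w c rule: less_induct)
  case less
  note finI = less.prems(1) and wD = less.prems(2) and indep = less.prems(3) and rel = less.prems(4)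
  have K: "is_subfield K" unfolding K_def by (rule subfield_constants[OF \<Delta>])
  have acl: "algebraic_closure_in K \<subseteq> K" unfolding K_def by (rule constants_algebraically_closed[OF \<Delta>])
  have DK: "D \<in> Der K" if "D \<in> \<Delta>" for D
    using that \<Delta> by (auto simp: K_def Der_def constants_def)
  have KI: "x \<in> K" if "\<And>D. D \<in> \<Delta> \<Longrightarrow> D x = 0" for x using that by (simp add: K_def constants_def)
  have shorter: "card (I - {i}) < card I" "finite (I - {i})" if "i \<in> I" for i
    using card_Diff1_less[OF finI that] finI by simp_all
  have indep_remove: "\<forall>j\<in>I - {i}. q j = 0" if i: "i \<in> I" and q: "(\<Sum>j\<in>I - {i}. of_rat (q j) * w j) \<in> K" for i and q :: "'i \<Rightarrow> rat"
  proof -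
    have "(\<Sum>j\<in>I. of_rat ((q(i := 0)) j) * w j) = (\<Sum>j\<in>I - {i}. of_rat (q j) * w j)"
      using i finI by (auto simp: sum.remove[of I i] intro!: sum.cong)
    then have *: "\<forall>j\<in>I. (q(i := 0)) j = 0" using indep[of "q(i := 0)"] q by (simp del: fun_upd_apply)
    show ?thesis
    proof
      fix j assume "j \<in> I - {i}"
      then show "q j = 0" using bspec[OF *, of j] by simp
    qed
  qed
  show ?case
  proof (rule ccontr)
    assume "\<not> (\<forall>i\<in>I. c i = 0)"
    then obtain i0 where i0: "i0 \<in> I" "c i0 \<noteq> 0" by blast
    \<comment> \<open>A zero coefficient would leave a shorter relation, to which the induction
      hypothesis applies.\<close>
    have nz: "c i \<noteq> 0" if i: "i \<in> I" for i
    proof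
      assume ci: "c i = 0"
      have "\<forall>j\<in>I - {i}. c j = 0"
      proof (rule less.hyps[OF shorter[OF i]])
        show "exp_form D (w j) = 0" if "j \<in> I - {i}" "D \<in> \<Delta>" for j D using wD that by blast
        show "\<forall>j\<in>I - {i}. q j = 0" if "(\<Sum>j\<in>I - {i}. of_rat (q j) * w j) \<in> K" for q :: "'i \<Rightarrow> rat"
          by (rule indep_remove[OF i that])
        show "(\<Sum>j\<in>I - {i}. c j * exp_form D (w j)) = 0" if "D \<in> Der K" for D
          using rel[OF that] ci i finI by (simp add: sum.remove[of I i])
      qed
      then show False using i0 ci by (cases "i0 = i") auto
    qed
    \<comment> \<open>Normalizing one coefficient to 1 makes its derivative vanish, so
      differentiating the relation shortens it.\<close>
    define b where "b i = c i / c i0" for i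
    have b0: "b i0 = 1" and bnz: "\<And>i. i \<in> I \<Longrightarrow> b i \<noteq> 0" using i0 nz by (simp_all add: b_def)
    have brel: "(\<Sum>i\<in>I. b i * exp_form D (w i)) = 0" if "D \<in> Der K" for D
    proof -
      have "(\<Sum>i\<in>I. b i * exp_form D (w i)) = (\<Sum>i\<in>I. c i * exp_form D (w i)) / c i0"
        by (simp add: b_def sum_divide_distrib)
      then show ?thesis using rel[OF that] by simp
    qed
    have bK: "b i \<in> K" if i: "i \<in> I" for i
    proof (rule KI)
      fix D0 assume D0: "D0 \<in> \<Delta>"
      have D0d: "derivation_on UNIV D0" using DK[OF D0] by (rule Der_derivation)
      have "\<forall>j\<in>I - {i0}. D0 (b j) = 0"
      proof (rule less.hyps[OF shorter[OF i0(1)]])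
        show "exp_form D (w j) = 0" if "j \<in> I - {i0}" "D \<in> \<Delta>" for j D using wD that by blast
        show "\<forall>j\<in>I - {i0}. q j = 0" if "(\<Sum>j\<in>I - {i0}. of_rat (q j) * w j) \<in> K" for q :: "'i \<Rightarrow> rat"
          by (rule indep_remove[OF i0(1) that])
        show "(\<Sum>j\<in>I - {i0}. D0 (b j) * exp_form D (w j)) = 0" if D: "D \<in> Der K" for D
        proof -
          have Dd: "derivation_on UNIV D" using D by (rule Der_derivation)
          define B where "B = (\<lambda>x. D0 (D x) - D (D0 x))"
          have "derivation_on UNIV B" unfolding B_def by (rule derivation_bracket[OF D0d Dd])
          moreover have "B x = 0" if "x \<in> K" for x
            using Der_zero[OF D that] Der_zero[OF DK[OF D0] that] derivation_0[OF subfield_UNIV D0d]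
              derivation_0[OF subfield_UNIV Dd] by (simp add: B_def)
          ultimately have "B \<in> Der K" by (simp add: Der_def)
          have Bw: "exp_form B (w j) = D0 (exp_form D (w j))" if "j \<in> I" for j
            unfolding B_def exp_form_bracket[OF D0d Dd] wD[OF that D0] derivation_0[OF subfield_UNIV Dd] by simp
          \<comment> \<open>The product rule splits this into the original relation at the bracket
            \<open>B\<close>, which is 0 because \<open>B\<close> is again in \<open>Der K\<close>,
            and a relation with coefficients \<open>D0 (b j)\<close>.\<close>
          have "0 = D0 (\<Sum>j\<in>I. b j * exp_form D (w j))"
            using brel[OF D] derivation_0[OF subfield_UNIV D0d] by simp
          also have "\<dots> = (\<Sum>j\<in>I. b j * exp_form B (w j) + exp_form D (w j) * D0 (b j))"
            by (simp add: derivation_sum[OF subfield_UNIV D0d] derivation_mult[OF subfield_UNIV D0d] Bw)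
          also have "\<dots> = (\<Sum>j\<in>I. D0 (b j) * exp_form D (w j))"
            using brel[OF \<open>B \<in> Der K\<close>] by (simp add: sum.distrib mult.commute)
          also have "\<dots> = (\<Sum>j\<in>I - {i0}. D0 (b j) * exp_form D (w j))"
            using i0 finI b0 derivation_1[OF subfield_UNIV D0d] by (simp add: sum.remove[of I i0])
          finally show ?thesis ..
        qed
      qed
      then show "D0 (b i) = 0" using i b0 derivation_1[OF subfield_UNIV D0d] by (cases "i = i0") auto
    qed
    have bindep: "\<forall>i\<in>I. q i = 0" if q: "(\<Sum>i\<in>I. of_int (q i) * b i) = 0" for q :: "'i \<Rightarrow> int"
    proof (rule ccontr)
      assume "\<not> (\<forall>i\<in>I. q i = 0)"
      then obtain i1 where i1: "i1 \<in> I" "q i1 \<noteq> 0" by blast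
      \<comment> \<open>A dependency of the coefficients is absorbed into the arguments: with
        \<open>w'\<close> in place of \<open>w\<close>, the same \<open>b\<close> gives a relation
        without the index \<open>i1\<close>.\<close>
      define p where "p i = (of_int (q i) / of_int (q i1) :: rat)" for i
      define w' where "w' i = w i - of_rat (p i) * w i1" for i
      have p: "(\<Sum>i\<in>I - {i1}. b i * of_rat (p i)) = - b i1"
      proof -
        have "(\<Sum>i\<in>I - {i1}. b i * of_rat (p i)) = (\<Sum>i\<in>I - {i1}. of_int (q i) * b i) / of_int (q i1)"
          by (simp add: p_def of_rat_divide sum_divide_distrib mult.commute)
        also have "(\<Sum>i\<in>I - {i1}. of_int (q i) * b i) = - (of_int (q i1) * b i1)"
          using q i1 finI by (simp add: sum.remove[of I i1] eq_neg_iff_add_eq_0 add.commute)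
        finally show ?thesis using i1 by simp
      qed
      have form_w': "exp_form D (w' i) = exp_form D (w i) - of_rat (p i) * exp_form D (w i1)" if "derivation_on UNIV D" for D i
        using exp_form_add[OF that, of "w i" "of_rat (- p i) * w i1"] exp_form_of_rat[OF that, of "- p i" "w i1"]
        by (simp add: w'_def of_rat_minus)
      have "\<forall>j\<in>I - {i1}. b j = 0"
      proof (rule less.hyps[OF shorter[OF i1(1)]])
        show "exp_form D (w' j) = 0" if "j \<in> I - {i1}" "D \<in> \<Delta>" for j D
          using wD i1 that form_w'[OF Der_derivation[OF DK]] by simp
        show "\<forall>j\<in>I - {i1}. r j = 0" if r: "(\<Sum>j\<in>I - {i1}. of_rat (r j) * w' j) \<in> K" for r :: "'i \<Rightarrow> rat"
        proof -
          define r' where "r' = r(i1 := - (\<Sum>j\<in>I - {i1}. r j * p j))"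
          have "(\<Sum>j\<in>I. of_rat (r' j) * w j) = of_rat (r' i1) * w i1 + (\<Sum>j\<in>I - {i1}. of_rat (r j) * w j)"
            using i1 finI by (auto simp: sum.remove[of I i1] r'_def intro!: sum.cong)
          also have "\<dots> = (\<Sum>j\<in>I - {i1}. of_rat (r j) * w' j)"
            by (simp add: r'_def w'_def of_rat_minus of_rat_sum of_rat_mult algebra_simps sum_subtractf sum_distrib_left)
          finally have *: "\<forall>j\<in>I. r' j = 0" using indep[of r'] r by simp
          show ?thesis
          proof
            fix j assume "j \<in> I - {i1}"
            then show "r j = 0" using bspec[OF *, of j] by (simp add: r'_def)
          qed
        qed
        show "(\<Sum>j\<in>I - {i1}. b j * exp_form D (w' j)) = 0" if D: "D \<in> Der K" for D
        proof -
          have "(\<Sum>j\<in>I - {i1}. b j * exp_form D (w' j))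
            = (\<Sum>j\<in>I - {i1}. b j * exp_form D (w j)) - (\<Sum>j\<in>I - {i1}. b j * of_rat (p j)) * exp_form D (w i1)"
            by (simp add: form_w'[OF Der_derivation[OF D]] algebra_simps sum_subtractf sum_distrib_left)
          also have "\<dots> = (\<Sum>j\<in>I. b j * exp_form D (w j))"
            using i1 finI by (simp add: p sum.remove[of I i1])
          finally show ?thesis using brel[OF D] by simp
        qed
      qed
      then have "I = {i1}" using bnz i1 by blast
      then show False using q i1 bnz by simp
    qed
    \<comment> \<open>With constant \<open>b i\<close>, the relation reads
      \<open>sum b dy/y = du\<close> for \<open>y i = exp (w i)\<close> and
      \<open>u = sum b w\<close>.\<close>
    have "exp (w i0) \<in> K"
    proof (rule log_relation_trivial[OF K acl finI bK bindep, where u = "\<Sum>i\<in>I. b i * w i" and y = "\<lambda>i. exp (w i)"])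
      show "(\<Sum>j\<in>I. b j * (D (exp (w j)) / exp (w j))) = D (\<Sum>i\<in>I. b i * w i)" if D: "D \<in> Der K" for D
      proof -
        have Dd: "derivation_on UNIV D" using D by (rule Der_derivation)
        have "D (\<Sum>i\<in>I. b i * w i) = (\<Sum>i\<in>I. b i * D (w i))"
          using Der_zero[OF D bK] by (simp add: derivation_sum[OF subfield_UNIV Dd] derivation_mult[OF subfield_UNIV Dd])
        moreover have "(\<Sum>j\<in>I. b j * (D (exp (w j)) / exp (w j))) - (\<Sum>i\<in>I. b i * D (w i)) = 0"
          using brel[OF D] by (simp add: exp_form_def right_diff_distrib sum_subtractf)
        ultimately show ?thesis by simp
      qed
    qed (use i0 in simp_all)
    \<comment> \<open>For \<open>D\<close> in \<open>\<Delta>\<close>,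
      \<open>D (exp (w i0)) = exp (w i0) * D (w i0)\<close>, and the left side is 0. Membership of
      \<open>w i0\<close> in \<open>K\<close> contradicts independence for the unit coefficient
      vector.\<close>
    then have "w i0 \<in> K"
      using wD[OF i0(1)] exp_form_eq_0_iff[OF Der_derivation[OF DK]] Der_zero[OF DK]
      by (intro KI) (metis exp_not_eq_zero mult_eq_0_iff)
    moreover have "(\<Sum>i\<in>I. of_rat (if i = i0 then 1 else 0) * w i) = w i0"
      using i0 finI by (auto simp: sum.remove[of I i0] intro!: sum.neutral)
    ultimately show False using indep[of "\<lambda>i. if i = i0 then 1 else 0"] i0 by auto
  qed
qed

section \<open>Dimension counts in vector spaces\<close>

context vector_space
begin

lemma independent_card_le_dim_finite:
  assumes "finite X" "independent B" "B \<subseteq> span X"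
  shows "finite B" "card B \<le> dim X"
proof -
  obtain B' where B': "B' \<subseteq> X" "independent B'" "X \<subseteq> span B'" "card B' = dim X"
    using basis_exists by blast
  then have "B \<subseteq> span B'" using assms(3) span_minimal[OF B'(3) subspace_span] by blast
  then show "finite B" "card B \<le> dim X"
    using independent_span_bound[OF finite_subset[OF B'(1) assms(1)] assms(2)] B'(4) by auto
qed

lemma dim_mono_finite:
  assumes "finite Y" "X \<subseteq> span Y"
  shows "dim X \<le> dim Y"
proof -
  obtain B where "B \<subseteq> X" "independent B" "X \<subseteq> span B" "card B = dim X"
    using basis_exists by blast
  then show ?thesis using independent_card_le_dim_finite(2)[OF assms(1), of B] assms(2) by auto
qed

text \<open>The cardinality equation records that \<open>f\<close> is injective on \<open>S\<close>
  and takes no value in \<open>B\<close>.\<close>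

lemma independent_family:
  assumes "finite S" "finite B" "independent B" "\<And>x. x \<in> S \<Longrightarrow> f x \<notin> span (B \<union> f ` (S - {x}))"
  shows "independent (B \<union> f ` S) \<and> card (B \<union> f ` S) = card B + card S"
  using assms(1,4)
proof (induction S rule: finite_induct)
  case empty
  then show ?case using assms(3) by simp
next
  case (insert x S)
  have IH: "independent (B \<union> f ` S) \<and> card (B \<union> f ` S) = card B + card S"
  proof (rule insert.IH)
    fix y assume y: "y \<in> S"
    have "span (B \<union> f ` (S - {y})) \<subseteq> span (B \<union> f ` (insert x S - {y}))" by (rule span_mono) blast
    then show "f y \<notin> span (B \<union> f ` (S - {y}))" using insert.prems[of y] y by blast
  qed
  have fx: "f x \<notin> span (B \<union> f ` S)" using insert.prems[of x] insert.hyps by simp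
  then have "f x \<notin> B \<union> f ` S" using span_base[of "f x" "B \<union> f ` S"] by blast
  moreover have "independent (insert (f x) (B \<union> f ` S))" using IH by (intro independent_insertI[OF fx]) simp
  ultimately show ?case using IH assms(2) insert.hyps by simp
qed

lemma select_independent_family:
  assumes "independent B"
  obtains S where "S \<subseteq> T" "f ` T \<subseteq> span (B \<union> f ` S)" "\<forall>x\<in>S. f x \<notin> span (B \<union> f ` (S - {x}))"
proof -
  obtain C where C: "B \<subseteq> C" "C \<subseteq> B \<union> f ` T" "independent C" "B \<union> f ` T \<subseteq> span C"
    using maximal_independent_subset_extend[of B "B \<union> f ` T"] assms by blast
  then have "C - B \<subseteq> f ` T" by blast
  then obtain S where S: "S \<subseteq> T" "inj_on f S" "C - B = f ` S" unfolding subset_image_inj by blast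
  have "C = B \<union> f ` S" using C(1) S(3) by blast
  moreover have "f x \<notin> span (B \<union> f ` (S - {x}))" if x: "x \<in> S" for x
  proof -
    have "f x \<in> C" "f x \<notin> B" using x S(3) by blast+
    moreover have "f x \<notin> f ` (S - {x})" using S(2) x by (auto simp: inj_on_def)
    ultimately have "B \<union> f ` (S - {x}) \<subseteq> C - {f x}" using C(1) S(3) by blast
    moreover have "f x \<notin> span (C - {f x})" using C(3) \<open>f x \<in> C\<close> by (auto simp: dependent_def)
    ultimately show ?thesis using span_mono[of "B \<union> f ` (S - {x})" "C - {f x}"] by blast
  qed
  ultimately show ?thesis using that[of S] S(1) C(4) by blast
qed

lemmas independent_family_empty = independent_family[OF _ finite.emptyI independent_empty, simplified]
lemmas select_independent_family_empty = select_independent_family[OF independent_empty, simplified]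

lemma span_image_coefficients:
  assumes "finite A" "v \<in> span (G \<union> f ` A)"
  shows "\<exists>c. v - (\<Sum>a\<in>A. scale (c a) (f a)) \<in> span G"
  using assms
proof (induction A arbitrary: v rule: finite_induct)
  case (insert a A)
  then have "v \<in> span (insert (f a) (G \<union> f ` A))" by simp
  then obtain k where "v - scale k (f a) \<in> span (G \<union> f ` A)" unfolding span_breakdown_eq by blast
  from insert.IH[OF this] obtain c where c: "v - scale k (f a) - (\<Sum>a\<in>A. scale (c a) (f a)) \<in> span G" by blast
  have "(\<Sum>b\<in>insert a A. scale ((c(a := k)) b) (f b)) = scale k (f a) + (\<Sum>b\<in>A. scale (c b) (f b))"
    using insert.hyps by (auto intro!: sum.cong)
  then have "v - (\<Sum>b\<in>insert a A. scale ((c(a := k)) b) (f b)) \<in> span G" using c by (simp add: diff_diff_eq)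
  then show ?case by blast
qed simp

end

section \<open>Differentials over the exponential algebraic closure\<close>

definition fun_scale :: "complex \<Rightarrow> ('b \<Rightarrow> complex) \<Rightarrow> 'b \<Rightarrow> complex" where
  "fun_scale c f = (\<lambda>x. c * f x)"

interpretation fs: vector_space "fun_scale :: complex \<Rightarrow> ('b \<Rightarrow> complex) \<Rightarrow> 'b \<Rightarrow> complex"
  by unfold_locales (auto simp: fun_scale_def fun_eq_iff algebra_simps)

interpretation rs: vector_space "\<lambda>(q::rat) (z::complex). of_rat q * z"
  by (rule vector_space_rat_complex)

interpretation fs_functional: vector_space_pair "fun_scale :: complex \<Rightarrow> ('b \<Rightarrow> complex) \<Rightarrow> 'b \<Rightarrow> complex" "(*) :: complex \<Rightarrow> complex \<Rightarrow> complex"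
  by unfold_locales (auto simp: algebra_simps)

definition exp_Der :: "(complex \<Rightarrow> complex) set" where
  "exp_Der = {D \<in> Der {}. \<forall>z. exp_form D z = 0}"

lemma exp_derivation_iff: "exp_derivation A D \<longleftrightarrow> D \<in> exp_Der \<and> (\<forall>a\<in>A. D a = 0)"
proof (cases "derivation_on UNIV D")
  case True
  then show ?thesis
    by (auto simp: exp_derivation_def exp_Der_def Der_def exp_form_eq_0_iff derivation_on_def)
qed (auto simp: exp_derivation_def exp_Der_def Der_def derivation_on_def)

abbreviation base :: "complex set" where "base \<equiv> ecl {}"

lemma base_eq: "base = constants exp_Der"
  by (auto simp: ecl_def constants_def exp_derivation_iff)

lemma subfield_base: "is_subfield base"
  unfolding base_eq by (rule subfield_constants) (auto simp: exp_Der_def)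

lemma exp_Der_subset: "exp_Der \<subseteq> Der base"
  by (auto simp: base_eq constants_def Der_def exp_Der_def)

lemma ecl_base_iff: "z \<in> ecl (base \<union> A) \<longleftrightarrow> (\<forall>D\<in>exp_Der. (\<forall>a\<in>A. D a = 0) \<longrightarrow> D z = 0)"
proof -
  have "exp_derivation (base \<union> A) D \<longleftrightarrow> D \<in> exp_Der \<and> (\<forall>a\<in>A. D a = 0)" for D
    using exp_Der_subset by (auto simp: exp_derivation_iff Der_def)
  then show ?thesis by (auto simp: ecl_def)
qed

text \<open>The Kaehler differentials of the complex field over \<open>ecl {}\<close> are modelled as functions on the space of derivations.\<close>

definition differential :: "complex \<Rightarrow> (complex \<Rightarrow> complex) \<Rightarrow> complex" where
  "differential z D = (if D \<in> Der base then D z else 0)"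

text \<open>As in \<open>differential\<close>, the value 0 off \<open>Der base\<close> lets linear
  identities hold as equations between functions.\<close>

definition log_form :: "complex \<Rightarrow> (complex \<Rightarrow> complex) \<Rightarrow> complex" where
  "log_form z D = (if D \<in> Der base then exp_form D z else 0)"

lemma differential_add: "differential (x + y) = differential x + differential y"
  by (auto simp: differential_def fun_eq_iff derivation_add[OF subfield_UNIV Der_derivation])

lemma differential_mult: "differential (x * y) = fun_scale x (differential y) + fun_scale y (differential x)"
  by (auto simp: differential_def fun_scale_def fun_eq_iff derivation_mult[OF subfield_UNIV Der_derivation])

lemma differential_base: "z \<in> base \<Longrightarrow> differential z = 0"
  by (auto simp: differential_def fun_eq_iff Der_def)

lemma log_form_eq: "log_form z = fun_scale (inverse (exp z)) (differential (exp z)) - differential z"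
  by (auto simp: differential_def log_form_def fun_scale_def fun_eq_iff exp_form_def divide_inverse)

lemma differential_exp: "differential (exp z) = fun_scale (exp z) (log_form z + differential z)"
  by (auto simp: differential_def log_form_def fun_scale_def fun_eq_iff exp_form_def)

lemma log_form_add: "log_form (x + y) = log_form x + log_form y"
  by (auto simp: log_form_def fun_eq_iff exp_form_add[OF Der_derivation])

lemma log_form_of_rat: "log_form (of_rat q * z) = fun_scale (of_rat q) (log_form z)"
  by (auto simp: log_form_def fun_scale_def fun_eq_iff exp_form_of_rat[OF Der_derivation])

lemma log_form_base:
  assumes "z \<in> base"
  shows "log_form z = 0"
proof -
  have "exp z \<in> base"
    using assms exp_form_eq_0_iff[OF Der_derivation] by (auto simp: base_eq constants_def exp_Der_def)
  then show ?thesis unfolding log_form_eq using assms differential_base by (auto simp: fun_scale_def fun_eq_iff)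
qed

lemma span_vanish:
  assumes "v \<in> fs.span G" "\<And>g. g \<in> G \<Longrightarrow> g D = 0"
  shows "v D = 0"
proof -
  have "fs.span G \<subseteq> {v. v D = 0}"
    using assms(2) by (intro fs.span_minimal) (auto simp: fs.subspace_def fun_scale_def)
  then show ?thesis using assms(1) by blast
qed

text \<open>A linear functional on differentials, precomposed with \<open>d\<close>, is a derivation.\<close>

lemma separating_derivation:
  assumes "differential x \<notin> fs.span G"
  shows "\<exists>D\<in>Der base. D x = 1 \<and> (\<forall>z. differential z \<in> fs.span G \<longrightarrow> D z = 0) \<and>
    (\<forall>z. log_form z \<in> fs.span G \<longrightarrow> exp_form D z = 0)"
proof -
  let ?x = "differential x"
  obtain B where B: "B \<subseteq> G" "fs.independent B" "G \<subseteq> fs.span B"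
    using fs.maximal_independent_subset[of G] by blast
  have spanB: "fs.span G \<subseteq> fs.span B" by (rule fs.span_minimal[OF B(3) fs.subspace_span])
  have xB: "?x \<notin> fs.span B" using assms fs.span_mono[OF B(1)] by blast
  have ind: "fs.independent (insert ?x B)" by (rule fs.independent_insertI[OF xB B(2)])
  have "?x \<notin> B" using xB fs.span_base[of ?x B] by blast
  obtain f where lin: "Vector_Spaces.linear fun_scale (*) f"
    and f: "\<forall>v\<in>insert ?x B. f v = (if v = ?x then 1 else 0)"
    using fs_functional.linear_independent_extend[OF ind, of "\<lambda>v. if v = ?x then 1 else 0"] by blast
  interpret f: Vector_Spaces.linear fun_scale "(*)" f by (rule lin)
  have fx: "f ?x = 1" using f by simp
  have "fs.span B \<subseteq> {v. f v = 0}"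
    using f \<open>?x \<notin> B\<close> by (intro fs.span_minimal) (auto simp: fs.subspace_def f.add f.scale f.zero)
  then have fG: "f v = 0" if "v \<in> fs.span G" for v using that spanB by blast
  define D where "D z = f (differential z)" for z
  have "D \<in> Der base"
    unfolding Der_def derivation_on_def D_def
    by (auto simp: differential_add differential_mult differential_base f.add f.scale f.zero)
  moreover have "exp_form D z = f (log_form z)" for z
    unfolding exp_form_def D_def differential_exp by (simp add: f.add f.scale)
  ultimately show ?thesis using fx fG by (intro bexI[of _ D]) (simp_all add: D_def)
qed

text \<open>If \<open>s\<close> is transcendental, a derivation over the generated field with value
  1 at \<open>s\<close> separates it from the span; if \<open>differential s\<close> is outside the
  span, a separating derivation contradicts algebraicity.\<close>

lemma differential_span_iff:
  "differential s \<in> fs.span (differential ` A) \<longleftrightarrow> s \<in> algebraic_closure_in (generated_subfield (base \<union> A))"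
proof
  let ?L = "generated_subfield (base \<union> A)"
  assume s: "differential s \<in> fs.span (differential ` A)"
  show "s \<in> algebraic_closure_in ?L"
  proof (rule ccontr)
    assume "s \<notin> algebraic_closure_in ?L"
    then obtain D where D: "D \<in> Der ?L" "D s = 1" by (rule transcendental_derivation[OF subfield_generated])
    have D0: "D a = 0" if "a \<in> base \<union> A" for a
      using Der_zero[OF D(1)] that generated_subfield_superset by blast
    then have DB: "D \<in> Der base" using D(1) by (auto simp: Der_def)
    have "differential s D = 0"
      by (rule span_vanish[OF s]) (use D0 in \<open>auto simp: differential_def\<close>)
    then show False using D(2) DB by (simp add: differential_def)
  qed
next
  let ?L = "generated_subfield (base \<union> A)"
  assume s: "s \<in> algebraic_closure_in ?L"
  show "differential s \<in> fs.span (differential ` A)"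
  proof (rule ccontr)
    assume "differential s \<notin> fs.span (differential ` A)"
    then obtain D where D: "D \<in> Der base" "D s = 1" "\<forall>z. differential z \<in> fs.span (differential ` A) \<longrightarrow> D z = 0"
      using separating_derivation by blast
    have "D a = 0" if "a \<in> A" for a using D(3) that fs.span_base by blast
    then have "D \<in> Der (base \<union> A)" using D(1) by (auto simp: Der_def)
    then have "D s = 0" using Der_algebraic[OF subfield_generated s] Der_generated by blast
    then show False using D(2) by simp
  qed
qed

lemma differential_family_iff:
  assumes "finite S"
  shows "(\<forall>s\<in>S. differential s \<notin> fs.span (differential ` (S - {s}))) \<longleftrightarrow> alg_independent base S"
  unfolding differential_span_iff alg_independent_iff[OF subfield_base assms] by (rule refl)

section \<open>Transcendence degree and rational dimension as dimensions of spaces of forms\<close>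

lemma Sup_card_eq:
  assumes "\<And>S. finite S \<Longrightarrow> P S \<Longrightarrow> card S \<le> n" "finite S0" "P S0" "card S0 = n"
  shows "Sup {enat (card S) | S. finite S \<and> P S} = enat n"
proof (rule antisym)
  show "Sup {enat (card S) | S. finite S \<and> P S} \<le> enat n"
  proof (rule Sup_least)
    fix x assume "x \<in> {enat (card S) | S. finite S \<and> P S}"
    then obtain S where S: "x = enat (card S)" "finite S" "P S" by (elim CollectE exE conjE)
    show "x \<le> enat n" unfolding S(1) using assms(1)[OF S(2,3)] by simp
  qed
  show "enat n \<le> Sup {enat (card S) | S. finite S \<and> P S}"
    by (intro Sup_upper CollectI exI[of _ S0] conjI) (simp_all add: assms(2-4))
qed

abbreviation forms :: "complex set \<Rightarrow> ((complex \<Rightarrow> complex) \<Rightarrow> complex) set" where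
  "forms t \<equiv> differential ` t \<union> log_form ` t"

text \<open>Since \<open>exp z\<close> is nonzero, \<open>differential (exp z)\<close> and
  \<open>log_form z\<close> determine each other modulo \<open>differential z\<close>.\<close>

lemma span_forms: "fs.span (differential ` (t \<union> exp ` t)) = fs.span (forms t)"
  unfolding fs.span_eq
proof (intro conjI subsetI)
  have d: "differential z \<in> fs.span (forms t)" and l: "log_form z \<in> fs.span (forms t)" if "z \<in> t" for z
    using that by (auto intro: fs.span_base)
  fix v assume "v \<in> differential ` (t \<union> exp ` t)"
  then consider z where "z \<in> t" "v = differential z" | z where "z \<in> t" "v = differential (exp z)" by blast
  then show "v \<in> fs.span (forms t)"
    by cases (simp_all add: differential_exp d l fs.span_scale fs.span_add)
next
  have d: "differential z \<in> fs.span (differential ` (t \<union> exp ` t))"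
    and e: "differential (exp z) \<in> fs.span (differential ` (t \<union> exp ` t))" if "z \<in> t" for z
    using that by (auto intro: fs.span_base)
  fix v assume "v \<in> forms t"
  then consider z where "z \<in> t" "v = differential z" | z where "z \<in> t" "v = log_form z" by blast
  then show "v \<in> fs.span (differential ` (t \<union> exp ` t))"
    by cases (simp_all add: log_form_eq d e fs.span_scale fs.span_diff)
qed

text \<open>Elements of the field have differentials in the span of those of its generators, which
  bounds independent sets; generators whose differentials form a basis attain the bound.\<close>

lemma trdeg_exp_field:
  assumes t: "finite t"
  shows "trdeg base (generated_subfield (base \<union> t \<union> exp ` t)) = enat (fs.dim (forms t))"
proof -
  let ?T = "t \<union> exp ` t"
  let ?L = "generated_subfield (base \<union> ?T)"
  obtain S where S: "S \<subseteq> ?T" "differential ` ?T \<subseteq> fs.span (differential ` S)"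
    "\<forall>s\<in>S. differential s \<notin> fs.span (differential ` (S - {s}))"
    by (rule fs.select_independent_family_empty[of ?T differential])
  have finS: "finite S" using S(1) t finite_subset by blast
  have dimT: "fs.dim (forms t) = fs.dim (differential ` ?T)" using fs.span_eq_dim[OF span_forms] by simp
  have "trdeg base ?L = enat (fs.dim (differential ` ?T))"
    unfolding trdeg_def
  proof (rule Sup_card_eq[of "\<lambda>S. S \<subseteq> ?L \<and> alg_independent base S"])
    fix S' assume S': "finite S'" "S' \<subseteq> ?L \<and> alg_independent base S'"
    have "fs.independent (differential ` S') \<and> card (differential ` S') = card S'"
      using S' differential_family_iff[OF S'(1)] by (intro fs.independent_family_empty) blast+
    moreover have "differential ` S' \<subseteq> fs.span (differential ` ?T)"
      using S' subset_algebraic_closure[OF subfield_generated[of "base \<union> ?T"]] by (auto simp: differential_span_iff)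
    ultimately show "card S' \<le> fs.dim (differential ` ?T)"
      using fs.independent_card_le_dim_finite(2)[of "differential ` ?T" "differential ` S'"] t by simp
  next
    have "fs.independent (differential ` S) \<and> card (differential ` S) = card S"
      using S(3) finS by (intro fs.independent_family_empty) blast+
    then show "card S = fs.dim (differential ` ?T)"
      using fs.basis_card_eq_dim[of "differential ` S" "differential ` ?T"] S(2) image_mono[OF S(1), of differential] by simp
    show "S \<subseteq> ?L \<and> alg_independent base S"
      using S(1,3) generated_subfield_superset[of "base \<union> ?T"] differential_family_iff[OF finS] by blast
  qed (rule finS)
  then show ?thesis by (simp add: dimT Un_assoc)
qed

text \<open>Ax's theorem modulo a space of forms: \<open>G\<close> vanishes on the derivations over
  the constants of \<open>\<Delta>\<close>, and only at these is the relation evaluated.\<close>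

lemma ax_family:
  assumes \<Delta>: "\<Delta> \<subseteq> Der base" and S: "finite S" and form: "\<And>s D. s \<in> S \<Longrightarrow> D \<in> \<Delta> \<Longrightarrow> exp_form D s = 0"
    and indep: "rat_independent_mod (constants \<Delta>) S"
    and G: "\<And>g D. g \<in> G \<Longrightarrow> D \<in> Der (constants \<Delta>) \<Longrightarrow> g D = 0" and s: "s \<in> S"
  shows "log_form s \<notin> fs.span (G \<union> log_form ` (S - {s}))"
proof
  assume "log_form s \<in> fs.span (G \<union> log_form ` (S - {s}))"
  then obtain c where c: "log_form s - (\<Sum>x\<in>S - {s}. fun_scale (c x) (log_form x)) \<in> fs.span G"
    using fs.span_image_coefficients S by blast
  have \<Delta>0: "\<Delta> \<subseteq> Der {}" using \<Delta> by (auto simp: Der_def)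
  have sub: "base \<subseteq> constants \<Delta>" using \<Delta> by (auto simp: Der_def constants_def)
  have "\<forall>x\<in>S. (if x = s then 1 else - c x) = 0"
  proof (rule ax_independence[OF \<Delta>0 S, of "\<lambda>x. x"])
    show "\<forall>i\<in>S. q i = 0" if "(\<Sum>i\<in>S. of_rat (q i) * i) \<in> constants \<Delta>" for q :: "complex \<Rightarrow> rat"
      using indep that unfolding rat_independent_mod_def by blast
    show "(\<Sum>x\<in>S. (if x = s then 1 else - c x) * exp_form D x) = 0" if D: "D \<in> Der (constants \<Delta>)" for D
    proof -
      have DB: "D \<in> Der base" using D sub by (auto simp: Der_def)
      have "(log_form s - (\<Sum>x\<in>S - {s}. fun_scale (c x) (log_form x))) D = 0"
        by (rule span_vanish[OF c G[OF _ D]])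
      moreover have "(\<Sum>x\<in>A. fun_scale (c x) (log_form x)) D = (\<Sum>x\<in>A. c x * exp_form D x)" for A
        by (induction A rule: infinite_finite_induct) (simp_all add: fun_scale_def log_form_def DB)
      ultimately have "exp_form D s = (\<Sum>x\<in>S - {s}. c x * exp_form D x)" by (simp add: log_form_def DB)
      moreover have "(\<Sum>x\<in>S - {s}. (if x = s then 1 else - c x) * exp_form D x) = - (\<Sum>x\<in>S - {s}. c x * exp_form D x)"
        unfolding sum_negf[symmetric] by (intro sum.cong) auto
      ultimately show ?thesis using S s by (simp add: sum.remove[of S s])
    qed
  qed (rule form)
  then show False using s by auto
qed

lemma subspace_subfield:
  assumes "is_subfield K"
  shows "rs.subspace K"
  unfolding rs.subspace_def
  using subfield_0[OF assms] subfield_add[OF assms] subfield_mult[OF assms subfield_of_rat[OF assms]] by blast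

lemma rat_span_base: "rat_span base = base"
  unfolding rat_span_def using subspace_subfield[OF subfield_base] by (simp add: rs.span_eq_iff)

lemma log_form_rat_span:
  assumes "z \<in> rs.span (A \<union> base)"
  shows "log_form z \<in> fs.span (log_form ` A)"
proof -
  have z0: "log_form 0 = 0" using log_form_of_rat[of 0 0] by (simp add: fun_scale_def fun_eq_iff)
  have "rs.span (A \<union> base) \<subseteq> {z. log_form z \<in> fs.span (log_form ` A)}"
  proof (rule rs.span_minimal)
    have "log_form a \<in> fs.span (log_form ` A)" if "a \<in> A" for a
      using that by (intro fs.span_base imageI)
    then show "A \<union> base \<subseteq> {z. log_form z \<in> fs.span (log_form ` A)}"
      by (auto simp: log_form_base fs.span_zero)
    show "rs.subspace {z. log_form z \<in> fs.span (log_form ` A)}"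
      by (auto simp: rs.subspace_def z0 log_form_add log_form_of_rat fs.span_zero fs.span_add fs.span_scale)
  qed
  then show ?thesis using assms by blast
qed

lemma rat_span_solve:
  fixes S :: "complex set"
  assumes S: "finite S" "s \<in> S" and x: "(\<Sum>s\<in>S. of_rat (q s) * s) \<in> rs.span (S - {s} \<union> B)" and qs: "q s \<noteq> 0"
  shows "s \<in> rs.span (S - {s} \<union> B)"
proof -
  let ?V = "rs.span (S - {s} \<union> B)"
  have y: "(\<Sum>r\<in>S - {s}. of_rat (q r) * r) \<in> ?V"
  proof (rule rs.span_sum)
    fix r assume "r \<in> S - {s}"
    then have "r \<in> ?V" by (intro rs.span_base UnI1)
    then show "of_rat (q r) * r \<in> ?V" by (rule rs.span_scale)
  qed
  have "(\<Sum>s\<in>S. of_rat (q s) * s) = of_rat (q s) * s + (\<Sum>r\<in>S - {s}. of_rat (q r) * r)"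
    by (rule sum.remove[OF S])
  then have "of_rat (q s) * s = (\<Sum>s\<in>S. of_rat (q s) * s) - (\<Sum>r\<in>S - {s}. of_rat (q r) * r)" by simp
  then have "of_rat (q s) * s \<in> ?V" using rs.span_diff[OF x y] by simp
  then have "of_rat (inverse (q s)) * (of_rat (q s) * s) \<in> ?V" by (rule rs.span_scale)
  moreover have "of_rat (inverse (q s)) * (of_rat (q s) * s) = s"
    using qs by (simp add: of_rat_inverse)
  ultimately show ?thesis by (simp only:)
qed

text \<open>\<open>log_form\<close> is rationally linear and kills \<open>base\<close>, so elements
  with independent forms are independent modulo \<open>base\<close>. The converse is Ax's theorem
  for \<open>exp_Der\<close>, whose constants are \<open>base\<close>.\<close>

lemma rat_lin_dim_eq:
  assumes t: "finite t"
  shows "rat_lin_dim t base = enat (fs.dim (log_form ` t))"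
proof -
  obtain S where S: "S \<subseteq> t" "log_form ` t \<subseteq> fs.span (log_form ` S)"
    "\<forall>s\<in>S. log_form s \<notin> fs.span (log_form ` (S - {s}))"
    by (rule fs.select_independent_family_empty[of t log_form])
  have finS: "finite S" using S(1) t finite_subset by blast
  have "fs.independent (log_form ` S) \<and> card (log_form ` S) = card S"
    using S(3) finS by (intro fs.independent_family_empty) blast+
  then have cardS: "card S = fs.dim (log_form ` t)"
    using fs.basis_card_eq_dim[of "log_form ` S" "log_form ` t"] S(2) image_mono[OF S(1), of log_form] by simp
  have indS: "q s = 0" if q: "(\<Sum>s\<in>S. of_rat (q s) * s) \<in> base" and s: "s \<in> S" for q s
  proof (rule ccontr)
    assume "q s \<noteq> 0"
    moreover have "(\<Sum>s\<in>S. of_rat (q s) * s) \<in> rs.span ((S - {s}) \<union> base)"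
      by (rule rs.span_base) (use q in blast)
    ultimately have "s \<in> rs.span ((S - {s}) \<union> base)" by (intro rat_span_solve[OF finS s])
    then have "log_form s \<in> fs.span (log_form ` (S - {s}))" by (rule log_form_rat_span)
    then show False using S(3) s by auto
  qed
  show ?thesis
    unfolding rat_lin_dim_def rat_span_base
  proof (rule Sup_card_eq[of "\<lambda>S. S \<subseteq> rat_span (t \<union> base) \<and> rat_independent_mod base S"])
  fix S assume S: "finite S" "S \<subseteq> rat_span (t \<union> base) \<and> rat_independent_mod base S"
  have form: "exp_form D s = 0" if "D \<in> exp_Der" for D s using that by (simp add: exp_Der_def)
  have ind: "rat_independent_mod (constants exp_Der) S" using S(2) unfolding base_eq ..
  have "log_form s \<notin> fs.span ({} \<union> log_form ` (S - {s}))" if "s \<in> S" for s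
    by (rule ax_family[OF exp_Der_subset S(1) form ind _ that]) simp_all
  then have "log_form s \<notin> fs.span (log_form ` (S - {s}))" if "s \<in> S" for s using that by simp
  then have "fs.independent (log_form ` S) \<and> card (log_form ` S) = card S"
    using S(1) by (intro fs.independent_family_empty) blast+
  moreover have "log_form ` S \<subseteq> fs.span (log_form ` t)"
    using S(2) log_form_rat_span by (auto simp: rat_span_def)
  ultimately show "card S \<le> fs.dim (log_form ` t)"
    using fs.independent_card_le_dim_finite(2)[of "log_form ` t" "log_form ` S"] t by simp
next
  show "S \<subseteq> rat_span (t \<union> base) \<and> rat_independent_mod base S"
    using S(1) rs.span_superset[of "t \<union> base"] indS unfolding rat_independent_mod_def rat_span_def by blast
  qed (rule finS, rule cardS)
qed

section \<open>Strong extensions\<close>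

text \<open>A maximal part of \<open>s\<close> that stays independent on top of a rational basis
  \<open>B\<close> of \<open>K\<close>.\<close>

lemma rat_complement:
  assumes K: "is_subfield K" and s: "finite s"
  shows "\<exists>S\<subseteq>s. rat_independent_mod K S \<and> (\<forall>x\<in>s. \<exists>k\<in>K. x - k \<in> rs.span S)"
proof -
  obtain B where B: "B \<subseteq> K" "rs.independent B" "K \<subseteq> rs.span B"
    using rs.maximal_independent_subset[of K] by blast
  have spanB: "rs.span B = K"
    using B(3) rs.span_minimal[OF B(1) subspace_subfield[OF K]] by blast
  obtain S where S: "S \<subseteq> s" "(\<lambda>x. x) ` s \<subseteq> rs.span (B \<union> (\<lambda>x. x) ` S)"
    "\<forall>x\<in>S. x \<notin> rs.span (B \<union> (\<lambda>x. x) ` (S - {x}))"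
    by (rule rs.select_independent_family[OF B(2), of s "\<lambda>x. x"])
  have finS: "finite S" using S(1) s finite_subset by blast
  have "q x = 0" if q: "(\<Sum>s\<in>S. of_rat (q s) * s) \<in> K" and x: "x \<in> S" for q x
  proof (rule ccontr)
    assume "q x \<noteq> 0"
    moreover have "(\<Sum>s\<in>S. of_rat (q s) * s) \<in> rs.span (S - {x} \<union> B)"
      using q rs.span_mono[of B "S - {x} \<union> B"] unfolding spanB by blast
    ultimately have "x \<in> rs.span (S - {x} \<union> B)" by (intro rat_span_solve[OF finS x])
    then show False using S(3) x by (simp add: Un_commute)
  qed
  then have "rat_independent_mod K S" unfolding rat_independent_mod_def by blast
  moreover have "\<exists>k\<in>K. x - k \<in> rs.span S" if "x \<in> s" for x
  proof -
    have "x \<in> rs.span (B \<union> S)" using S(2) that by auto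
    then obtain k y where ky: "k \<in> rs.span B" "y \<in> rs.span S" "x = k + y" unfolding rs.span_Un by blast
    then have "x - k = y" by simp
    then show ?thesis using ky spanB by blast
  qed
  ultimately show ?thesis using S(1) by blast
qed

text \<open>Modularity: \<open>v\<close> witnesses that \<open>X\<close> and \<open>Z\<close> intersect in more than \<open>span Y\<close>.\<close>

lemma (in vector_space) dim_Un_lt:
  assumes fin: "finite X" "finite Z" and sub: "Y \<subseteq> span X" "Y \<subseteq> Z" and v: "v \<in> span X" "v \<in> span Z" "v \<notin> span Y"
  shows "dim (X \<union> Z) + dim Y < dim X + dim Z"
proof -
  obtain B where B: "B \<subseteq> Y" "independent B" "Y \<subseteq> span B" "card B = dim Y"
    using basis_exists by blast
  have finB: "finite B" by (rule finite_subset[OF subset_trans[OF B(1) sub(2)] fin(2)])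
  have vB: "v \<notin> span B" using v(3) span_mono[OF B(1)] by blast
  then have vB': "v \<notin> B" using span_base[of v B] by blast
  have ind: "independent (insert v B)" by (rule independent_insertI[OF vB B(2)])
  \<comment> \<open>Bases of both spans through \<open>insert v B\<close>: they share more than
    \<open>dim Y\<close> elements, so their union is small.\<close>
  have ext: "\<exists>C. insert v B \<subseteq> C \<and> A \<subseteq> span C \<and> finite C \<and> card C = dim A"
    if A: "finite A" "v \<in> span A" "Y \<subseteq> span A" for A
  proof -
    obtain C where C: "insert v B \<subseteq> C" "C \<subseteq> insert v B \<union> A" "independent C" "insert v B \<union> A \<subseteq> span C"
      using maximal_independent_subset_extend[of "insert v B" "insert v B \<union> A"] ind by blast
    have finC: "finite C" using finite_subset[OF C(2)] A(1) finB by simp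
    have "insert v B \<union> A \<subseteq> span A" using A(2,3) B(1) span_superset[of A] by blast
    then have "span C = span A"
      unfolding span_eq using C(2,4) by blast
    then have "dim C = dim A" by (rule span_eq_dim)
    then show ?thesis using C finC dim_eq_card_independent[OF C(3)] by (intro exI[of _ C]) auto
  qed
  obtain C1 where C1: "insert v B \<subseteq> C1" "X \<subseteq> span C1" "finite C1" "card C1 = dim X"
    using ext[OF fin(1) v(1) sub(1)] by blast
  have "Y \<subseteq> span Z" using sub(2) span_superset[of Z] by blast
  then obtain C2 where C2: "insert v B \<subseteq> C2" "Z \<subseteq> span C2" "finite C2" "card C2 = dim Z"
    using ext[OF fin(2) v(2)] by blast
  have "X \<union> Z \<subseteq> span (C1 \<union> C2)"
    using C1(2) C2(2) span_mono[of C1 "C1 \<union> C2"] span_mono[of C2 "C1 \<union> C2"] by blast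
  then have "dim (X \<union> Z) \<le> card (C1 \<union> C2)" using dim_le_card C1(3) C2(3) by blast
  moreover have "card (C1 \<union> C2) + card (C1 \<inter> C2) = dim X + dim Z"
    using card_Un_Int[OF C1(3) C2(3)] C1(4) C2(4) by simp
  moreover have "card (insert v B) \<le> card (C1 \<inter> C2)"
    using C1(1,3) C2(1) by (intro card_mono) auto
  moreover have "card (insert v B) = Suc (dim Y)" using vB' finB B(4) by simp
  ultimately show ?thesis by linarith
qed

lemma (in vector_space) dim_Un_family:
  assumes "finite X" "finite S" "\<And>x. x \<in> S \<Longrightarrow> f x \<notin> span (X \<union> f ` (S - {x}))" "finite Z" "X \<subseteq> span Z" "f ` S \<subseteq> span Z"
  shows "dim X + card S \<le> dim Z"
proof -
  obtain B where B: "B \<subseteq> X" "independent B" "X \<subseteq> span B" "card B = dim X"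
    using basis_exists by blast
  have finB: "finite B" by (rule finite_subset[OF B(1) assms(1)])
  have "f x \<notin> span (B \<union> f ` (S - {x}))" if "x \<in> S" for x
    using assms(3)[OF that] span_mono[of "B \<union> f ` (S - {x})" "X \<union> f ` (S - {x})"] B(1) by blast
  then have "independent (B \<union> f ` S) \<and> card (B \<union> f ` S) = card B + card S"
    by (rule independent_family[OF assms(2) finB B(2)])
  moreover have "B \<union> f ` S \<subseteq> span Z" using B(1) assms(5,6) by blast
  ultimately show ?thesis using independent_card_le_dim_finite(2)[OF assms(4), of "B \<union> f ` S"] B(4) by simp
qed

text \<open>Kirby's theorem that exponential derivations extend along strong extensions, in dual form. If \<open>v\<close> were not
  in the span of \<open>log_form ` t\<close>, it would involve finitely many further logarithmic forms, at \<open>s\<close>. Over the field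
  \<open>K\<close> of constants of the derivations vanishing on the resulting space, \<open>s\<close> splits into a part \<open>S\<close> independent
  modulo \<open>K\<close>, to which Ax's theorem applies, and a part in \<open>K\<close>, to which the minimality of \<open>t\<close> applies.\<close>

lemma strong_intersection:
  assumes t: "finite t"
    and min: "\<And>t'. finite t' \<Longrightarrow> t \<subseteq> t' \<Longrightarrow>
      fs.dim (forms t) + fs.dim (log_form ` t') \<le> fs.dim (forms t') + fs.dim (log_form ` t)"
    and v: "v \<in> fs.span (forms t)" "v \<in> fs.span (range log_form)"
  shows "v \<in> fs.span (log_form ` t)"
proof (rule ccontr)
  assume nv: "v \<notin> fs.span (log_form ` t)"
  obtain A where A: "finite A" "A \<subseteq> range log_form" "v \<in> fs.span A"
    using v(2) unfolding fs.span_explicit by (fastforce intro: fs.span_sum fs.span_scale fs.span_base)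
  obtain s0 where s0: "finite s0" "A = log_form ` s0" using finite_subset_image[OF A(1,2)] by blast
  define s where "s = t \<union> s0"
  have s: "finite s" "t \<subseteq> s" using t s0(1) by (auto simp: s_def)
  have vs: "v \<in> fs.span (log_form ` s)"
    using A(3) fs.span_mono[of A "log_form ` s"] unfolding s0(2) s_def by blast
  define G where "G = forms t \<union> log_form ` s"
  have finG: "finite G" using t s by (simp add: G_def)
  have lt: "fs.dim G + fs.dim (log_form ` t) < fs.dim (forms t) + fs.dim (log_form ` s)"
    unfolding G_def using t s v(1) vs nv
    by (intro fs.dim_Un_lt) (auto intro: fs.span_base)
  \<comment> \<open>The annihilator of \<open>G\<close>. By duality, \<open>K\<close> consists
    exactly of the \<open>z\<close> with \<open>differential z\<close> in the span of
    \<open>G\<close>.\<close>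
  define \<Delta> where "\<Delta> = {D \<in> Der base. \<forall>g\<in>G. g D = 0}"
  define K where "K = constants \<Delta>"
  have \<Delta>: "\<Delta> \<subseteq> Der base" by (auto simp: \<Delta>_def)
  have \<Delta>0: "\<Delta> \<subseteq> Der {}" using \<Delta> by (auto simp: Der_def)
  have K: "is_subfield K" unfolding K_def by (rule subfield_constants[OF \<Delta>0])
  have baseK: "base \<subseteq> K" using \<Delta> by (auto simp: K_def constants_def Der_def)
  have vanish: "g D = 0" if "g \<in> fs.span G" "D \<in> \<Delta>" for g D
    using that(2) by (intro span_vanish[OF that(1)]) (auto simp: \<Delta>_def)
  have K_G: "differential z \<in> fs.span G" if z: "z \<in> K" for z
  proof (rule ccontr)
    assume "differential z \<notin> fs.span G"
    then obtain D where D: "D \<in> Der base" "D z = 1" "\<forall>z. differential z \<in> fs.span G \<longrightarrow> D z = 0"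
      "\<forall>z. log_form z \<in> fs.span G \<longrightarrow> exp_form D z = 0"
      using separating_derivation by blast
    have "g D = 0" if g: "g \<in> G" for g
    proof -
      have "g \<in> fs.span G" using g by (rule fs.span_base)
      moreover have "(\<exists>z. g = differential z) \<or> (\<exists>z. g = log_form z)" using g by (auto simp: G_def)
      ultimately show ?thesis using D(1,3,4) by (auto simp: differential_def log_form_def)
    qed
    then have "D \<in> \<Delta>" using D(1) by (simp add: \<Delta>_def)
    then show False using z D(2) by (auto simp: K_def constants_def)
  qed
  have form0: "exp_form D z = 0" if "log_form z \<in> fs.span G" "D \<in> \<Delta>" for z D
    using vanish[OF that] that(2) \<Delta> by (simp add: log_form_def subset_iff)
  have G_K: "z \<in> K" if "differential z \<in> fs.span G" for z
  proof -
    have "D z = 0" if D: "D \<in> \<Delta>" for D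
      using vanish[OF \<open>differential z \<in> fs.span G\<close> D] \<Delta> D by (simp add: differential_def subset_iff)
    then show ?thesis by (simp add: K_def constants_def)
  qed
  have log_s: "log_form z \<in> fs.span G" if "z \<in> s" for z
    using that by (intro fs.span_base) (simp add: G_def)
  obtain S where S: "S \<subseteq> s" "rat_independent_mod K S" "\<forall>x\<in>s. \<exists>k\<in>K. x - k \<in> rs.span S"
    using rat_complement[OF K s(1)] by blast
  from S(3) obtain \<kappa> where \<kappa>: "\<forall>x\<in>s. \<kappa> x \<in> K \<and> x - \<kappa> x \<in> rs.span S" by (metis (no_types))
  have finS: "finite S" using S(1) s finite_subset by blast
  \<comment> \<open>The candidate violating minimality: each element of \<open>s\<close> contributes
    its part in \<open>K\<close>, which differs from it by a rational combination of
    \<open>S\<close>.\<close>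
  define t' where "t' = t \<union> \<kappa> ` s"
  have t': "finite t'" "t \<subseteq> t'" using t s by (auto simp: t'_def)
  have log_\<kappa>: "log_form x = log_form (\<kappa> x) + log_form (x - \<kappa> x)" for x
    using log_form_add[of "\<kappa> x" "x - \<kappa> x"] by simp
  have log_S: "log_form (x - \<kappa> x) \<in> fs.span (log_form ` S)" if "x \<in> s" for x
    using \<kappa> that rs.span_mono[of S "S \<union> base"] by (intro log_form_rat_span) auto
  have S_G: "fs.span (log_form ` S) \<subseteq> fs.span G"
    using S(1) by (intro fs.span_mono) (auto simp: G_def)
  have t'_K: "z \<in> K" and t'_G: "log_form z \<in> fs.span G" if z: "z \<in> t'" for z
  proof -
    have *: "z \<in> K \<and> log_form z \<in> fs.span G"
    proof (cases "z \<in> t")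
      case True
      then have "differential z \<in> fs.span G" "log_form z \<in> fs.span G"
        by (auto simp: G_def intro: fs.span_base)
      then show ?thesis using G_K by blast
    next
      case False
      then obtain x where x: "x \<in> s" "z = \<kappa> x" using z by (auto simp: t'_def)
      have eq: "log_form z = log_form x - log_form (x - \<kappa> x)" using log_\<kappa>[of x] x(2) by simp
      have "log_form z \<in> fs.span G"
        unfolding eq by (rule fs.span_diff[OF log_s[OF x(1)] subsetD[OF S_G log_S[OF x(1)]]])
      then show ?thesis using \<kappa> x by blast
    qed
    show "z \<in> K" "log_form z \<in> fs.span G" using * by blast+
  qed
  \<comment> \<open>All these forms lie in the span of \<open>G\<close>, and by Ax's theorem those
    at \<open>S\<close> are independent modulo \<open>forms t'\<close>.\<close>
  have "fs.dim (forms t') + card S \<le> fs.dim G"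
  proof (rule fs.dim_Un_family[where f = log_form])
    show "forms t' \<subseteq> fs.span G" by (intro Un_least image_subsetI K_G t'_K t'_G)
    show "log_form ` S \<subseteq> fs.span G" using S(1) by (intro image_subsetI log_s) blast
    show "log_form x \<notin> fs.span (forms t' \<union> log_form ` (S - {x}))" if x: "x \<in> S" for x
    proof (rule ax_family[OF \<Delta> finS _ _ _ x])
      show "exp_form D z = 0" if "z \<in> S" "D \<in> \<Delta>" for z D
        using form0[OF log_s] S(1) that by blast
      show "rat_independent_mod (constants \<Delta>) S" using S(2) by (simp add: K_def)
      show "g D = 0" if g: "g \<in> forms t'" and D: "D \<in> Der (constants \<Delta>)" for g D
      proof -
        have DK: "D z = 0" if "z \<in> K" for z using Der_zero[OF D] that by (simp add: K_def)
        have "exp z \<in> K" if z: "z \<in> t'" for z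
        proof -
          have "D' (exp z) = 0" if D': "D' \<in> \<Delta>" for D'
          proof -
            have "D' z = 0" using t'_K[OF z] D' by (simp add: K_def constants_def)
            moreover have "D' (exp z) = exp z * D' z"
              using form0[OF t'_G[OF z] D'] exp_form_eq_0_iff[OF Der_derivation, of D' base z] D' \<Delta> by blast
            ultimately show ?thesis by simp
          qed
          then show ?thesis by (simp add: K_def constants_def)
        qed
        then have "exp_form D z = 0" "D z = 0" if "z \<in> t'" for z
          using that DK t'_K by (simp_all add: exp_form_def)
        then show ?thesis using g by (auto simp: differential_def log_form_def)
      qed
    qed
  qed (use t' finS finG in auto)
  moreover have "fs.dim (log_form ` s) \<le> fs.dim (log_form ` t') + card S"
  proof -
    obtain B where B: "B \<subseteq> log_form ` t'" "log_form ` t' \<subseteq> fs.span B" "card B = fs.dim (log_form ` t')"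
      by (rule fs.basis_exists[of "log_form ` t'"])
    have finB: "finite B" using finite_subset[OF B(1)] t'(1) by simp
    have "log_form x \<in> fs.span (B \<union> log_form ` S)" if x: "x \<in> s" for x
    proof -
      have "log_form (\<kappa> x) \<in> fs.span B" using B(2) x by (auto simp: t'_def)
      then have "log_form (\<kappa> x) \<in> fs.span (B \<union> log_form ` S)" using fs.span_mono[of B "B \<union> log_form ` S"] by blast
      moreover have "log_form (x - \<kappa> x) \<in> fs.span (B \<union> log_form ` S)"
        using log_S[OF x] fs.span_mono[of "log_form ` S" "B \<union> log_form ` S"] by blast
      ultimately show ?thesis unfolding log_\<kappa>[of x] by (rule fs.span_add)
    qed
    then have "fs.dim (log_form ` s) \<le> card (B \<union> log_form ` S)"
      using finB finS by (intro fs.dim_le_card) auto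
    also have "\<dots> \<le> card B + card S"
      using card_Un_le[of B "log_form ` S"] card_image_le[OF finS, of log_form] by linarith
    finally show ?thesis using B(3) by simp
  qed
  \<comment> \<open>\<open>card S\<close> cancels between the two estimates, and the strict
    inequality \<open>lt\<close> remains.\<close>
  ultimately show False using min[OF t'] lt by linarith
qed

text \<open>\<open>S\<close> completes a basis of the logarithmic forms of \<open>t\<close> to a
  basis of all its forms. \<open>strong\<close> keeps the differentials of \<open>S\<close>
  independent modulo every logarithmic form, so exponential derivations separate the elements of
  \<open>S\<close>.\<close>

lemma exp_dim_eq:
  assumes t: "finite t"
    and strong: "\<And>v. v \<in> fs.span (forms t) \<Longrightarrow> v \<in> fs.span (range log_form) \<Longrightarrow> v \<in> fs.span (log_form ` t)"
  shows "enat (fs.dim (log_form ` t)) + exp_dim t base = enat (fs.dim (forms t))"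
proof -
  let ?O = "log_form ` t" and ?U = "forms t"
  obtain B where B: "B \<subseteq> ?O" "fs.independent B" "?O \<subseteq> fs.span B" "card B = fs.dim ?O"
    by (rule fs.basis_exists[of ?O])
  have finB: "finite B" using finite_subset[OF B(1)] t by simp
  obtain S where S: "S \<subseteq> t" "differential ` t \<subseteq> fs.span (B \<union> differential ` S)"
    "\<forall>x\<in>S. differential x \<notin> fs.span (B \<union> differential ` (S - {x}))"
    by (rule fs.select_independent_family[OF B(2), of t differential])
  have finS: "finite S" using S(1) t finite_subset by blast
  have card: "fs.dim ?O + card S = fs.dim ?U"
  proof -
    have ind: "fs.independent (B \<union> differential ` S) \<and> card (B \<union> differential ` S) = card B + card S"
      using S(3) by (intro fs.independent_family[OF finS finB B(2)]) blast
    have "?U \<subseteq> fs.span (B \<union> differential ` S)"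
      using S(2) B(3) fs.span_mono[of B "B \<union> differential ` S"] by blast
    moreover have "B \<union> differential ` S \<subseteq> ?U" using B(1) S(1) by blast
    ultimately show ?thesis using fs.basis_card_eq_dim[of "B \<union> differential ` S" ?U] ind B(4) by simp
  qed
  have ind_iff: "pregeometry_independent ecl base R \<longleftrightarrow>
    (\<forall>r\<in>R. \<exists>D\<in>exp_Der. (\<forall>a\<in>R - {r}. D a = 0) \<and> D r \<noteq> 0)" for R
    unfolding pregeometry_independent_def ecl_base_iff by blast
  \<comment> \<open>An exponential derivation witnessing independence of \<open>r\<close> kills all
    logarithmic forms, so the differentials of \<open>R\<close> are independent modulo those of
    \<open>t\<close>.\<close>
  have upper: "card R \<le> card S" if R: "finite R" "R \<subseteq> t \<and> pregeometry_independent ecl base R" for R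
  proof -
    have Rt: "R \<subseteq> t" using R(2) by blast
    have "fs.dim ?O + card R \<le> fs.dim ?U"
    proof (rule fs.dim_Un_family[where f = differential])
      fix r assume r: "r \<in> R"
      then obtain D where D: "D \<in> exp_Der" "\<forall>a\<in>R - {r}. D a = 0" "D r \<noteq> 0" using R(2) ind_iff by blast
      show "differential r \<notin> fs.span (?O \<union> differential ` (R - {r}))"
      proof
        assume "differential r \<in> fs.span (?O \<union> differential ` (R - {r}))"
        then have "differential r D = 0"
        proof (rule span_vanish)
          fix g assume "g \<in> ?O \<union> differential ` (R - {r})"
          then consider z where "g = log_form z" | z where "z \<in> R - {r}" "g = differential z" by blast
          then show "g D = 0"
            using D(1,2) by cases (auto simp: log_form_def differential_def exp_Der_def)
        qed
        moreover have "D \<in> Der base" using D(1) exp_Der_subset by blast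
        ultimately show False using D(3) by (simp add: differential_def)
      qed
    next
      show "differential ` R \<subseteq> fs.span ?U" using Rt by (intro image_subsetI fs.span_base) blast
      show "?O \<subseteq> fs.span ?U" by (intro image_subsetI fs.span_base) blast
    qed (use t R(1) in simp_all)
    then show ?thesis using card by linarith
  qed
  have "differential x \<notin> fs.span (range log_form \<union> differential ` (S - {x}))" if x: "x \<in> S" for x
  proof
    assume "differential x \<in> fs.span (range log_form \<union> differential ` (S - {x}))"
    then obtain v w where vw: "v \<in> fs.span (range log_form)" "w \<in> fs.span (differential ` (S - {x}))" "differential x = v + w"
      unfolding fs.span_Un by blast
    have "differential ` (S - {x}) \<subseteq> ?U" using S(1) by blast
    then have "w \<in> fs.span ?U" using vw(2) fs.span_mono[of "differential ` (S - {x})" ?U] by blast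
    moreover have "differential x \<in> fs.span ?U" using x S(1) by (intro fs.span_base) blast
    moreover have "v = differential x - w" using vw(3) by simp
    \<comment> \<open>The logarithmic part \<open>v\<close> of a dependency lies among the forms of
      \<open>t\<close>; \<open>strong\<close> puts it into the span of \<open>B\<close>, where the
      choice of \<open>S\<close> excludes it.\<close>
    ultimately have "v \<in> fs.span ?U" using fs.span_diff by simp
    then have "v \<in> fs.span ?O" using strong vw(1) by blast
    then have "v \<in> fs.span B" using fs.span_minimal[OF B(3) fs.subspace_span] by blast
    then have "differential x \<in> fs.span (B \<union> differential ` (S - {x}))"
      unfolding fs.span_Un using vw(2,3) by blast
    then show False using S(3) x by blast
  qed
  note indep = this
  have "\<exists>D\<in>exp_Der. (\<forall>a\<in>S - {x}. D a = 0) \<and> D x \<noteq> 0" if x: "x \<in> S" for x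
  proof -
    let ?G = "range log_form \<union> differential ` (S - {x})"
    obtain D where D: "D \<in> Der base" "D x = 1" "\<forall>z. differential z \<in> fs.span ?G \<longrightarrow> D z = 0"
      "\<forall>z. log_form z \<in> fs.span ?G \<longrightarrow> exp_form D z = 0"
      using separating_derivation[OF indep[OF x]] by blast
    have "exp_form D z = 0" for z using D(4) fs.span_base[of "log_form z" ?G] by blast
    then have "D \<in> exp_Der" using D(1) by (auto simp: exp_Der_def Der_def)
    moreover have "D a = 0" if "a \<in> S - {x}" for a
      using D(3) fs.span_base[of "differential a" ?G] that by blast
    ultimately show ?thesis using D(2) by (intro bexI[of _ D]) auto
  qed
  then have lower: "S \<subseteq> t \<and> pregeometry_independent ecl base S" using S(1) ind_iff by blast
  have "exp_dim t base = enat (card S)"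
    unfolding pregeometry_dim_def
    by (rule Sup_card_eq[of "\<lambda>S. S \<subseteq> t \<and> pregeometry_independent ecl base S", OF upper finS lower refl])
  then show ?thesis using card by simp
qed

theorem theorem5p6:
  fixes F E :: "complex set"
  defines "E \<equiv> ecl {}"
  assumes "is_subfield F"
    and "trdeg E F < \<infinity>"
  shows "\<exists>ts :: complex list.
    F \<subseteq> algebraic_closure_in (generated_subfield (E \<union> set ts \<union> exp ` set ts)) \<and>
    trdeg E (generated_subfield (E \<union> set ts \<union> exp ` set ts)) =
      rat_lin_dim (set ts) E + exp_dim (set ts) E"
proof -
  let ?indep = "\<lambda>S. finite S \<and> S \<subseteq> F \<and> alg_independent E S"
  obtain n where n: "trdeg E F = enat n" using assms(3) by (cases "trdeg E F") auto
  have bound: "card S \<le> n" if "?indep S" for S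
  proof -
    have "enat (card S) \<le> trdeg E F" unfolding trdeg_def using that by (intro Sup_upper) blast
    then show ?thesis by (simp add: n)
  qed
  have "?indep {}" using alg_independent_iff[OF subfield_base, of "{}"] by (simp add: E_def)
  \<comment> \<open>A transcendence basis of largest size. The strict bound needed here is
    \<open>Suc n\<close>, as sizes may reach \<open>n\<close>.\<close>
  then obtain t0 where t0: "?indep t0" and max: "\<And>S. ?indep S \<Longrightarrow> card S \<le> card t0"
    using ex_has_greatest_nat[of ?indep "{}" card "Suc n"] bound by (metis less_Suc_eq_le)
  \<comment> \<open>Otherwise the exchange property of spans would make \<open>insert f t0\<close> a
    larger independent set.\<close>
  have F_span: "differential f \<in> fs.span (differential ` t0)" if f: "f \<in> F" for f
  proof (rule ccontr)
    assume nf: "differential f \<notin> fs.span (differential ` t0)"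
    have "f \<notin> t0" using nf by (auto intro: fs.span_base)
    obtain D where D: "D \<in> Der base" "D f = 1" "\<forall>z. differential z \<in> fs.span (differential ` t0) \<longrightarrow> D z = 0"
      using separating_derivation[OF nf] by blast
    have ind0: "\<forall>s\<in>t0. differential s \<notin> fs.span (differential ` (t0 - {s}))"
      using t0 differential_family_iff by (auto simp: E_def)
    have "differential s \<notin> fs.span (differential ` (insert f t0 - {s}))" if s: "s \<in> insert f t0" for s
    proof (cases "s = f")
      case True
      then show ?thesis using nf \<open>f \<notin> t0\<close> by simp
    next
      case False
      then have s: "s \<in> t0" using s by simp
      have eq: "differential ` (insert f t0 - {s}) = insert (differential f) (differential ` (t0 - {s}))"
        using False by auto
      show ?thesis
      proof
        assume "differential s \<in> fs.span (differential ` (insert f t0 - {s}))"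
        then have "differential f \<in> fs.span (insert (differential s) (differential ` (t0 - {s})))"
          unfolding eq using fs.in_span_insert ind0 s by blast
        moreover have "insert (differential s) (differential ` (t0 - {s})) = differential ` t0" using s by blast
        ultimately show False using nf by simp
      qed
    qed
    then have "alg_independent E (insert f t0)"
      using t0 differential_family_iff[of "insert f t0"] by (simp add: E_def)
    then have "card (insert f t0) \<le> card t0" using max[of "insert f t0"] t0 f by blast
    then show False using t0 \<open>f \<notin> t0\<close> by simp
  qed
  \<comment> \<open>The quantity to minimize. By \<open>le\<close>, the subtraction of natural
    numbers is not truncated for finite sets.\<close>
  define predim where "predim t = fs.dim (forms t) - fs.dim (log_form ` t)" for t
  have le: "fs.dim (log_form ` t) \<le> fs.dim (forms t)" if "finite t" for t
  proof (rule fs.dim_mono_finite)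
    show "log_form ` t \<subseteq> fs.span (forms t)" by (intro image_subsetI fs.span_base) blast
  qed (use that in simp)
  obtain t where t: "finite t" "t0 \<subseteq> t" and min: "\<And>t'. finite t' \<Longrightarrow> t0 \<subseteq> t' \<Longrightarrow> predim t \<le> predim t'"
    using ex_has_least_nat[of "\<lambda>t. finite t \<and> t0 \<subseteq> t" t0 predim] t0 by auto
  have strong: "v \<in> fs.span (log_form ` t)" if "v \<in> fs.span (forms t)" "v \<in> fs.span (range log_form)" for v
  proof (rule strong_intersection[OF t(1) _ that])
    fix t' assume t': "finite t'" "t \<subseteq> t'"
    then have "predim t \<le> predim t'" using min t(2) by blast
    then show "fs.dim (forms t) + fs.dim (log_form ` t') \<le> fs.dim (forms t') + fs.dim (log_form ` t)"
      using le[OF t(1)] le[OF t'(1)] unfolding predim_def by linarith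
  qed
  obtain ts where ts: "set ts = t" using finite_list[OF t(1)] by blast
  have "F \<subseteq> algebraic_closure_in (generated_subfield (E \<union> t \<union> exp ` t))"
  proof
    fix f assume "f \<in> F"
    have "differential ` t0 \<subseteq> differential ` (t \<union> exp ` t)" using t(2) by blast
    then have "differential f \<in> fs.span (differential ` (t \<union> exp ` t))"
      using F_span[OF \<open>f \<in> F\<close>] fs.span_mono[of "differential ` t0" "differential ` (t \<union> exp ` t)"] by blast
    then show "f \<in> algebraic_closure_in (generated_subfield (E \<union> t \<union> exp ` t))"
      unfolding differential_span_iff E_def Un_assoc .
  qed
  moreover have "trdeg E (generated_subfield (E \<union> t \<union> exp ` t)) = rat_lin_dim t E + exp_dim t E"
    unfolding E_def trdeg_exp_field[OF t(1)] rat_lin_dim_eq[OF t(1)]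
    by (rule exp_dim_eq[OF t(1), symmetric]) (rule strong)
  ultimately show ?thesis unfolding ts[symmetric] by blast
qed

end
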